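(* Assume $\xi$ is non-degenerate and $\vec h=\vec0$. There exists $\varepsilon>0$ such that the map $F_t:\Delta^r\to\Delta^r$ is injective for $t\in(0,\varepsilon]$. Moreover $F_t$ is surjective for all $t>0$.
   Context: Let $\mathscr S=\{1,\dots,r\}$, $\vec\lambda\in\mathbb R_{>0}^{\mathscr S}$ with $\sum_s\lambda_s=1$. For each $k\ge2$ let $\Gamma^{(k)}=(\gamma_{s_1,\dots,s_k})\in(\mathbb R_{\ge0}^{\mathscr S})^{\otimes k}$ be symmetric, with $\sum_{k\ge2}2^k\|\Gamma^{(k)}\|_\infty<\infty$; $\xi(\vec x)=\sum_{k\ge2}\sum_{s_1,\dots,s_k}\gamma_{s_1,\dots,s_k}^2(\lambda_{s_1}x_{s_1})\cdots(\lambda_{s_k}x_{s_k})$ and $\xi^s=\lambda_s^{-1}\partial_{x_s}\xi$. Non-degenerate means that all entries of $\Gamma^{(2)},\Gamma^{(3)}$ are strictly positive. Let $\Delta^r=\{\vec v\in\mathbb R_{\ge0}^{\mathscr S}:\langle\vec\lambda,\vec v\rangle=1\}$. For $\vec v\in\Delta^r$ set $F_t(\vec v)=\Phi(t)/t$, where $\Phi$ is the solution started from $\Phi(0)=\vec0$, $\Phi'(0)=\vec v$ of the tree-descending ODE $$\frac1{\Phi_s'(q)}\frac{d}{dq}\sqrt{\frac{\Phi_s'(q)}{(\xi^s\circ\Phi)'(q)}}=\frac1{\Phi_{s'}'(q)}\frac{d}{dq}\sqrt{\frac{\Phi_{s'}'(q)}{(\xi^{s'}\circ\Phi)'(q)}}\qquad\forall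 s,s'\in\mathscr S,$$ subject to $\langle\vec\lambda,\Phi(q)\rangle=q$ (so $\langle\vec\lambda,\Phi''\rangle=0$). Where some $\Phi_s'$ vanish the ODE is read in the equivalent division-free form: there is $\Psi(q)$, independent of $s$, with $\Phi_s''(\xi^s\circ\Phi)'-\Phi_s'(\xi^s\circ\Phi)''=2\Psi\big(\Phi_s'(\xi^s\circ\Phi)'\big)^{3/2}$ for all $s$. The solution is unique and satisfies $\Phi'(q)\in\Delta^r$. In the definition of $F_t$ the solution is continued for as long as it is defined, without stopping when a coordinate of $\Phi$ reaches $1$; "all $t>0$" means all $t>0$ for which $F_t$ is so defined. *)

theory Defs
  imports "HOL-Analysis.Analysis" "HOL-Library.Multiset"
begin

text \<open>
  The species set \<open>{1,...,r}\<close> is a finite type \<open>'s\<close>. All tensors \<open>\<Gamma>\<^sup>(\<^sup>k\<^sup>)\<close> are held in one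
  function \<open>gam\<close> on lists: the entry \<open>\<gamma>\<close> with indices \<open>s\<^sub>1,...,s\<^sub>k\<close> is \<open>gam [s\<^sub>1,...,s\<^sub>k]\<close>. Values
  on lists of length less than 2 play no role.
\<close>

definition multi_indices :: "nat \<Rightarrow> 's list set"
  where "multi_indices k = {ss. length ss = k}"

definition tensor_sup_norm :: "('s::finite list \<Rightarrow> real) \<Rightarrow> nat \<Rightarrow> real"
  where "tensor_sup_norm gam k = Max ((\<lambda>ss. \<bar>gam ss\<bar>) ` multi_indices k)"

definition symmetric_tensors :: "('s list \<Rightarrow> real) \<Rightarrow> bool"
  where "symmetric_tensors gam \<longleftrightarrow>
    (\<forall>ss ss'. length ss \<ge> 2 \<longrightarrow> mset ss = mset ss' \<longrightarrow> gam ss = gam ss')"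

definition non_degenerate :: "('s list \<Rightarrow> real) \<Rightarrow> bool"
  where "non_degenerate gam \<longleftrightarrow> (\<forall>ss \<in> multi_indices 2 \<union> multi_indices 3. gam ss > 0)"

definition xi_term :: "real^'s \<Rightarrow> ('s list \<Rightarrow> real) \<Rightarrow> real^'s \<Rightarrow> 's list \<Rightarrow> real"
  where "xi_term lam gam x ss = (gam ss)\<^sup>2 * (\<Prod>s\<leftarrow>ss. lam $ s * x $ s)"

definition xi :: "real^'s::finite \<Rightarrow> ('s list \<Rightarrow> real) \<Rightarrow> real^'s \<Rightarrow> real"
  where "xi lam gam x = (\<Sum>k. \<Sum>ss\<in>multi_indices (k + 2). xi_term lam gam x ss)"

text \<open>
  The assumption on \<open>\<Gamma>\<close> does not make the power series \<open>\<xi>\<close> converge everywhere. Its domain is the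
  open set on which it is absolutely convergent; there \<open>\<xi>\<close> is smooth. Outside it, \<open>xi\<close> has no meaning.
\<close>

definition xi_domain :: "real^'s::finite \<Rightarrow> ('s list \<Rightarrow> real) \<Rightarrow> (real^'s) set"
  where "xi_domain lam gam =
    interior {x. summable (\<lambda>k. \<Sum>ss\<in>multi_indices (k + 2). \<bar>xi_term lam gam x ss\<bar>)}"

definition xi_species :: "real^'s::finite \<Rightarrow> ('s list \<Rightarrow> real) \<Rightarrow> 's \<Rightarrow> real^'s \<Rightarrow> real"
  where "xi_species lam gam s x =
    inverse (lam $ s) * deriv (\<lambda>u. xi lam gam (x + u *\<^sub>R axis s 1)) 0"

definition weighted_simplex :: "real^'s::finite \<Rightarrow> (real^'s) set"
  where "weighted_simplex lam = {v. (\<forall>s. v $ s \<ge> 0) \<and> lam \<bullet> v = 1}"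

text \<open>
  The equation at a single time. The arguments are \<open>\<Phi>'\<close>, \<open>\<Phi>''\<close>, and for each species \<open>s\<close> the
  functions \<open>G s = (\<xi>\<^sup>s \<circ> \<Phi>)'\<close> and \<open>G' s = (\<xi>\<^sup>s \<circ> \<Phi>)''\<close>. Derivatives are taken within the time
  interval \<open>I\<close>, hence one-sided at its end points.
\<close>

definition tree_descending_at ::
    "real set \<Rightarrow> (real \<Rightarrow> real^'s) \<Rightarrow> (real \<Rightarrow> real^'s) \<Rightarrow> ('s \<Rightarrow> real \<Rightarrow> real) \<Rightarrow>
     ('s \<Rightarrow> real \<Rightarrow> real) \<Rightarrow> real \<Rightarrow> bool"
  where "tree_descending_at I \<Phi>' \<Phi>'' G G' q \<longleftrightarrow>
    (if \<forall>s. \<Phi>' q $ s \<noteq> 0 then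
       (\<exists>D. (\<forall>s. ((\<lambda>p. sqrt (\<Phi>' p $ s / G s p)) has_real_derivative D s) (at q within I)) \<and>
            (\<forall>s s'. 1 / \<Phi>' q $ s * D s = 1 / \<Phi>' q $ s' * D s'))
     else
       (\<exists>\<Psi>. \<forall>s. \<Phi>'' q $ s * G s q - \<Phi>' q $ s * G' s q
                 = 2 * \<Psi> * (\<Phi>' q $ s * G s q) powr (3/2)))"

text \<open>
  \<open>\<Phi>\<close> solves the equation on \<open>{0..t}\<close> with \<open>\<Phi> 0 = 0\<close> and \<open>\<Phi>' 0 = v\<close>; starting at the origin
  is the case of zero external field. The conditions
  \<open>\<Phi> q \<in> xi_domain\<close> and \<open>0 \<le> \<Phi>'\<^sub>s * G s\<close> only say that the quantities in the equation (\<open>\<xi>\<close>, the square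
  root, the power \<open>3/2\<close>) are meaningful; \<open>\<Phi>' q \<in> weighted_simplex lam\<close> is not imposed.
\<close>

definition tree_descending_solution ::
    "real^'s::finite \<Rightarrow> ('s list \<Rightarrow> real) \<Rightarrow> real^'s \<Rightarrow> real \<Rightarrow> (real \<Rightarrow> real^'s) \<Rightarrow> bool"
  where "tree_descending_solution lam gam v t \<Phi> \<longleftrightarrow>
    \<Phi> 0 = 0 \<and>
    (\<forall>q\<in>{0..t}. \<Phi> q \<in> xi_domain lam gam \<and> lam \<bullet> \<Phi> q = q) \<and>
    (\<exists>\<Phi>' \<Phi>'' G G'.
       \<Phi>' 0 = v \<and>
       (\<forall>q\<in>{0..t}.
          (\<Phi> has_vector_derivative \<Phi>' q) (at q within {0..t}) \<and>
          (\<Phi>' has_vector_derivative \<Phi>'' q) (at q within {0..t}) \<and>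
          (\<forall>s. ((\<lambda>p. xi_species lam gam s (\<Phi> p)) has_real_derivative G s q) (at q within {0..t}) \<and>
               (G s has_real_derivative G' s q) (at q within {0..t}) \<and>
               0 \<le> \<Phi>' q $ s * G s q) \<and>
          tree_descending_at {0..t} \<Phi>' \<Phi>'' G G' q))"

definition tree_map_defined :: "real^'s::finite \<Rightarrow> ('s list \<Rightarrow> real) \<Rightarrow> real \<Rightarrow> bool"
  where "tree_map_defined lam gam t \<longleftrightarrow>
    (\<forall>v\<in>weighted_simplex lam. \<exists>\<Phi>. tree_descending_solution lam gam v t \<Phi>)"

text \<open>The map \<open>F\<^sub>t\<close>; a solution is pinned down only on \<open>{0..t}\<close>, so its value at \<open>t\<close> is selected.\<close>

definition tree_map :: "real^'s::finite \<Rightarrow> ('s list \<Rightarrow> real) \<Rightarrow> real \<Rightarrow> real^'s \<Rightarrow> real^'s"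
  where "tree_map lam gam t v =
    (THE y. \<exists>\<Phi>. tree_descending_solution lam gam v t \<Phi> \<and> y = (1 / t) *\<^sub>R \<Phi> t)"

end

theory Submission
  imports Defs
begin

text \<open>
  \<^bold>\<open>Reduction to an explicit second order equation.\<close> Write \<open>x = \<Phi>(q)\<close>, \<open>v = \<Phi>'(q)\<close>, \<open>w = \<Phi>''(q)\<close>, and
  \<open>\<lambda>\<^sub>j N\<^sub>i\<^sub>j(x) = \<partial>\<^sub>j\<xi>\<^sup>i(x)\<close>, so that \<open>N\<close> is a symmetric matrix and \<open>G\<^sub>i = (\<xi>\<^sup>i \<circ> \<Phi>)' = \<Sum>\<^sub>j \<lambda>\<^sub>j N\<^sub>i\<^sub>j v\<^sub>j\<close>. The
  division-free equation becomes the linear system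
  \<open>G\<^sub>i w\<^sub>i - v\<^sub>i \<Sum>\<^sub>j \<lambda>\<^sub>j N\<^sub>i\<^sub>j w\<^sub>j = v\<^sub>i Q\<^sub>i + \<psi> (v\<^sub>i G\<^sub>i)\<^sup>3\<^sup>/\<^sup>2\<close> with \<open>\<Sum>\<^sub>i \<lambda>\<^sub>i w\<^sub>i = 0\<close>, where \<open>Q\<close> is quadratic in \<open>v\<close> and
  \<open>\<psi> = 2\<Psi>\<close>. The \<open>\<lambda>\<close>-weighted sum of the left-hand side vanishes, which determines \<open>\<psi>\<close>. As \<open>\<Gamma>\<^sup>(\<^sup>2\<^sup>)\<close> has
  positive entries and \<open>\<xi>\<close> has nonnegative coefficients, \<open>N\<close> is bounded below by a positive constant
  on the orthant; a Doeblin-type contraction then shows that the operator on the left is coercive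
  on \<open>{w. \<Sum>\<^sub>i \<lambda>\<^sub>i w\<^sub>i = 0}\<close>, uniformly for \<open>v\<close> in the whole closed simplex (lemma
  \<open>laplacian_coercive\<close>). Hence \<open>w = accel x v\<close> is a function of \<open>(x, v)\<close> which is Lipschitz up to the
  boundary of the simplex (\<open>accel_lipschitz\<close>; the power \<open>3/2\<close> is what makes the right-hand side
  Lipschitz), and it satisfies \<open>|w\<^sub>i| \<le> C v\<^sub>i\<close> (\<open>accel_le_velocity\<close>). On \<open>[0,t]\<close> with \<open>t > 0\<close>,
  the solutions of the tree-descending equation with \<open>\<Phi>(0) = 0\<close> and \<open>\<Phi>'(0)\<close> in the simplex are exactly the
  curves with these initial data for which \<open>\<Phi>'\<close> stays in the simplex and \<open>\<Phi>'' = accel \<Phi> \<Phi>'\<close> (\<open>solution_imp_flow\<close>,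
  \<open>flow_imp_solution\<close>).

  \<^bold>\<open>Consequences.\<close> Gronwall's inequality gives uniqueness and continuous dependence on \<open>v\<close>; because
  \<open>\<Phi>\<close> is coordinatewise increasing, a solution on \<open>[0,t]\<close> stays in one box \<open>[0, \<Phi>(t)]\<close> of the domain, on
  a neighbourhood of which \<open>accel\<close> is Lipschitz. For small \<open>t\<close>, solutions exist for all \<open>v\<close> by the
  contraction principle, and \<open>F\<^sub>t - id\<close> is Lipschitz with a constant of order \<open>t\<close>, so that \<open>F\<^sub>t\<close> is
  injective. For every \<open>t\<close> for which \<open>F\<^sub>t\<close> is defined it is continuous, and \<open>v\<^sub>s = 0\<close> implies
  \<open>(F\<^sub>t v)\<^sub>s = 0\<close> since \<open>|\<Phi>\<^sub>s''| \<le> C \<Phi>\<^sub>s'\<close>. A continuous self-map of a simplex that preserves the faces is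
  surjective by Brouwer's theorem (\<open>face_preserving_surjective\<close>).
\<close>

section \<open>Power series with coefficients indexed by lists\<close>

text \<open>
  A power series in the variables \<open>y\<^sub>s\<close> is given by coefficients \<open>a\<close> indexed by lists of species: the
  list \<open>[s\<^sub>1,...,s\<^sub>k]\<close> contributes \<open>a [s\<^sub>1,...,s\<^sub>k] y\<^sub>s\<^sub>1 \<cdots> y\<^sub>s\<^sub>k\<close>. A monomial occurs once for each ordering of
  its factors, and all orderings carry the same coefficient.
\<close>

definition symmetric_coeffs :: "('s list \<Rightarrow> real) \<Rightarrow> bool"
  where "symmetric_coeffs a \<longleftrightarrow> (\<forall>ss ss'. mset ss = mset ss' \<longrightarrow> a ss = a ss')"

text \<open>
The homogeneous part of degree \<open>k\<close>.
\<close>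

definition hom_part :: "('s::finite list \<Rightarrow> real) \<Rightarrow> nat \<Rightarrow> real^'s \<Rightarrow> real"
  where "hom_part a k y = (\<Sum>ss\<in>multi_indices k. a ss * (\<Prod>s\<leftarrow>ss. y $ s))"

text \<open>
The sum is taken degree by degree; it is meaningful only where that series converges.
\<close>

definition power_series :: "('s::finite list \<Rightarrow> real) \<Rightarrow> real^'s \<Rightarrow> real"
  where "power_series a y = (\<Sum>k. hom_part a k y)"

text \<open>
  The coefficients of the partial derivative in the direction \<open>s\<close>. By symmetry each of the
  \<open>length ss + 1\<close> positions at which \<open>s\<close> can be inserted into \<open>ss\<close> contributes the same amount.
\<close>

definition diff_coeffs :: "'s \<Rightarrow> ('s list \<Rightarrow> real) \<Rightarrow> 's list \<Rightarrow> real"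
  where "diff_coeffs s a ss = real (Suc (length ss)) * a (s # ss)"

text \<open>
  Nonnegative symmetric coefficients whose power series converges at \<open>\<theta> R\<close> for all \<open>\<theta> < 1\<close>, hence
  absolutely on the open box \<open>{y. \<forall>s. \<bar>y\<^sub>s\<bar> < R\<^sub>s}\<close>. Nothing is asked at \<open>R\<close> itself, and so the property
  passes to partial derivatives with the same \<open>R\<close>.
\<close>

definition converges_below :: "('s::finite list \<Rightarrow> real) \<Rightarrow> real^'s \<Rightarrow> bool"
  where "converges_below a R \<longleftrightarrow>
    (\<forall>ss. 0 \<le> a ss) \<and> symmetric_coeffs a \<and> (\<forall>s. 0 < R $ s) \<and>
    (\<forall>\<theta>. 0 < \<theta> \<longrightarrow> \<theta> < 1 \<longrightarrow> summable (\<lambda>k. hom_part a k R * \<theta> ^ k))"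

lemma finite_multi_indices [simp]: "finite (multi_indices k :: 's::finite list set)"
  unfolding multi_indices_def using finite_lists_length_eq[of "UNIV :: 's set" k] by simp

lemma sum_multi_indices_Suc:
  fixes f :: "'s::finite list \<Rightarrow> real"
  shows "(\<Sum>ss\<in>multi_indices (Suc k). f ss) = (\<Sum>s\<in>UNIV. \<Sum>ss\<in>multi_indices k. f (s # ss))"
proof -
  have eq: "multi_indices (Suc k) = (\<lambda>(s, ss). s # ss) ` (UNIV \<times> (multi_indices k :: 's list set))"
    by (auto simp: multi_indices_def image_iff length_Suc_conv)
  have "(\<Sum>ss\<in>multi_indices (Suc k). f ss) = (\<Sum>(s, ss)\<in>UNIV \<times> multi_indices k. f (s # ss))"
    unfolding eq by (subst sum.reindex) (auto simp: inj_on_def case_prod_unfold)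
  then show ?thesis by (simp add: sum.cartesian_product)
qed

lemma hom_part_0 [simp]: "hom_part a 0 y = a []"
  by (simp add: hom_part_def multi_indices_def)

lemma hom_part_Suc:
  "hom_part a (Suc k) y = (\<Sum>s\<in>UNIV. y $ s * hom_part (\<lambda>ss. a (s # ss)) k y)"
  unfolding hom_part_def sum_multi_indices_Suc
  by (simp add: sum_distrib_left mult_ac)

lemma hom_part_diff_coeffs:
  "hom_part (diff_coeffs s a) k y = real (Suc k) * hom_part (\<lambda>ss. a (s # ss)) k y"
  unfolding hom_part_def diff_coeffs_def sum_distrib_left
  by (rule sum.cong) (auto simp: multi_indices_def mult_ac)

lemma hom_part_nonneg:
  assumes "\<And>ss. 0 \<le> a ss" "\<And>s. 0 \<le> y $ s"
  shows "0 \<le> hom_part a k y"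
  using assms(1)
proof (induction k arbitrary: a)
  case (Suc k)
  then show ?case unfolding hom_part_Suc
    by (intro sum_nonneg mult_nonneg_nonneg) (auto simp: assms(2))
qed simp

lemma hom_part_abs_le:
  assumes "\<And>ss. 0 \<le> a ss" "\<And>s. \<bar>y $ s\<bar> \<le> \<theta> * R $ s" "\<And>s. 0 \<le> R $ s" "0 \<le> \<theta>"
  shows "\<bar>hom_part a k y\<bar> \<le> hom_part a k R * \<theta> ^ k"
  using assms(1)
proof (induction k arbitrary: a)
  case 0
  then show ?case by simp
next
  case (Suc k)
  have "\<bar>hom_part a (Suc k) y\<bar> \<le> (\<Sum>s\<in>UNIV. \<bar>y $ s\<bar> * \<bar>hom_part (\<lambda>ss. a (s # ss)) k y\<bar>)"
    unfolding hom_part_Suc by (rule order_trans[OF sum_abs]) (simp add: abs_mult)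
  also have "\<dots> \<le> (\<Sum>s\<in>UNIV. (\<theta> * R $ s) * (hom_part (\<lambda>ss. a (s # ss)) k R * \<theta> ^ k))"
    using Suc assms by (intro sum_mono mult_mono) auto
  also have "\<dots> = hom_part a (Suc k) R * \<theta> ^ Suc k"
    unfolding hom_part_Suc by (simp add: sum_distrib_left sum_distrib_right mult_ac)
  finally show ?case .
qed

lemma symmetric_coeffs_Cons: "symmetric_coeffs a \<Longrightarrow> symmetric_coeffs (\<lambda>ss. a (s # ss))"
  unfolding symmetric_coeffs_def by (metis mset.simps(2))

lemma symmetric_coeffs_swap: "symmetric_coeffs a \<Longrightarrow> a (s # s' # ss) = a (s' # s # ss)"
  unfolding symmetric_coeffs_def by (simp add: add_mset_commute)

lemma symmetric_coeffs_diff_coeffs: "symmetric_coeffs a \<Longrightarrow> symmetric_coeffs (diff_coeffs s a)"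
  unfolding symmetric_coeffs_def diff_coeffs_def by (metis mset.simps(2) mset_eq_length)

lemma diff_coeffs_commute:
  "symmetric_coeffs a \<Longrightarrow> diff_coeffs s (diff_coeffs s' a) = diff_coeffs s' (diff_coeffs s a)"
  by (auto simp: diff_coeffs_def fun_eq_iff symmetric_coeffs_swap)

lemma hom_part_has_derivative:
  fixes a :: "'s::finite list \<Rightarrow> real"
  assumes "symmetric_coeffs a"
  shows "(hom_part a (Suc k) has_derivative
           (\<lambda>h. \<Sum>s\<in>UNIV. h $ s * hom_part (diff_coeffs s a) k y)) (at y)"
  using assms
proof (induction k arbitrary: a)
  case 0
  have "hom_part a (Suc 0) = (\<lambda>y. \<Sum>s\<in>UNIV. y $ s * a [s])"
    by (simp add: fun_eq_iff hom_part_Suc)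
  moreover have "((\<lambda>y. \<Sum>s\<in>UNIV. y $ s * a [s]) has_derivative (\<lambda>h. \<Sum>s\<in>UNIV. h $ s * a [s])) (at y)"
    by (intro has_derivative_sum has_derivative_mult_left
          bounded_linear_imp_has_derivative bounded_linear_vec_nth)
  ultimately show ?case by (simp add: diff_coeffs_def)
next
  case (Suc k)
  define A where "A s = hom_part (\<lambda>ss. a (s # ss)) (Suc k) y" for s
  define B where "B s s' = hom_part (\<lambda>ss. a (s # s' # ss)) k y" for s s'
  have Bsym: "B s s' = B s' s" for s s'
    unfolding B_def using symmetric_coeffs_swap[OF Suc.prems] by metis
  have AB: "A s = (\<Sum>s'\<in>UNIV. y $ s' * B s s')" for s
    by (simp add: A_def B_def hom_part_Suc)
  have dB: "hom_part (diff_coeffs s' (\<lambda>ss. a (s # ss))) k y = real (Suc k) * B s s'" for s s'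
    by (simp add: hom_part_diff_coeffs B_def)
  have "hom_part a (Suc (Suc k)) = (\<lambda>y. \<Sum>s\<in>UNIV. y $ s * hom_part (\<lambda>ss. a (s # ss)) (Suc k) y)"
    by (rule ext, rule hom_part_Suc)
  moreover have "((\<lambda>y. \<Sum>s\<in>UNIV. y $ s * hom_part (\<lambda>ss. a (s # ss)) (Suc k) y) has_derivative
     (\<lambda>h. \<Sum>s\<in>UNIV. y $ s * (\<Sum>s'\<in>UNIV. h $ s' * hom_part (diff_coeffs s' (\<lambda>ss. a (s # ss))) k y)
            + h $ s * hom_part (\<lambda>ss. a (s # ss)) (Suc k) y)) (at y)"
    by (intro has_derivative_sum has_derivative_mult Suc.IH symmetric_coeffs_Cons Suc.prems
          bounded_linear_imp_has_derivative bounded_linear_vec_nth)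
  moreover have "(\<Sum>s\<in>UNIV. y $ s * (\<Sum>s'\<in>UNIV. h $ s' * hom_part (diff_coeffs s' (\<lambda>ss. a (s # ss))) k y)
            + h $ s * hom_part (\<lambda>ss. a (s # ss)) (Suc k) y)
       = (\<Sum>s\<in>UNIV. h $ s * hom_part (diff_coeffs s a) (Suc k) y)" for h :: "real^'s"
  proof -
    have "(\<Sum>s\<in>UNIV. y $ s * (\<Sum>s'\<in>UNIV. h $ s' * (real (Suc k) * B s s')))
        = (\<Sum>s'\<in>UNIV. \<Sum>s\<in>UNIV. y $ s * (h $ s' * (real (Suc k) * B s s')))"
      by (subst sum.swap) (simp add: sum_distrib_left)
    also have "\<dots> = (\<Sum>s'\<in>UNIV. h $ s' * (real (Suc k) * A s'))"
      unfolding AB sum_distrib_left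
      by (intro sum.cong refl) (simp add: mult_ac Bsym)
    finally have eq: "(\<Sum>s\<in>UNIV. y $ s * (\<Sum>s'\<in>UNIV. h $ s' * (real (Suc k) * B s s')))
        = (\<Sum>s\<in>UNIV. h $ s * (real (Suc k) * A s))" .
    show ?thesis
      unfolding dB unfolding hom_part_diff_coeffs A_def[symmetric] sum.distrib eq
      unfolding sum.distrib[symmetric] by (intro sum.cong refl) (simp add: algebra_simps)
  qed
  ultimately show ?case by simp
qed

lemma converges_belowD:
  assumes "converges_below a R"
  shows "\<And>ss. 0 \<le> a ss" "symmetric_coeffs a" "\<And>s. 0 < R $ s"
    "\<And>\<theta>. 0 < \<theta> \<Longrightarrow> \<theta> < 1 \<Longrightarrow> summable (\<lambda>k. hom_part a k R * \<theta> ^ k)"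
  using assms by (auto simp: converges_below_def)

lemma converges_below_diff_coeffs:
  assumes a: "converges_below a R"
  shows "converges_below (diff_coeffs s a) R"
  unfolding converges_below_def
proof (intro conjI allI impI)
  note D = converges_belowD[OF a]
  show "0 \<le> diff_coeffs s a ss" for ss using D(1) by (simp add: diff_coeffs_def)
  show "symmetric_coeffs (diff_coeffs s a)" by (rule symmetric_coeffs_diff_coeffs[OF D(2)])
  show "0 < R $ i" for i by (rule D(3))
  fix \<theta> :: real assume \<theta>: "0 < \<theta>" "\<theta> < 1"
  have nn: "0 \<le> hom_part a k R" for k using D by (intro hom_part_nonneg) (auto simp: less_imp_le)
  have "summable (\<lambda>n. hom_part a n R * x ^ n)" if "norm x < 1" for x :: real
  proof (cases "x = 0")
    case True
    then show ?thesis using powser_sums_zero sums_summable by auto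
  next
    case False
    then have "summable (\<lambda>n. hom_part a n R * \<bar>x\<bar> ^ n)" using that D(4)[of "\<bar>x\<bar>"] by auto
    then show ?thesis
      by (rule summable_comparison_test') (simp add: abs_mult nn power_abs)
  qed
  then have sm: "summable (\<lambda>n. diffs (\<lambda>k. hom_part a k R) n * \<theta> ^ n)"
    using \<theta> by (intro termdiff_converges[of \<theta> 1]) auto
  have "norm (hom_part (diff_coeffs s a) k R * \<theta> ^ k)
      \<le> inverse (R $ s) * (diffs (\<lambda>k. hom_part a k R) k * \<theta> ^ k)" for k
  proof -
    have nn1: "0 \<le> hom_part (\<lambda>ss. a (i # ss)) k R" for i
      using D by (intro hom_part_nonneg) (auto simp: less_imp_le)
    have "R $ s * hom_part (\<lambda>ss. a (s # ss)) k R \<le> hom_part a (Suc k) R"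
      unfolding hom_part_Suc
      using D(3) nn1 by (intro member_le_sum) (auto simp: less_imp_le)
    then have "hom_part (\<lambda>ss. a (s # ss)) k R \<le> inverse (R $ s) * hom_part a (Suc k) R"
      using D(3)[of s] by (simp add: field_simps)
    then have "real (Suc k) * hom_part (\<lambda>ss. a (s # ss)) k R * \<theta> ^ k
         \<le> real (Suc k) * (inverse (R $ s) * hom_part a (Suc k) R) * \<theta> ^ k"
      using \<theta> by (intro mult_right_mono mult_left_mono) auto
    moreover have "norm (hom_part (diff_coeffs s a) k R * \<theta> ^ k)
         = real (Suc k) * hom_part (\<lambda>ss. a (s # ss)) k R * \<theta> ^ k"
      using nn1[of s] \<theta> by (simp add: hom_part_diff_coeffs abs_mult)
    ultimately show ?thesis by (simp add: diffs_def mult_ac)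
  qed
  then show "summable (\<lambda>k. hom_part (diff_coeffs s a) k R * \<theta> ^ k)"
    by (intro summable_comparison_test'[OF summable_mult[OF sm, of "inverse (R $ s)"]])
qed

lemma summable_hom_part:
  assumes a: "converges_below a R" and \<theta>: "0 < \<theta>" "\<theta> < 1" and y: "\<And>s. \<bar>y $ s\<bar> \<le> \<theta> * R $ s"
  shows "summable (\<lambda>k. hom_part a k y)"
    and "\<bar>power_series a y\<bar> \<le> (\<Sum>k. hom_part a k R * \<theta> ^ k)"
proof -
  note D = converges_belowD[OF a]
  have le: "\<bar>hom_part a k y\<bar> \<le> hom_part a k R * \<theta> ^ k" for k
    using D y \<theta> by (intro hom_part_abs_le) (auto simp: less_imp_le)
  have s1: "summable (\<lambda>k. \<bar>hom_part a k y\<bar>)"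
    by (rule summable_comparison_test'[OF D(4)[OF \<theta>], of 0]) (use le in auto)
  then show s: "summable (\<lambda>k. hom_part a k y)" by (rule summable_rabs_cancel)
  show "\<bar>power_series a y\<bar> \<le> (\<Sum>k. hom_part a k R * \<theta> ^ k)"
    unfolding power_series_def using summable_rabs[OF s1] suminf_le[OF le s1 D(4)[OF \<theta>]] by simp
qed

lemma box_scale:
  fixes y R :: "real^'s::finite"
  assumes "\<And>s. \<bar>y $ s\<bar> < R $ s"
  obtains \<theta> where "0 < \<theta>" "\<theta> < 1" "\<And>s. \<bar>y $ s\<bar> < \<theta> * R $ s"
proof -
  define m where "m = Max (range (\<lambda>s. \<bar>y $ s\<bar> / R $ s))"
  have R: "0 < R $ s" for s using assms[of s] by linarith
  have "m < 1" unfolding m_def using assms R by (subst Max_less_iff) auto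
  moreover have m: "\<bar>y $ s\<bar> / R $ s \<le> m" for s unfolding m_def by (intro Max_ge) auto
  moreover have "0 \<le> m" using m[of undefined] R[of undefined]
    by (meson abs_ge_zero divide_nonneg_pos order_trans)
  ultimately obtain \<theta> where \<theta>: "m < \<theta>" "\<theta> < 1" "0 < \<theta>"
    using dense[of m 1] by auto
  have "\<bar>y $ s\<bar> < \<theta> * R $ s" for s
    using m[of s] \<theta>(1) R[of s] by (simp add: divide_le_eq) (smt (verit) mult_strict_right_mono)
  then show ?thesis using that \<theta> by blast
qed

text \<open>
  Differentiation term by term. The derivative series converges uniformly on each smaller box
  \<open>{y. \<forall>s. \<bar>y\<^sub>s\<bar> < \<theta> R\<^sub>s}\<close> with \<open>\<theta> < 1\<close>.
\<close>

lemma power_series_has_derivative: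
  fixes a :: "'s::finite list \<Rightarrow> real"
  assumes a: "converges_below a R" and y: "\<And>s. \<bar>y $ s\<bar> < R $ s"
  shows "(power_series a has_derivative (\<lambda>h. \<Sum>s\<in>UNIV. h $ s * power_series (diff_coeffs s a) y)) (at y)"
proof -
  note D = converges_belowD[OF a]
  obtain \<theta> where \<theta>: "0 < \<theta>" "\<theta> < 1" and y\<theta>: "\<And>s. \<bar>y $ s\<bar> < \<theta> * R $ s"
    using box_scale[OF y] by metis
  define S where "S = box (- \<theta> *\<^sub>R R) (\<theta> *\<^sub>R R)"
  have S: "x \<in> S \<longleftrightarrow> (\<forall>s. \<bar>x $ s\<bar> < \<theta> * R $ s)" for x
    unfolding S_def mem_box_cart by (simp add: abs_less_iff) (metis minus_less_iff)
  have yS: "y \<in> S" using S y\<theta> by blast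
  define c where "c k s = hom_part (diff_coeffs s a) k R * \<theta> ^ k" for k s
  have sc: "summable (\<lambda>k. c k s)" for s
    unfolding c_def by (rule converges_belowD(4)[OF converges_below_diff_coeffs[OF a] \<theta>])
  have cnn: "0 \<le> c k s" for k s
    unfolding c_def using D \<theta> converges_belowD(1)[OF converges_below_diff_coeffs[OF a]]
    by (intro mult_nonneg_nonneg hom_part_nonneg) (auto simp: less_imp_le)
  have le: "\<bar>hom_part (diff_coeffs s a) k x\<bar> \<le> c k s" if "x \<in> S" for k s x
    unfolding c_def using that S converges_belowD(1,3)[OF converges_below_diff_coeffs[OF a]] \<theta>
    by (intro hom_part_abs_le) (auto simp: less_imp_le)
  have smx: "summable (\<lambda>k. hom_part (diff_coeffs s a) k x)" if "x \<in> S" for s x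
    using that S less_imp_le by (intro summable_hom_part(1)[OF converges_below_diff_coeffs[OF a] \<theta>]) blast
  have tail: "\<bar>(\<Sum>i<n. hom_part (diff_coeffs s a) i x) - power_series (diff_coeffs s a) x\<bar> \<le> (\<Sum>k. c (k + n) s)"
    if "x \<in> S" for n s x
  proof -
    have "power_series (diff_coeffs s a) x - (\<Sum>i<n. hom_part (diff_coeffs s a) i x)
        = (\<Sum>k. hom_part (diff_coeffs s a) (k + n) x)"
      unfolding power_series_def by (subst suminf_minus_initial_segment[OF smx[OF that]]) simp
    moreover have "norm (\<Sum>k. hom_part (diff_coeffs s a) (k + n) x) \<le> (\<Sum>k. c (k + n) s)"
      by (rule norm_suminf_le) (use le[OF that] summable_ignore_initial_segment[OF sc] in auto)
    ultimately show ?thesis by (simp add: abs_minus_commute)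
  qed
  have "\<exists>g. \<forall>x\<in>S. (\<lambda>n. hom_part a (Suc n) x) sums (g x) \<and>
      (g has_derivative (\<lambda>h. \<Sum>s\<in>UNIV. h $ s * power_series (diff_coeffs s a) x)) (at x within S)"
  proof (rule has_derivative_series)
    show "convex S" unfolding S_def by (rule convex_box)
    show "(hom_part a (Suc n) has_derivative (\<lambda>h. \<Sum>s\<in>UNIV. h $ s * hom_part (diff_coeffs s a) n x))
       (at x within S)" for n x
      by (rule has_derivative_at_withinI[OF hom_part_has_derivative[OF D(2)]])
    show "y \<in> S" by (rule yS)
    have "summable (\<lambda>k. hom_part a k y)"
      using y\<theta> less_imp_le by (intro summable_hom_part(1)[OF a \<theta>]) blast
    then show "(\<lambda>n. hom_part a (Suc n) y) sums (\<Sum>n. hom_part a (Suc n) y)"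
      by (intro summable_sums)
        (use summable_ignore_initial_segment[of "\<lambda>k. hom_part a k y" 1] in simp)
    fix e :: real assume "e > 0"
    have "(\<lambda>n. \<Sum>s\<in>UNIV. \<Sum>k. c (k + n) s) \<longlonglongrightarrow> (\<Sum>s\<in>(UNIV::'s set). 0)"
      by (intro tendsto_sum suminf_exist_split2[OF sc])
    then have "\<forall>\<^sub>F n in sequentially. (\<Sum>s\<in>UNIV. \<Sum>k. c (k + n) s) < e"
      using \<open>e > 0\<close> by (intro order_tendstoD) auto
    then show "\<forall>\<^sub>F n in sequentially. \<forall>x\<in>S. \<forall>h.
        norm ((\<Sum>i<n. \<Sum>s\<in>UNIV. h $ s * hom_part (diff_coeffs s a) i x)
            - (\<Sum>s\<in>UNIV. h $ s * power_series (diff_coeffs s a) x)) \<le> e * norm h"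
    proof (eventually_elim, intro ballI allI)
      fix n x and h :: "real^'s" assume n: "(\<Sum>s\<in>UNIV. \<Sum>k. c (k + n) s) < e" and x: "x \<in> S"
      have "(\<Sum>i<n. \<Sum>s\<in>UNIV. h $ s * hom_part (diff_coeffs s a) i x)
            - (\<Sum>s\<in>UNIV. h $ s * power_series (diff_coeffs s a) x)
          = (\<Sum>s\<in>UNIV. h $ s * ((\<Sum>i<n. hom_part (diff_coeffs s a) i x) - power_series (diff_coeffs s a) x))"
        by (subst sum.swap) (simp add: sum_subtractf algebra_simps sum_distrib_left)
      also have "norm \<dots> \<le> (\<Sum>s\<in>UNIV. norm h * (\<Sum>k. c (k + n) s))"
        unfolding real_norm_def
        by (rule order_trans[OF sum_abs], intro sum_mono, unfold abs_mult, intro mult_mono tail[OF x])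
           (auto intro: component_le_norm_cart)
      also have "\<dots> = norm h * (\<Sum>s\<in>UNIV. \<Sum>k. c (k + n) s)" by (simp add: sum_distrib_left)
      also have "\<dots> \<le> e * norm h" using mult_left_mono[OF less_imp_le[OF n] norm_ge_zero[of h]] by (simp add: mult.commute)
      finally show "norm ((\<Sum>i<n. \<Sum>s\<in>UNIV. h $ s * hom_part (diff_coeffs s a) i x)
            - (\<Sum>s\<in>UNIV. h $ s * power_series (diff_coeffs s a) x)) \<le> e * norm h" .
    qed
  qed
  then obtain g where g: "\<And>x. x \<in> S \<Longrightarrow> (\<lambda>n. hom_part a (Suc n) x) sums (g x)"
    "\<And>x. x \<in> S \<Longrightarrow> (g has_derivative (\<lambda>h. \<Sum>s\<in>UNIV. h $ s * power_series (diff_coeffs s a) x)) (at x within S)"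
    by blast
  have ps: "power_series a x = a [] + g x" if "x \<in> S" for x
    unfolding power_series_def using sums_Suc[OF g(1)[OF that]] by (simp add: sums_unique[symmetric])
  have "open S" unfolding S_def by (rule open_box)
  have "((\<lambda>x. a [] + g x) has_derivative (\<lambda>h. \<Sum>s\<in>UNIV. h $ s * power_series (diff_coeffs s a) y)) (at y)"
    using has_derivative_add[OF has_derivative_const g(2)[OF yS], of "a []"]
    by (simp add: at_within_open[OF yS \<open>open S\<close>])
  then show ?thesis
    by (rule has_derivative_transform_within_open[OF _ \<open>open S\<close> yS]) (simp add: ps)
qed

lemma power_series_ge_const:
  assumes a: "converges_below a R" and y: "\<And>s. 0 \<le> y $ s" "\<And>s. y $ s < R $ s"
  shows "a [] \<le> power_series a y"
proof -
  obtain \<theta> where \<theta>: "0 < \<theta>" "\<theta> < 1" and y\<theta>: "\<And>s. \<bar>y $ s\<bar> < \<theta> * R $ s"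
    by (rule box_scale[of y R]) (use y in auto)
  have "summable (\<lambda>k. hom_part a k y)"
    using y\<theta> less_imp_le by (intro summable_hom_part(1)[OF a \<theta>]) blast
  then have "(\<Sum>k\<in>{0}. hom_part a k y) \<le> power_series a y"
    unfolding power_series_def
    using y converges_belowD(1)[OF a] by (intro sum_le_suminf hom_part_nonneg) auto
  then show ?thesis by simp
qed

section \<open>A weighted graph Laplacian\<close>

text \<open>
  A complete graph on the species with symmetric weights \<open>N i j\<close> and vertex masses \<open>lam i\<close>. For a vector
  \<open>v\<close> the function \<open>degree_vec\<close> is \<open>\<Sum>\<^sub>j \<lambda>\<^sub>j N\<^sub>i\<^sub>j v\<^sub>j\<close>.
\<close>

definition degree_vec :: "real^'s::finite \<Rightarrow> ('s \<Rightarrow> 's \<Rightarrow> real) \<Rightarrow> real^'s \<Rightarrow> 's \<Rightarrow> real"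
  where "degree_vec lam N v i = (\<Sum>j\<in>UNIV. lam $ j * N i j * v $ j)"

text \<open>
  The linear operator in \<open>w\<close> which governs \<open>\<Phi>''\<close>. For \<open>w\<^sub>i = v\<^sub>i u\<^sub>i\<close> it is
  \<open>v\<^sub>i \<Sum>\<^sub>j \<lambda>\<^sub>j N\<^sub>i\<^sub>j v\<^sub>j (u\<^sub>i - u\<^sub>j)\<close>, a weighted graph Laplacian of \<open>u\<close>. In this form it remains well-behaved when
  coordinates of \<open>v\<close> vanish.
\<close>

definition laplacian :: "real^'s::finite \<Rightarrow> ('s \<Rightarrow> 's \<Rightarrow> real) \<Rightarrow> real^'s \<Rightarrow> real^'s \<Rightarrow> 's \<Rightarrow> real"
  where "laplacian lam N v w i =
    degree_vec lam N v i * w $ i - v $ i * (\<Sum>j\<in>UNIV. lam $ j * N i j * w $ j)"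

lemma degree_vec_bounds:
  fixes lam v :: "real^'s::finite"
  assumes lam: "\<And>s. 0 < lam $ s" and v: "\<And>s. 0 \<le> v $ s" "(\<Sum>s\<in>UNIV. lam $ s * v $ s) = 1"
    and N: "\<And>i j. m \<le> N i j" "\<And>i j. N i j \<le> B"
  shows "m \<le> degree_vec lam N v i" "degree_vec lam N v i \<le> B"
proof -
  have nn: "0 \<le> lam $ j * v $ j" for j using lam[of j] v(1)[of j] by simp
  have "(\<Sum>j\<in>UNIV. lam $ j * v $ j) * m \<le> (\<Sum>j\<in>UNIV. lam $ j * N i j * v $ j)"
    unfolding sum_distrib_right
    by (intro sum_mono) (use mult_left_mono[OF N(1) nn] in \<open>simp add: mult_ac\<close>)
  then show "m \<le> degree_vec lam N v i" by (simp add: v(2) degree_vec_def)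
  have "(\<Sum>j\<in>UNIV. lam $ j * N i j * v $ j) \<le> (\<Sum>j\<in>UNIV. lam $ j * v $ j) * B"
    unfolding sum_distrib_right
    by (intro sum_mono) (use mult_left_mono[OF N(2) nn] in \<open>simp add: mult_ac\<close>)
  then show "degree_vec lam N v i \<le> B" by (simp add: v(2) degree_vec_def)
qed

lemma degree_vec_swap:
  assumes "\<And>i j. N i j = N j i"
  shows "(\<Sum>i\<in>UNIV. lam $ i * v $ i * (\<Sum>j\<in>UNIV. lam $ j * N i j * w j))
       = (\<Sum>j\<in>UNIV. lam $ j * w j * degree_vec lam N v j)"
proof -
  have "(\<Sum>i\<in>UNIV. lam $ i * v $ i * (\<Sum>j\<in>UNIV. lam $ j * N i j * w j))
      = (\<Sum>j\<in>UNIV. \<Sum>i\<in>UNIV. lam $ i * v $ i * (lam $ j * N i j * w j))"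
    by (subst sum.swap) (simp add: sum_distrib_left)
  also have "\<dots> = (\<Sum>j\<in>UNIV. lam $ j * w j * degree_vec lam N v j)"
    unfolding degree_vec_def sum_distrib_left
    by (intro sum.cong refl) (simp add: mult_ac assms[of _ _] )
  finally show ?thesis .
qed

lemma sum_laplacian:
  assumes "\<And>i j. N i j = N j i"
  shows "(\<Sum>i\<in>UNIV. lam $ i * laplacian lam N v w i) = 0"
  using degree_vec_swap[of N lam v "\<lambda>j. w $ j", OF assms]
  by (simp add: laplacian_def right_diff_distrib sum_subtractf mult_ac)

lemma laplacian_diff:
  "laplacian lam N v (w - w') i = laplacian lam N v w i - laplacian lam N v w' i"
  by (simp add: laplacian_def algebra_simps sum_subtractf)

lemma laplacian_kernel: "laplacian lam N v (c *\<^sub>R v) i = 0"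
  by (simp add: laplacian_def degree_vec_def sum_distrib_left mult_ac)

text \<open>
  With \<open>\<mu>\<^sub>i = \<lambda>\<^sub>i G\<^sub>i w\<^sub>i\<close> the operator becomes \<open>\<mu> - \<mu>P\<close> for the transition matrix
  \<open>P j i = v\<^sub>i \<lambda>\<^sub>i N\<^sub>i\<^sub>j / G\<^sub>j\<close>, whose rows dominate \<open>\<kappa>\<close> times the probability vector \<open>(\<lambda>\<^sub>i v\<^sub>i)\<^sub>i\<close> (Doeblin's
  condition). So \<open>P\<close> contracts the \<open>\<ell>\<^sup>1\<close>-norm by \<open>1 - \<kappa>\<close> on measures \<open>\<mu>\<close> of total mass zero.
\<close>

lemma laplacian_coercive_centred:
  fixes lam v w :: "real^'s::finite"
  assumes lam: "\<And>s. 0 < lam $ s" and v: "\<And>s. 0 \<le> v $ s" "(\<Sum>s\<in>UNIV. lam $ s * v $ s) = 1"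
    and N: "\<And>i j. N i j = N j i" "\<And>i j. m \<le> N i j" "\<And>i j. N i j \<le> B" and m: "0 < m"
    and w: "(\<Sum>s\<in>UNIV. lam $ s * degree_vec lam N v s * w $ s) = 0"
  shows "(\<Sum>s\<in>UNIV. lam $ s * \<bar>w $ s\<bar>)
    \<le> B / m\<^sup>2 * (\<Sum>s\<in>UNIV. lam $ s * \<bar>laplacian lam N v w s\<bar>)"
proof -
  define G where "G = degree_vec lam N v"
  define b where "b = laplacian lam N v w"
  define \<kappa> where "\<kappa> = m / B"
  have G: "m \<le> G i" "G i \<le> B" for i
    unfolding G_def using degree_vec_bounds[OF lam v N(2,3)] by auto
  have B: "0 < B" using G m by (meson less_le_trans)
  have \<kappa>: "\<kappa> * G j \<le> N i j" for i j
  proof -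
    have "\<kappa> * G j \<le> \<kappa> * B" unfolding \<kappa>_def using G m B by (intro mult_left_mono) auto
    then show ?thesis using N(2)[of i j] B by (simp add: \<kappa>_def)
  qed
  have pt: "lam $ i * (G i * \<bar>w $ i\<bar>)
      \<le> lam $ i * \<bar>b i\<bar> + lam $ i * v $ i * (\<Sum>j\<in>UNIV. lam $ j * (N i j - \<kappa> * G j) * \<bar>w $ j\<bar>)" for i
  proof -
    \<comment> \<open>Subtracting the vanishing sum leaves the nonnegative kernel \<open>N - \<kappa> G\<close>.\<close>
    have "G i * w $ i = b i + v $ i * (\<Sum>j\<in>UNIV. lam $ j * N i j * w $ j)"
      by (simp add: b_def laplacian_def G_def)
    also have "(\<Sum>j\<in>UNIV. lam $ j * N i j * w $ j)
        = (\<Sum>j\<in>UNIV. lam $ j * N i j * w $ j) - \<kappa> * (\<Sum>j\<in>UNIV. lam $ j * G j * w $ j)"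
      using w by (simp add: G_def)
    also have "\<dots> = (\<Sum>j\<in>UNIV. lam $ j * (N i j - \<kappa> * G j) * w $ j)"
      unfolding sum_distrib_left sum_subtractf[symmetric]
      by (intro sum.cong refl) (simp add: algebra_simps)
    finally have e: "G i * w $ i = b i + v $ i * (\<Sum>j\<in>UNIV. lam $ j * (N i j - \<kappa> * G j) * w $ j)" .
    have "\<bar>G i * w $ i\<bar> \<le> \<bar>b i\<bar> + v $ i * \<bar>\<Sum>j\<in>UNIV. lam $ j * (N i j - \<kappa> * G j) * w $ j\<bar>"
      unfolding e by (rule order_trans[OF abs_triangle_ineq]) (use v(1)[of i] in \<open>simp add: abs_mult\<close>)
    also have "\<bar>\<Sum>j\<in>UNIV. lam $ j * (N i j - \<kappa> * G j) * w $ j\<bar>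
        \<le> (\<Sum>j\<in>UNIV. lam $ j * (N i j - \<kappa> * G j) * \<bar>w $ j\<bar>)"
      by (rule order_trans[OF sum_abs])
         (use \<kappa> lam in \<open>auto simp: abs_mult abs_of_nonneg less_imp_le\<close>)
    finally have "\<bar>G i * w $ i\<bar> \<le> \<bar>b i\<bar> + v $ i * (\<Sum>j\<in>UNIV. lam $ j * (N i j - \<kappa> * G j) * \<bar>w $ j\<bar>)"
      using v(1)[of i] by (simp add: mult_left_mono)
    then have "lam $ i * \<bar>G i * w $ i\<bar>
      \<le> lam $ i * (\<bar>b i\<bar> + v $ i * (\<Sum>j\<in>UNIV. lam $ j * (N i j - \<kappa> * G j) * \<bar>w $ j\<bar>))"
      using lam[of i] by (intro mult_left_mono) auto
    then show ?thesis using G(1)[of i] m by (simp add: abs_mult algebra_simps)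
  qed
  have "(\<Sum>i\<in>UNIV. lam $ i * v $ i * (\<Sum>j\<in>UNIV. lam $ j * (N i j - \<kappa> * G j) * \<bar>w $ j\<bar>))
     = (\<Sum>i\<in>UNIV. lam $ i * v $ i * (\<Sum>j\<in>UNIV. lam $ j * N i j * \<bar>w $ j\<bar>))
       - (\<Sum>i\<in>UNIV. lam $ i * v $ i) * (\<Sum>j\<in>UNIV. lam $ j * (\<kappa> * G j) * \<bar>w $ j\<bar>)"
    by (simp add: left_diff_distrib right_diff_distrib sum_subtractf sum_distrib_right)
  also have "\<dots> = (1 - \<kappa>) * (\<Sum>j\<in>UNIV. lam $ j * (G j * \<bar>w $ j\<bar>))"
    unfolding v(2) degree_vec_swap[of N lam v "\<lambda>j. \<bar>w $ j\<bar>", OF N(1)]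
    unfolding G_def left_diff_distrib sum_distrib_left sum_subtractf[symmetric]
    by (intro sum.cong refl) (simp add: algebra_simps)
  finally have S: "(\<Sum>i\<in>UNIV. lam $ i * v $ i * (\<Sum>j\<in>UNIV. lam $ j * (N i j - \<kappa> * G j) * \<bar>w $ j\<bar>))
     = (1 - \<kappa>) * (\<Sum>j\<in>UNIV. lam $ j * (G j * \<bar>w $ j\<bar>))" .
  have "(\<Sum>i\<in>UNIV. lam $ i * (G i * \<bar>w $ i\<bar>))
      \<le> (\<Sum>i\<in>UNIV. lam $ i * \<bar>b i\<bar>) + (1 - \<kappa>) * (\<Sum>j\<in>UNIV. lam $ j * (G j * \<bar>w $ j\<bar>))"
    unfolding S[symmetric] sum.distrib[symmetric] by (rule sum_mono) (rule pt)
  then have A: "\<kappa> * (\<Sum>i\<in>UNIV. lam $ i * (G i * \<bar>w $ i\<bar>)) \<le> (\<Sum>i\<in>UNIV. lam $ i * \<bar>b i\<bar>)"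
    by (simp add: algebra_simps)
  have "m * (\<Sum>s\<in>UNIV. lam $ s * \<bar>w $ s\<bar>) \<le> (\<Sum>i\<in>UNIV. lam $ i * (G i * \<bar>w $ i\<bar>))"
    unfolding sum_distrib_left
  proof (rule sum_mono)
    fix i
    have "(lam $ i * \<bar>w $ i\<bar>) * m \<le> (lam $ i * \<bar>w $ i\<bar>) * G i"
      using G lam[of i] by (intro mult_left_mono) auto
    then show "m * (lam $ i * \<bar>w $ i\<bar>) \<le> lam $ i * (G i * \<bar>w $ i\<bar>)" by (simp add: mult_ac)
  qed
  then have "\<kappa> * (m * (\<Sum>s\<in>UNIV. lam $ s * \<bar>w $ s\<bar>)) \<le> (\<Sum>i\<in>UNIV. lam $ i * \<bar>b i\<bar>)"
    using A m B by (smt (verit) \<kappa>_def divide_pos_pos mult_left_mono)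
  then show ?thesis using m B by (simp add: \<kappa>_def b_def field_simps power2_eq_square)
qed

text \<open>
  The normalisation \<open>\<Sum>\<^sub>i \<lambda>\<^sub>i w\<^sub>i = 0\<close> replaces \<open>\<Sum>\<^sub>i \<lambda>\<^sub>i G\<^sub>i w\<^sub>i = 0\<close> at the cost of a factor 2: the two normalised
  vectors differ by a multiple of \<open>v\<close>, which spans the kernel.
\<close>

lemma laplacian_coercive:
  fixes lam v w :: "real^'s::finite"
  assumes lam: "\<And>s. 0 < lam $ s" and v: "\<And>s. 0 \<le> v $ s" "(\<Sum>s\<in>UNIV. lam $ s * v $ s) = 1"
    and N: "\<And>i j. N i j = N j i" "\<And>i j. m \<le> N i j" "\<And>i j. N i j \<le> B" and m: "0 < m"
    and w: "(\<Sum>s\<in>UNIV. lam $ s * w $ s) = 0"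
  shows "(\<Sum>s\<in>UNIV. lam $ s * \<bar>w $ s\<bar>)
    \<le> 2 * B / m\<^sup>2 * (\<Sum>s\<in>UNIV. lam $ s * \<bar>laplacian lam N v w s\<bar>)"
proof -
  define G where "G = degree_vec lam N v"
  have G: "m \<le> G i" for i unfolding G_def using degree_vec_bounds[OF lam v N(2,3)] by auto
  have "m * 1 \<le> (\<Sum>s\<in>UNIV. lam $ s * G s * v $ s)"
    unfolding v(2)[symmetric] sum_distrib_left
  proof (rule sum_mono)
    fix i
    have "(lam $ i * v $ i) * m \<le> (lam $ i * v $ i) * G i"
      using G lam[of i] v(1)[of i] by (intro mult_left_mono) auto
    then show "m * (lam $ i * v $ i) \<le> lam $ i * G i * v $ i" by (simp add: mult_ac)
  qed
  then have pos: "0 < (\<Sum>s\<in>UNIV. lam $ s * G s * v $ s)" using m by linarith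
  define c where "c = (\<Sum>s\<in>UNIV. lam $ s * G s * w $ s) / (\<Sum>s\<in>UNIV. lam $ s * G s * v $ s)"
  define u where "u = w - c *\<^sub>R v"
  have "(\<Sum>s\<in>UNIV. lam $ s * G s * u $ s)
      = (\<Sum>s\<in>UNIV. lam $ s * G s * w $ s) - c * (\<Sum>s\<in>UNIV. lam $ s * G s * v $ s)"
    by (simp add: u_def algebra_simps sum_subtractf sum_distrib_left)
  also have "\<dots> = 0" using pos by (simp add: c_def)
  finally have "(\<Sum>s\<in>UNIV. lam $ s * degree_vec lam N v s * u $ s) = 0" by (simp add: G_def)
  from laplacian_coercive_centred[OF lam v N m this]
  have 1: "(\<Sum>s\<in>UNIV. lam $ s * \<bar>u $ s\<bar>)
    \<le> B / m\<^sup>2 * (\<Sum>s\<in>UNIV. lam $ s * \<bar>laplacian lam N v w s\<bar>)"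
    by (simp add: u_def laplacian_diff laplacian_kernel)
  have "(\<Sum>s\<in>UNIV. lam $ s * u $ s) = - c"
    using w v(2) by (simp add: u_def algebra_simps sum_subtractf sum_distrib_left[symmetric])
  then have c: "\<bar>c\<bar> \<le> (\<Sum>s\<in>UNIV. lam $ s * \<bar>u $ s\<bar>)"
    using sum_abs[of "\<lambda>s. lam $ s * u $ s" UNIV] lam by (simp add: abs_mult less_imp_le)
  have "(\<Sum>s\<in>UNIV. lam $ s * \<bar>w $ s\<bar>) \<le> (\<Sum>s\<in>UNIV. lam $ s * \<bar>u $ s\<bar> + \<bar>c\<bar> * (lam $ s * v $ s))"
  proof (rule sum_mono)
    fix s
    have "\<bar>w $ s\<bar> \<le> \<bar>u $ s\<bar> + \<bar>c\<bar> * v $ s"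
      using v(1)[of s] abs_triangle_ineq[of "u $ s" "c * v $ s"] by (simp add: u_def abs_mult)
    then have "lam $ s * \<bar>w $ s\<bar> \<le> lam $ s * (\<bar>u $ s\<bar> + \<bar>c\<bar> * v $ s)"
      using lam[of s] by (intro mult_left_mono) auto
    then show "lam $ s * \<bar>w $ s\<bar> \<le> lam $ s * \<bar>u $ s\<bar> + \<bar>c\<bar> * (lam $ s * v $ s)"
      by (simp add: algebra_simps)
  qed
  also have "\<dots> = (\<Sum>s\<in>UNIV. lam $ s * \<bar>u $ s\<bar>) + \<bar>c\<bar>"
    by (simp add: sum.distrib sum_distrib_left[symmetric] v(2))
  finally show ?thesis using c 1 by simp
qed

lemma laplacian_solvable:
  fixes lam v :: "real^'s::finite"
  assumes lam: "\<And>s. 0 < lam $ s" and v: "\<And>s. 0 \<le> v $ s" "(\<Sum>s\<in>UNIV. lam $ s * v $ s) = 1"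
    and N: "\<And>i j. N i j = N j i" "\<And>i j. m \<le> N i j" "\<And>i j. N i j \<le> B" and m: "0 < m"
    and b: "(\<Sum>s\<in>UNIV. lam $ s * b s) = 0"
  shows "\<exists>!w. (\<Sum>s\<in>UNIV. lam $ s * w $ s) = 0 \<and> (\<forall>i. laplacian lam N v w i = b i)"
proof -
  have zero: "w = 0" if "(\<Sum>s\<in>UNIV. lam $ s * w $ s) = 0" "\<And>i. laplacian lam N v w i = 0" for w
  proof -
    have "(\<Sum>s\<in>UNIV. lam $ s * \<bar>w $ s\<bar>) \<le> 0"
      using laplacian_coercive[where N = N, OF lam v N m that(1)] that(2) by simp
    moreover have nn: "0 \<le> lam $ s * \<bar>w $ s\<bar>" for s using lam[of s] by simp
    ultimately have "(\<Sum>s\<in>UNIV. lam $ s * \<bar>w $ s\<bar>) = 0" by (intro antisym sum_nonneg) auto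
    then have "lam $ s * \<bar>w $ s\<bar> = 0" for s
      using sum_nonneg_eq_0_iff[of UNIV "\<lambda>s. lam $ s * \<bar>w $ s\<bar>"] nn by auto
    then have "w $ s = 0" for s using lam[of s] by (metis abs_eq_0 less_irrefl mult_eq_0_iff)
    then show ?thesis by (simp add: vec_eq_iff)
  qed
  \<comment> \<open>Adding a multiple of \<open>v\<close> makes the operator invertible on the whole space without changing it
     on vectors of weighted sum zero.\<close>
  define A where "A w = (\<chi> i. laplacian lam N v w i + (\<Sum>j\<in>UNIV. lam $ j * w $ j) * v $ i)" for w
  have lc: "(\<Sum>i\<in>UNIV. lam $ i * (f i + S * v $ i))
      = (\<Sum>i\<in>UNIV. lam $ i * f i) + S * (\<Sum>i\<in>UNIV. lam $ i * v $ i)" for f S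
    by (simp add: algebra_simps sum.distrib sum_distrib_left)
  have sumA: "(\<Sum>i\<in>UNIV. lam $ i * A w $ i) = (\<Sum>j\<in>UNIV. lam $ j * w $ j)" for w
    using sum_laplacian[where N = N and lam = lam and v = v and w = w, OF N(1)] v(2)
    by (simp add: A_def lc)
  have lin: "linear A"
    by (rule linearI)
       (simp_all add: A_def vec_eq_iff laplacian_def algebra_simps sum.distrib sum_distrib_left)
  have "inj A"
  proof (rule linear_injective_0[OF lin, THEN iffD2], intro allI impI)
    fix w assume A0: "A w = 0"
    then have s: "(\<Sum>j\<in>UNIV. lam $ j * w $ j) = 0" using sumA[of w] by simp
    have "laplacian lam N v w i = 0" for i
      using arg_cong[OF A0, of "\<lambda>x. x $ i"] s by (simp add: A_def)
    then show "w = 0" using zero s by blast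
  qed
  then have "surj A" using lin linear_injective_imp_surjective by blast
  then obtain w where w: "A w = (\<chi> i. b i)" by (metis surjD)
  have s: "(\<Sum>j\<in>UNIV. lam $ j * w $ j) = 0" using sumA[of w] b by (simp add: w)
  have l: "laplacian lam N v w i = b i" for i
    using arg_cong[OF w, of "\<lambda>x. x $ i"] s by (simp add: A_def)
  show ?thesis
  proof (rule ex1I[of _ w])
    show "(\<Sum>s\<in>UNIV. lam $ s * w $ s) = 0 \<and> (\<forall>i. laplacian lam N v w i = b i)" using s l by blast
    fix w' assume w': "(\<Sum>s\<in>UNIV. lam $ s * w' $ s) = 0 \<and> (\<forall>i. laplacian lam N v w' i = b i)"
    have "w' - w = 0"
      using w' s l by (intro zero) (simp_all add: laplacian_diff algebra_simps sum_subtractf)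
    then show "w' = w" by simp
  qed
qed

section \<open>Bounded Lipschitz functions\<close>

text \<open>
  Bounded Lipschitz real functions on \<open>S\<close>. Boundedness is part of the notion because it makes the class
  closed under products.
\<close>

definition bounded_lipschitz :: "'a::metric_space set \<Rightarrow> ('a \<Rightarrow> real) \<Rightarrow> bool"
  where "bounded_lipschitz S f \<longleftrightarrow>
    (\<exists>B\<ge>0. \<forall>p\<in>S. \<bar>f p\<bar> \<le> B) \<and> (\<exists>L\<ge>0. \<forall>p\<in>S. \<forall>q\<in>S. \<bar>f p - f q\<bar> \<le> L * dist p q)"

lemma bounded_lipschitzE:
  assumes "bounded_lipschitz S f"
  obtains B L where "0 \<le> B" "0 \<le> L" "\<And>p. p \<in> S \<Longrightarrow> \<bar>f p\<bar> \<le> B"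
    "\<And>p q. p \<in> S \<Longrightarrow> q \<in> S \<Longrightarrow> \<bar>f p - f q\<bar> \<le> L * dist p q"
  using assms unfolding bounded_lipschitz_def by blast

lemma bounded_lipschitzI:
  assumes "0 \<le> B" "0 \<le> L" "\<And>p. p \<in> S \<Longrightarrow> \<bar>f p\<bar> \<le> B"
    "\<And>p q. p \<in> S \<Longrightarrow> q \<in> S \<Longrightarrow> \<bar>f p - f q\<bar> \<le> L * dist p q"
  shows "bounded_lipschitz S f"
  using assms unfolding bounded_lipschitz_def by blast

lemma bounded_lipschitz_const [intro]: "bounded_lipschitz S (\<lambda>_. c)"
  by (rule bounded_lipschitzI[of "\<bar>c\<bar>" 0]) auto

lemma bounded_lipschitz_add [intro]:
  assumes "bounded_lipschitz S f" "bounded_lipschitz S g"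
  shows "bounded_lipschitz S (\<lambda>p. f p + g p)"
proof -
  obtain B L where f: "0 \<le> B" "0 \<le> L" "\<And>p. p \<in> S \<Longrightarrow> \<bar>f p\<bar> \<le> B"
    "\<And>p q. p \<in> S \<Longrightarrow> q \<in> S \<Longrightarrow> \<bar>f p - f q\<bar> \<le> L * dist p q"
    using bounded_lipschitzE[OF assms(1)] by blast
  obtain B' L' where g: "0 \<le> B'" "0 \<le> L'" "\<And>p. p \<in> S \<Longrightarrow> \<bar>g p\<bar> \<le> B'"
    "\<And>p q. p \<in> S \<Longrightarrow> q \<in> S \<Longrightarrow> \<bar>g p - g q\<bar> \<le> L' * dist p q"
    using bounded_lipschitzE[OF assms(2)] by blast
  show ?thesis
  proof (rule bounded_lipschitzI[of "B + B'" "L + L'"])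
    show "\<bar>f p + g p\<bar> \<le> B + B'" if "p \<in> S" for p using f(3)[OF that] g(3)[OF that] by linarith
    show "\<bar>f p + g p - (f q + g q)\<bar> \<le> (L + L') * dist p q" if "p \<in> S" "q \<in> S" for p q
      using f(4)[OF that] g(4)[OF that] unfolding distrib_right by linarith
  qed (use f g in auto)
qed

lemma bounded_lipschitz_mult [intro]:
  assumes "bounded_lipschitz S f" "bounded_lipschitz S g"
  shows "bounded_lipschitz S (\<lambda>p. f p * g p)"
proof -
  obtain B L where f: "0 \<le> B" "0 \<le> L" "\<And>p. p \<in> S \<Longrightarrow> \<bar>f p\<bar> \<le> B"
    "\<And>p q. p \<in> S \<Longrightarrow> q \<in> S \<Longrightarrow> \<bar>f p - f q\<bar> \<le> L * dist p q"
    using bounded_lipschitzE[OF assms(1)] by blast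
  obtain B' L' where g: "0 \<le> B'" "0 \<le> L'" "\<And>p. p \<in> S \<Longrightarrow> \<bar>g p\<bar> \<le> B'"
    "\<And>p q. p \<in> S \<Longrightarrow> q \<in> S \<Longrightarrow> \<bar>g p - g q\<bar> \<le> L' * dist p q"
    using bounded_lipschitzE[OF assms(2)] by blast
  show ?thesis
  proof (rule bounded_lipschitzI[of "B * B'" "L * B' + B * L'"])
    show "\<bar>f p * g p\<bar> \<le> B * B'" if "p \<in> S" for p
      unfolding abs_mult using f(3)[OF that] g(3)[OF that] f(1) by (intro mult_mono) auto
    show "\<bar>f p * g p - f q * g q\<bar> \<le> (L * B' + B * L') * dist p q" if "p \<in> S" "q \<in> S" for p q
    proof -
      have "f p * g p - f q * g q = (f p - f q) * g p + f q * (g p - g q)"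
        by (simp add: algebra_simps)
      then have "\<bar>f p * g p - f q * g q\<bar> \<le> \<bar>f p - f q\<bar> * \<bar>g p\<bar> + \<bar>f q\<bar> * \<bar>g p - g q\<bar>"
        by (metis abs_mult abs_triangle_ineq)
      also have "\<dots> \<le> (L * dist p q) * B' + B * (L' * dist p q)"
        using f(4)[OF that] g(4)[OF that] f(3)[OF that(2)] g(3)[OF that(1)] f(1,2) g(1,2)
        by (intro add_mono mult_mono) auto
      finally show ?thesis by (simp add: algebra_simps)
    qed
  qed (use f g in auto)
qed

lemma bounded_lipschitz_minus [intro]:
  "bounded_lipschitz S f \<Longrightarrow> bounded_lipschitz S (\<lambda>p. - f p)"
  using bounded_lipschitz_mult[OF bounded_lipschitz_const, of S f "-1"] by simp

lemma bounded_lipschitz_diff [intro]: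
  "bounded_lipschitz S f \<Longrightarrow> bounded_lipschitz S g \<Longrightarrow> bounded_lipschitz S (\<lambda>p. f p - g p)"
  using bounded_lipschitz_add[OF _ bounded_lipschitz_minus, of S f g] by simp

lemma bounded_lipschitz_sum [intro]:
  assumes "\<And>i. i \<in> I \<Longrightarrow> bounded_lipschitz S (f i)"
  shows "bounded_lipschitz S (\<lambda>p. \<Sum>i\<in>I. f i p)"
  using assms by (induction I rule: infinite_finite_induct) auto

lemma bounded_lipschitz_divide:
  assumes f: "bounded_lipschitz S f" and g: "bounded_lipschitz S g" and c: "0 < c"
    and ge: "\<And>p. p \<in> S \<Longrightarrow> c \<le> g p"
  shows "bounded_lipschitz S (\<lambda>p. f p / g p)"
proof -
  obtain B L where g: "0 \<le> B" "0 \<le> L" "\<And>p. p \<in> S \<Longrightarrow> \<bar>g p\<bar> \<le> B"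
    "\<And>p q. p \<in> S \<Longrightarrow> q \<in> S \<Longrightarrow> \<bar>g p - g q\<bar> \<le> L * dist p q"
    using bounded_lipschitzE[OF assms(2)] by blast
  have "bounded_lipschitz S (\<lambda>p. 1 / g p)"
  proof (rule bounded_lipschitzI[of "1 / c" "L / c\<^sup>2"])
    show "\<bar>1 / g p\<bar> \<le> 1 / c" if "p \<in> S" for p
      using ge[OF that] c by (simp add: frac_le)
    show "\<bar>1 / g p - 1 / g q\<bar> \<le> L / c\<^sup>2 * dist p q" if "p \<in> S" "q \<in> S" for p q
    proof -
      have gp: "c \<le> g p" "c \<le> g q" using ge that by auto
      have "\<bar>1 / g p - 1 / g q\<bar> = \<bar>g p - g q\<bar> / (g p * g q)"
        using gp c by (simp add: field_simps abs_mult abs_minus_commute)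
      also have "\<dots> \<le> (L * dist p q) / (c * c)"
        using g(4)[OF that] gp c g(2) by (intro frac_le mult_mono) auto
      finally show ?thesis by (simp add: power2_eq_square)
    qed
  qed (use c g in auto)
  from bounded_lipschitz_mult[OF f this] show ?thesis by simp
qed

lemma powr_three_halves: "0 \<le> x \<Longrightarrow> x powr (3/2) = x * sqrt x" for x :: real
proof -
  assume "0 \<le> x"
  have "x powr (3/2) = x powr (1 + 1/2)" by simp
  also have "\<dots> = x powr 1 * x powr (1/2)" by (rule powr_add)
  finally show ?thesis using \<open>0 \<le> x\<close> by (simp add: powr_half_sqrt)
qed

text \<open>
  The function \<open>x \<mapsto> x powr (3/2)\<close> is locally Lipschitz up to the boundary point \<open>0\<close>, unlike the
  square root.
\<close>

lemma abs_powr_three_halves_diff: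
  fixes x y :: real
  assumes "0 \<le> x" "0 \<le> y"
  shows "\<bar>x powr (3/2) - y powr (3/2)\<bar> \<le> (sqrt x + sqrt y) * \<bar>x - y\<bar>"
proof -
  define p q where "p = sqrt x" and "q = sqrt y"
  have pq: "0 \<le> p" "0 \<le> q" "x = p * p" "y = q * q" using assms by (auto simp: p_def q_def)
  have "x powr (3/2) - y powr (3/2) = (p - q) * (p * p + p * q + q * q)"
    using powr_three_halves[OF assms(1)] powr_three_halves[OF assms(2)] pq
    unfolding p_def[symmetric] q_def[symmetric] by (simp add: algebra_simps)
  then have "\<bar>x powr (3/2) - y powr (3/2)\<bar> = \<bar>p - q\<bar> * (p * p + p * q + q * q)"
    using pq by (simp add: abs_mult)
  also have "\<dots> \<le> \<bar>p - q\<bar> * ((p + q) * (p + q))"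
    using pq by (intro mult_left_mono) (auto simp: algebra_simps)
  also have "\<dots> = (p + q) * \<bar>(p - q) * (p + q)\<bar>" using pq by (simp add: abs_mult)
  also have "(p - q) * (p + q) = x - y" using pq by (simp add: algebra_simps)
  finally show ?thesis by (simp add: p_def q_def)
qed

lemma bounded_lipschitz_powr_three_halves:
  assumes "bounded_lipschitz S f" and nn: "\<And>p. p \<in> S \<Longrightarrow> 0 \<le> f p"
  shows "bounded_lipschitz S (\<lambda>p. f p powr (3/2))"
proof -
  obtain B L where f: "0 \<le> B" "0 \<le> L" "\<And>p. p \<in> S \<Longrightarrow> \<bar>f p\<bar> \<le> B"
    "\<And>p q. p \<in> S \<Longrightarrow> q \<in> S \<Longrightarrow> \<bar>f p - f q\<bar> \<le> L * dist p q"
    using bounded_lipschitzE[OF assms(1)] by blast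
  show ?thesis
  proof (rule bounded_lipschitzI[of "B powr (3/2)" "2 * sqrt B * L"])
    show "\<bar>f p powr (3/2)\<bar> \<le> B powr (3/2)" if "p \<in> S" for p
      using f(3)[OF that] nn[OF that] by (auto intro!: powr_mono2)
    show "\<bar>f p powr (3/2) - f q powr (3/2)\<bar> \<le> 2 * sqrt B * L * dist p q" if "p \<in> S" "q \<in> S" for p q
    proof -
      have "sqrt (f p) \<le> sqrt B" "sqrt (f q) \<le> sqrt B" using f(3) that by (auto simp: abs_le_iff)
      then have "sqrt (f p) + sqrt (f q) \<le> 2 * sqrt B" by linarith
      then have "(sqrt (f p) + sqrt (f q)) * \<bar>f p - f q\<bar> \<le> (2 * sqrt B) * (L * dist p q)"
        using f(1,2) f(4)[OF that] nn that by (intro mult_mono) auto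
      then show ?thesis using abs_powr_three_halves_diff[OF nn[OF that(1)] nn[OF that(2)]] by simp
    qed
  qed (use f in auto)
qed

lemma power_series_bounded_lipschitz:
  fixes a :: "'s::finite list \<Rightarrow> real"
  assumes a: "converges_below a R" and \<theta>: "0 < \<theta>" "\<theta> < 1"
  shows "bounded_lipschitz {x. \<forall>s. 0 \<le> x $ s \<and> x $ s \<le> \<theta> * R $ s} (power_series a)"
proof -
  let ?S = "{x::real^'s. \<forall>s. 0 \<le> x $ s \<and> x $ s \<le> \<theta> * R $ s}"
  have S: "?S = cbox 0 (\<theta> *\<^sub>R R)" by (auto simp: mem_box_cart)
  have abs: "\<bar>x $ s\<bar> \<le> \<theta> * R $ s" if "x \<in> ?S" for x s using that by auto
  have lt: "\<bar>x $ s\<bar> < R $ s" if "x \<in> ?S" for x s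
    using abs[OF that, of s] converges_belowD(3)[OF a, of s] \<theta> by (smt (verit) mult_less_cancel_right2)
  define B where "B s = (\<Sum>k. hom_part (diff_coeffs s a) k R * \<theta> ^ k)" for s
  have B: "\<bar>power_series (diff_coeffs s a) x\<bar> \<le> B s" if "x \<in> ?S" for s x
    unfolding B_def by (rule summable_hom_part(2)[OF converges_below_diff_coeffs[OF a] \<theta> abs[OF that]])
  have bnd: "onorm (\<lambda>h. \<Sum>s\<in>UNIV. h $ s * power_series (diff_coeffs s a) x) \<le> (\<Sum>s\<in>UNIV. B s)"
    if "x \<in> ?S" for x
  proof (rule onorm_le)
    fix h :: "real^'s"
    have "norm (\<Sum>s\<in>UNIV. h $ s * power_series (diff_coeffs s a) x) \<le> (\<Sum>s\<in>UNIV. norm h * B s)"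
      unfolding real_norm_def
      by (rule order_trans[OF sum_abs], intro sum_mono, unfold abs_mult, intro mult_mono B[OF that])
         (auto intro: component_le_norm_cart)
    then show "norm (\<Sum>s\<in>UNIV. h $ s * power_series (diff_coeffs s a) x) \<le> (\<Sum>s\<in>UNIV. B s) * norm h"
      by (simp only: sum_distrib_right mult.commute[of "norm h"])
  qed
  have zero: "0 \<in> ?S" using \<theta> converges_belowD(3)[OF a] by (auto simp: less_imp_le)
  show ?thesis
  proof (rule bounded_lipschitzI)
    show "\<bar>power_series a x\<bar> \<le> (\<Sum>k. hom_part a k R * \<theta> ^ k)" if "x \<in> ?S" for x
      by (rule summable_hom_part(2)[OF a \<theta> abs[OF that]])
    then show "0 \<le> (\<Sum>k. hom_part a k R * \<theta> ^ k)" using zero by (meson abs_ge_zero order_trans)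
    show "0 \<le> (\<Sum>s\<in>UNIV. B s)" using B[OF zero] by (intro sum_nonneg) (meson abs_ge_zero order_trans)
    fix x y assume xy: "x \<in> ?S" "y \<in> ?S"
    have "norm (power_series a x - power_series a y) \<le> (\<Sum>s\<in>UNIV. B s) * norm (x - y)"
    proof (rule differentiable_bound[OF _ _ bnd xy])
      show "convex ?S" unfolding S by (rule convex_box)
      show "(power_series a has_derivative (\<lambda>h. \<Sum>s\<in>UNIV. h $ s * power_series (diff_coeffs s a) z))
         (at z within ?S)" if "z \<in> ?S" for z
        by (rule has_derivative_at_withinI[OF power_series_has_derivative[OF a lt[OF that]]])
    qed
    then show "\<bar>power_series a x - power_series a y\<bar> \<le> (\<Sum>s\<in>UNIV. B s) * dist x y"
      by (simp add: dist_norm)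
  qed
qed

lemma bounded_lipschitz_fst:
  assumes "bounded_lipschitz S f"
  shows "bounded_lipschitz (S \<times> T) (\<lambda>p. f (fst p))"
proof -
  obtain B L where f: "0 \<le> B" "0 \<le> L" "\<And>p. p \<in> S \<Longrightarrow> \<bar>f p\<bar> \<le> B"
    "\<And>p q. p \<in> S \<Longrightarrow> q \<in> S \<Longrightarrow> \<bar>f p - f q\<bar> \<le> L * dist p q"
    using bounded_lipschitzE[OF assms(1)] by blast
  show ?thesis
  proof (rule bounded_lipschitzI[OF f(1,2)])
    show "\<bar>f (fst p)\<bar> \<le> B" if "p \<in> S \<times> T" for p using that f(3) by auto
    show "\<bar>f (fst p) - f (fst q)\<bar> \<le> L * dist p q" if "p \<in> S \<times> T" "q \<in> S \<times> T" for p q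
      using that f(4)[of "fst p" "fst q"] mult_left_mono[OF dist_fst_le f(2), of p q]
      by (auto simp: mem_Times_iff)
  qed
qed

section \<open>The acceleration as a function of position and velocity\<close>

lemma laplacian_eq_sum:
  "laplacian lam N v w i
    = (\<Sum>j\<in>UNIV. ((if i = j then degree_vec lam N v i else 0) - v $ i * (lam $ j * N i j)) * w $ j)"
proof -
  have "(\<Sum>j\<in>UNIV. (if i = j then degree_vec lam N v i else 0) * w $ j) = degree_vec lam N v i * w $ i"
    by (simp add: if_distrib[of "\<lambda>c. c * _"] cong: if_cong)
  then show ?thesis
    unfolding left_diff_distrib sum_subtractf laplacian_def
    by (simp add: sum_distrib_left mult_ac)
qed

lemma weighted_simplex_iff:
  "v \<in> weighted_simplex lam \<longleftrightarrow> (\<forall>s. 0 \<le> v $ s) \<and> (\<Sum>s\<in>UNIV. lam $ s * v $ s) = 1"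
  by (simp add: weighted_simplex_def inner_vec_def)

text \<open>
  The coefficients \<open>a\<close> play the role of those of \<open>\<xi>\<close>. The last assumption bounds the constant terms of
  the second derivatives \<open>\<partial>\<^sub>i\<partial>\<^sub>j\<xi>\<close> from below.
\<close>

locale species_series =
  fixes lam :: "real^'s::finite" and a :: "'s list \<Rightarrow> real" and m :: real
  assumes lam_pos: "\<And>s. 0 < lam $ s"
    and lam_sum: "(\<Sum>s\<in>UNIV. lam $ s) = 1"
    and m_pos: "0 < m"
    and second_order_ge: "\<And>i j. m * (lam $ i * lam $ j) \<le> diff_coeffs j (diff_coeffs i a) []"
begin

text \<open>
  \<open>N\<^sub>i\<^sub>j = \<partial>\<^sub>i\<partial>\<^sub>j\<xi> / (\<lambda>\<^sub>i \<lambda>\<^sub>j)\<close>; hence \<open>\<partial>\<^sub>j\<xi>\<^sup>i = \<lambda>\<^sub>j N\<^sub>i\<^sub>j\<close>.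
\<close>

definition kern :: "real^'s \<Rightarrow> 's \<Rightarrow> 's \<Rightarrow> real"
  where "kern x i j = power_series (diff_coeffs j (diff_coeffs i a)) x / (lam $ i * lam $ j)"

text \<open>
  \<open>Q\<^sub>i = \<Sum>\<^sub>j\<^sub>k \<partial>\<^sub>j\<partial>\<^sub>k\<xi>\<^sup>i v\<^sub>j v\<^sub>k\<close>, the part of \<open>(\<xi>\<^sup>i \<circ> \<Phi>)''\<close> that does not involve \<open>\<Phi>''\<close>.
\<close>

definition quad :: "real^'s \<Rightarrow> real^'s \<Rightarrow> 's \<Rightarrow> real"
  where "quad x v i = (\<Sum>j\<in>UNIV. \<Sum>k\<in>UNIV.
     power_series (diff_coeffs k (diff_coeffs j (diff_coeffs i a))) x / lam $ i * v $ j * v $ k)"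

text \<open>
\<open>G\<^sub>i = \<Sum>\<^sub>j \<partial>\<^sub>j\<xi>\<^sup>i v\<^sub>j\<close>, the derivative of \<open>\<xi>\<^sup>i\<close> in the direction \<open>v\<close>.
\<close>

definition deg :: "real^'s \<Rightarrow> real^'s \<Rightarrow> 's \<Rightarrow> real"
  where "deg x v = degree_vec lam (kern x) v"

text \<open>
  The common value of the two sides of the tree-descending equation, up to the factor \<open>2\<close>. It is
  the only value for which the weighted sum of \<open>force\<close> below vanishes.
\<close>

definition psi :: "real^'s \<Rightarrow> real^'s \<Rightarrow> real"
  where "psi x v = - (\<Sum>s\<in>UNIV. lam $ s * (v $ s * quad x v s)) /
                     (\<Sum>s\<in>UNIV. lam $ s * (v $ s * deg x v s) powr (3/2))"

text \<open>
The right-hand side of the linear system for \<open>\<Phi>''\<close>.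
\<close>

definition force :: "real^'s \<Rightarrow> real^'s \<Rightarrow> 's \<Rightarrow> real"
  where "force x v i = v $ i * quad x v i + psi x v * (v $ i * deg x v i) powr (3/2)"

text \<open>
  The second derivative \<open>\<Phi>''\<close> prescribed by the equation when \<open>\<Phi> = x\<close> and \<open>\<Phi>' = v\<close>. The solution is
  unique for \<open>v\<close> in the simplex and \<open>x \<ge> 0\<close> within the box of convergence, as lemma \<open>accel\<close> below states.
\<close>

definition accel :: "real^'s \<Rightarrow> real^'s \<Rightarrow> real^'s"
  where "accel x v = (THE w. (\<Sum>s\<in>UNIV. lam $ s * w $ s) = 0 \<and>
                             (\<forall>i. laplacian lam (kern x) v w i = force x v i))"

lemma simplexD:
  assumes "v \<in> weighted_simplex lam"
  shows "\<And>s. 0 \<le> v $ s" "(\<Sum>s\<in>UNIV. lam $ s * v $ s) = 1"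
  using assms by (auto simp: weighted_simplex_iff)

lemma simplex_component_le:
  assumes "v \<in> weighted_simplex lam"
  shows "v $ s \<le> 1 / lam $ s"
proof -
  have "lam $ s * v $ s \<le> (\<Sum>s\<in>UNIV. lam $ s * v $ s)"
    using simplexD(1)[OF assms] lam_pos by (intro member_le_sum) (auto simp: less_imp_le)
  then show ?thesis using simplexD(2)[OF assms] lam_pos[of s] by (simp add: field_simps)
qed

lemma kern_sym: "symmetric_coeffs a \<Longrightarrow> kern x i j = kern x j i"
  unfolding kern_def by (simp add: diff_coeffs_commute[of a j i] mult.commute)

lemma kern_ge:
  assumes "converges_below a R" "\<And>s. 0 \<le> x $ s" "\<And>s. x $ s < R $ s"
  shows "m \<le> kern x i j"
proof -
  have "m * (lam $ i * lam $ j) \<le> power_series (diff_coeffs j (diff_coeffs i a)) x"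
    using power_series_ge_const[OF converges_below_diff_coeffs[OF converges_below_diff_coeffs[OF assms(1)]] assms(2,3)]
      second_order_ge order_trans by blast
  then show ?thesis using lam_pos[of i] lam_pos[of j] by (simp add: kern_def pos_le_divide_eq)
qed

lemma kern_le_Max: "kern x i j \<le> Max (range (\<lambda>(i, j). kern x i j))"
  by (rule Max_ge) auto

lemma deg_ge:
  assumes "converges_below a R" "\<And>s. 0 \<le> x $ s" "\<And>s. x $ s < R $ s" "v \<in> weighted_simplex lam"
  shows "m \<le> deg x v i"
  unfolding deg_def
  by (rule degree_vec_bounds(1)[OF lam_pos simplexD[OF assms(4)] kern_ge[OF assms(1-3)] kern_le_Max])

lemma cubic_sum_ge:
  assumes "converges_below a R" "\<And>s. 0 \<le> x $ s" "\<And>s. x $ s < R $ s" "v \<in> weighted_simplex lam"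
  shows "Min (range (($) lam)) * m powr (3/2) \<le> (\<Sum>s\<in>UNIV. lam $ s * (v $ s * deg x v s) powr (3/2))"
proof -
  have "\<exists>s. 1 \<le> v $ s"
  proof (rule ccontr)
    assume "\<not> (\<exists>s. 1 \<le> v $ s)"
    then have "(\<Sum>s\<in>UNIV. lam $ s * v $ s) < (\<Sum>s\<in>UNIV. lam $ s)"
      using lam_pos by (intro sum_strict_mono) (auto simp: not_le)
    then show False using simplexD(2)[OF assms(4)] lam_sum by simp
  qed
  then obtain s where s: "1 \<le> v $ s" by blast
  have d: "m \<le> deg x v s" by (rule deg_ge[OF assms])
  have "1 * m \<le> v $ s * deg x v s" using s d m_pos by (intro mult_mono) auto
  then have "m powr (3/2) \<le> (v $ s * deg x v s) powr (3/2)"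
    using m_pos by (intro powr_mono2) auto
  then have "Min (range (($) lam)) * m powr (3/2) \<le> lam $ s * (v $ s * deg x v s) powr (3/2)"
    using lam_pos[of s] by (intro mult_mono) (auto intro: Min_le)
  also have "\<dots> \<le> (\<Sum>s\<in>UNIV. lam $ s * (v $ s * deg x v s) powr (3/2))"
    using lam_pos by (intro member_le_sum) (auto simp: less_imp_le)
  finally show ?thesis .
qed

lemma Min_lam_pos: "0 < Min (range (($) lam))"
  using lam_pos by (subst Min_gr_iff) auto

lemma sum_force:
  assumes "converges_below a R" "\<And>s. 0 \<le> x $ s" "\<And>s. x $ s < R $ s" "v \<in> weighted_simplex lam"
  shows "(\<Sum>s\<in>UNIV. lam $ s * force x v s) = 0"
proof -
  define D where "D = (\<Sum>s\<in>UNIV. lam $ s * (v $ s * deg x v s) powr (3/2))"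
  have "0 < Min (range (($) lam)) * m powr (3/2)" using Min_lam_pos m_pos by simp
  then have D: "0 < D" using cubic_sum_ge[OF assms] unfolding D_def by (rule less_le_trans)
  have "(\<Sum>s\<in>UNIV. lam $ s * force x v s) = (\<Sum>s\<in>UNIV. lam $ s * (v $ s * quad x v s)) + psi x v * D"
    unfolding D_def sum_distrib_left sum.distrib[symmetric]
    by (intro sum.cong refl) (simp add: force_def algebra_simps)
  then show ?thesis using D by (simp add: psi_def D_def[symmetric])
qed

lemma accel:
  assumes "converges_below a R" "\<And>s. 0 \<le> x $ s" "\<And>s. x $ s < R $ s" "v \<in> weighted_simplex lam"
  shows "(\<Sum>s\<in>UNIV. lam $ s * accel x v $ s) = 0"
    and "laplacian lam (kern x) v (accel x v) i = force x v i"
    and "\<And>w. (\<Sum>s\<in>UNIV. lam $ s * w $ s) = 0 \<Longrightarrow>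
       (\<And>i. laplacian lam (kern x) v w i = force x v i) \<Longrightarrow> w = accel x v"
proof -
  have ex: "\<exists>!w. (\<Sum>s\<in>UNIV. lam $ s * w $ s) = 0 \<and> (\<forall>i. laplacian lam (kern x) v w i = force x v i)"
    by (rule laplacian_solvable[OF lam_pos simplexD[OF assms(4)]
          kern_sym[OF converges_belowD(2)[OF assms(1)]] kern_ge[OF assms(1-3)] kern_le_Max m_pos
          sum_force[OF assms]])
  from theI'[OF ex] show "(\<Sum>s\<in>UNIV. lam $ s * accel x v $ s) = 0"
    "laplacian lam (kern x) v (accel x v) i = force x v i"
    unfolding accel_def by blast+
  show "w = accel x v" if "(\<Sum>s\<in>UNIV. lam $ s * w $ s) = 0"
       "\<And>i. laplacian lam (kern x) v w i = force x v i" for w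
    unfolding accel_def using the1_equality[OF ex] that by blast
qed

text \<open>
  Positions in the closed box \<open>[0, \<theta>R]\<close> together with velocities in the simplex. For \<open>\<theta> < 1\<close> all derivatives
  of a power series that converges below \<open>R\<close> are bounded on it.
\<close>

definition phase_box :: "real^'s \<Rightarrow> real \<Rightarrow> ((real^'s) \<times> (real^'s)) set"
  where "phase_box R \<theta> = {x. \<forall>s. 0 \<le> x $ s \<and> x $ s \<le> \<theta> * R $ s} \<times> weighted_simplex lam"

lemma phase_boxD:
  assumes "converges_below a R" "0 < \<theta>" "\<theta> < 1" "p \<in> phase_box R \<theta>"
  shows "\<And>s. 0 \<le> fst p $ s" "\<And>s. fst p $ s < R $ s" "snd p \<in> weighted_simplex lam"
proof -
  show "0 \<le> fst p $ s" for s using assms by (auto simp: phase_box_def mem_Times_iff)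
  show "snd p \<in> weighted_simplex lam" using assms by (auto simp: phase_box_def mem_Times_iff)
  have "fst p $ s \<le> \<theta> * R $ s" for s using assms(4) by (auto simp: phase_box_def mem_Times_iff)
  moreover have "\<theta> * R $ s < R $ s" for s using converges_belowD(3)[OF assms(1), of s] assms(3) by simp
  ultimately show "fst p $ s < R $ s" for s by (meson le_less_trans)
qed

context
  fixes R :: "real^'s" and \<theta> :: real
  assumes conv: "converges_below a R" and \<theta>: "0 < \<theta>" "\<theta> < 1"
begin

lemma bounded_lipschitz_velocity: "bounded_lipschitz (phase_box R \<theta>) (\<lambda>p. snd p $ s)"
proof (rule bounded_lipschitzI[of "1 / lam $ s" 1])
  show "\<bar>snd p $ s\<bar> \<le> 1 / lam $ s" if "p \<in> phase_box R \<theta>" for p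
    using simplex_component_le[of "snd p" s] simplexD(1)[of "snd p" s] phase_boxD[OF conv \<theta> that] by simp
  show "\<bar>snd p $ s - snd q $ s\<bar> \<le> 1 * dist p q" for p q :: "(real^'s) \<times> (real^'s)"
    using component_le_norm_cart[of "snd p - snd q" s] dist_snd_le[of p q] by (simp add: dist_norm)
qed (use lam_pos[of s] in auto)

lemma bounded_lipschitz_power_series:
  "converges_below b R \<Longrightarrow> bounded_lipschitz (phase_box R \<theta>) (\<lambda>p. power_series b (fst p))"
  unfolding phase_box_def by (intro bounded_lipschitz_fst power_series_bounded_lipschitz \<theta>)

lemma bounded_lipschitz_kern: "bounded_lipschitz (phase_box R \<theta>) (\<lambda>p. kern (fst p) i j)"
  unfolding kern_def divide_inverse
  by (intro bounded_lipschitz_mult bounded_lipschitz_const bounded_lipschitz_power_series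
        converges_below_diff_coeffs conv)

lemma bounded_lipschitz_quad: "bounded_lipschitz (phase_box R \<theta>) (\<lambda>p. quad (fst p) (snd p) i)"
  unfolding quad_def divide_inverse
  by (intro bounded_lipschitz_sum bounded_lipschitz_mult bounded_lipschitz_const
        bounded_lipschitz_velocity bounded_lipschitz_power_series converges_below_diff_coeffs conv)

lemma bounded_lipschitz_deg: "bounded_lipschitz (phase_box R \<theta>) (\<lambda>p. deg (fst p) (snd p) i)"
  unfolding deg_def degree_vec_def
  by (intro bounded_lipschitz_sum bounded_lipschitz_mult bounded_lipschitz_const
        bounded_lipschitz_velocity bounded_lipschitz_kern)

lemma bounded_lipschitz_cubic:
  "bounded_lipschitz (phase_box R \<theta>) (\<lambda>p. (snd p $ i * deg (fst p) (snd p) i) powr (3/2))"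
proof (intro bounded_lipschitz_powr_three_halves bounded_lipschitz_mult
    bounded_lipschitz_velocity bounded_lipschitz_deg)
  fix p assume p: "p \<in> phase_box R \<theta>"
  note D = phase_boxD[OF conv \<theta> p]
  show "0 \<le> snd p $ i * deg (fst p) (snd p) i"
    using simplexD(1)[OF D(3), of i] deg_ge[OF conv D, of i] m_pos by simp
qed

lemma bounded_lipschitz_psi: "bounded_lipschitz (phase_box R \<theta>) (\<lambda>p. psi (fst p) (snd p))"
  unfolding psi_def
proof (rule bounded_lipschitz_divide[of _ _ _ "Min (range (($) lam)) * m powr (3/2)"])
  show "0 < Min (range (($) lam)) * m powr (3/2)" using Min_lam_pos m_pos by simp
  show "Min (range (($) lam)) * m powr (3/2)
      \<le> (\<Sum>s\<in>UNIV. lam $ s * (snd p $ s * deg (fst p) (snd p) s) powr (3/2))"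
    if "p \<in> phase_box R \<theta>" for p
    by (rule cubic_sum_ge[OF conv phase_boxD[OF conv \<theta> that]])
qed (intro bounded_lipschitz_minus bounded_lipschitz_sum bounded_lipschitz_mult bounded_lipschitz_const
        bounded_lipschitz_velocity bounded_lipschitz_quad bounded_lipschitz_cubic)+

lemma bounded_lipschitz_force: "bounded_lipschitz (phase_box R \<theta>) (\<lambda>p. force (fst p) (snd p) i)"
  unfolding force_def
  by (intro bounded_lipschitz_add bounded_lipschitz_mult
        bounded_lipschitz_velocity bounded_lipschitz_quad bounded_lipschitz_psi bounded_lipschitz_cubic)

lemma kern_le: obtains B where "0 < B" "\<And>p i j. p \<in> phase_box R \<theta> \<Longrightarrow> kern (fst p) i j \<le> B"
proof -
  have "\<exists>B\<ge>0. \<forall>p\<in>phase_box R \<theta>. \<bar>kern (fst p) i j\<bar> \<le> B" for i j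
    using bounded_lipschitz_kern[of i j] unfolding bounded_lipschitz_def by blast
  then obtain b where b: "\<And>i j. 0 \<le> b i j" "\<And>i j p. p \<in> phase_box R \<theta> \<Longrightarrow> \<bar>kern (fst p) i j\<bar> \<le> b i j"
    by metis
  have "kern (fst p) i j \<le> 1 + (\<Sum>i\<in>UNIV. \<Sum>j\<in>UNIV. b i j)" if "p \<in> phase_box R \<theta>" for p i j
  proof -
    have "b i j \<le> (\<Sum>j\<in>UNIV. b i j)" using b by (intro member_le_sum) auto
    also have "\<dots> \<le> (\<Sum>i\<in>UNIV. \<Sum>j\<in>UNIV. b i j)" using b by (intro member_le_sum sum_nonneg) auto
    finally show ?thesis using b(2)[OF that, of i j] by linarith
  qed
  moreover have "0 < 1 + (\<Sum>i\<in>UNIV. \<Sum>j\<in>UNIV. b i j)"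
    using b(1) by (intro add_pos_nonneg sum_nonneg) auto
  ultimately show ?thesis using that by blast
qed

lemma weighted_norm_le:
  obtains C where "0 \<le> C" "\<And>p w. p \<in> phase_box R \<theta> \<Longrightarrow> (\<Sum>s\<in>UNIV. lam $ s * w $ s) = 0 \<Longrightarrow>
    (\<Sum>s\<in>UNIV. lam $ s * \<bar>w $ s\<bar>) \<le> C * (\<Sum>s\<in>UNIV. lam $ s * \<bar>laplacian lam (kern (fst p)) (snd p) w s\<bar>)"
proof -
  obtain B where B: "0 < B" "\<And>p i j. p \<in> phase_box R \<theta> \<Longrightarrow> kern (fst p) i j \<le> B"
    using kern_le by blast
  show ?thesis
  proof (rule that[of "2 * B / m\<^sup>2"])
    show "0 \<le> 2 * B / m\<^sup>2" using B by simp
    fix p :: "(real^'s) \<times> (real^'s)" and w :: "real^'s"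
    assume p: "p \<in> phase_box R \<theta>" and w: "(\<Sum>s\<in>UNIV. lam $ s * w $ s) = 0"
    note D = phase_boxD[OF conv \<theta> p]
    show "(\<Sum>s\<in>UNIV. lam $ s * \<bar>w $ s\<bar>)
      \<le> 2 * B / m\<^sup>2 * (\<Sum>s\<in>UNIV. lam $ s * \<bar>laplacian lam (kern (fst p)) (snd p) w s\<bar>)"
      by (rule laplacian_coercive[OF lam_pos simplexD[OF D(3)] kern_sym[OF converges_belowD(2)[OF conv]]
            kern_ge[OF conv D(1,2)] B(2)[OF p] m_pos w])
  qed
qed

lemma component_le_weighted_norm: "\<bar>w $ s\<bar> \<le> (\<Sum>s\<in>UNIV. lam $ s * \<bar>w $ s\<bar>) / lam $ s"
proof -
  have "lam $ s * \<bar>w $ s\<bar> \<le> (\<Sum>s\<in>UNIV. lam $ s * \<bar>w $ s\<bar>)"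
    using lam_pos by (intro member_le_sum) (auto simp: less_imp_le)
  then show ?thesis using lam_pos[of s] by (simp add: pos_le_divide_eq mult.commute)
qed

text \<open>
  Subtracting the linear systems at two points \<open>p\<close> and \<open>q\<close> gives a system at \<open>p\<close> for the difference of
  the two solutions, with a right-hand side of the order of the distance; coercivity does the rest.
\<close>

lemma bounded_lipschitz_accel: "bounded_lipschitz (phase_box R \<theta>) (\<lambda>p. accel (fst p) (snd p) $ s)"
proof -
  let ?S = "phase_box R \<theta>"
  define w where "w p = accel (fst p) (snd p)" for p
  define E where "E p i j = (if i = j then deg (fst p) (snd p) i else 0)
      - snd p $ i * (lam $ j * kern (fst p) i j)" for p i j
  have lap: "laplacian lam (kern (fst p)) (snd p) u i = (\<Sum>j\<in>UNIV. E p i j * u $ j)" for p u i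
    unfolding laplacian_eq_sum E_def deg_def ..
  have wsum: "(\<Sum>s\<in>UNIV. lam $ s * w p $ s) = 0" if "p \<in> ?S" for p
    unfolding w_def by (rule accel(1)[OF conv phase_boxD[OF conv \<theta> that]])
  have wlap: "laplacian lam (kern (fst p)) (snd p) (w p) i = force (fst p) (snd p) i" if "p \<in> ?S" for p i
    unfolding w_def by (rule accel(2)[OF conv phase_boxD[OF conv \<theta> that]])
  obtain C where C: "0 \<le> C" "\<And>p w. p \<in> ?S \<Longrightarrow> (\<Sum>s\<in>UNIV. lam $ s * w $ s) = 0 \<Longrightarrow>
    (\<Sum>s\<in>UNIV. lam $ s * \<bar>w $ s\<bar>) \<le> C * (\<Sum>s\<in>UNIV. lam $ s * \<bar>laplacian lam (kern (fst p)) (snd p) w s\<bar>)"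
    using weighted_norm_le by blast
  have "bounded_lipschitz ?S (\<lambda>p. if i = j then deg (fst p) (snd p) i else 0)" for i j
    by (cases "i = j") (simp_all add: bounded_lipschitz_deg bounded_lipschitz_const)
  then have bE: "bounded_lipschitz ?S (\<lambda>p. E p i j)" for i j
    unfolding E_def by (intro bounded_lipschitz_diff bounded_lipschitz_mult bounded_lipschitz_const
        bounded_lipschitz_velocity bounded_lipschitz_kern)
  have "\<exists>L\<ge>0. \<forall>p\<in>?S. \<forall>q\<in>?S. \<bar>E p i j - E q i j\<bar> \<le> L * dist p q" for i j
    using bE[of i j] unfolding bounded_lipschitz_def by blast
  then obtain LE where LE: "\<And>i j. 0 \<le> LE i j"
    "\<And>i j p q. p \<in> ?S \<Longrightarrow> q \<in> ?S \<Longrightarrow> \<bar>E p i j - E q i j\<bar> \<le> LE i j * dist p q"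
    by metis
  have "\<exists>L B. 0 \<le> L \<and> 0 \<le> B \<and> (\<forall>p\<in>?S. \<bar>force (fst p) (snd p) i\<bar> \<le> B) \<and>
     (\<forall>p\<in>?S. \<forall>q\<in>?S. \<bar>force (fst p) (snd p) i - force (fst q) (snd q) i\<bar> \<le> L * dist p q)" for i
    using bounded_lipschitz_force[of i] unfolding bounded_lipschitz_def by blast
  then obtain LF BF where F: "\<And>i. 0 \<le> LF i" "\<And>i. 0 \<le> BF i"
    "\<And>i p. p \<in> ?S \<Longrightarrow> \<bar>force (fst p) (snd p) i\<bar> \<le> BF i"
    "\<And>i p q. p \<in> ?S \<Longrightarrow> q \<in> ?S \<Longrightarrow>
        \<bar>force (fst p) (snd p) i - force (fst q) (snd q) i\<bar> \<le> LF i * dist p q"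
    by metis
  define W where "W i = C * (\<Sum>s\<in>UNIV. lam $ s * BF s) / lam $ i" for i
  have W0: "0 \<le> W i" for i
    unfolding W_def using C F(2) lam_pos by (intro divide_nonneg_pos mult_nonneg_nonneg sum_nonneg)
      (auto simp: less_imp_le)
  have W: "\<bar>w p $ i\<bar> \<le> W i" if p: "p \<in> ?S" for p i
  proof -
    have "C * (\<Sum>s\<in>UNIV. lam $ s * \<bar>laplacian lam (kern (fst p)) (snd p) (w p) s\<bar>)
        \<le> C * (\<Sum>s\<in>UNIV. lam $ s * BF s)"
      unfolding wlap[OF p] using F(3)[OF p] lam_pos C(1)
      by (intro mult_left_mono sum_mono) (auto simp: less_imp_le)
    then have "(\<Sum>s\<in>UNIV. lam $ s * \<bar>w p $ s\<bar>) / lam $ i \<le> W i"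
      unfolding W_def using C(2)[OF p wsum[OF p]] lam_pos[of i] by (intro divide_right_mono) auto
    then show ?thesis using component_le_weighted_norm[of "w p" i] by linarith
  qed
  define L where "L = C * (\<Sum>s\<in>UNIV. lam $ s * (LF s + (\<Sum>j\<in>UNIV. LE s j * W j))) / lam $ s"
  have "\<bar>w p $ s - w q $ s\<bar> \<le> L * dist p q" if p: "p \<in> ?S" and q: "q \<in> ?S" for p q
  proof -
    define u where "u = w p - w q"
    have u: "(\<Sum>s\<in>UNIV. lam $ s * u $ s) = 0"
      using wsum[OF p] wsum[OF q] by (simp add: u_def right_diff_distrib sum_subtractf)
    have lu: "\<bar>laplacian lam (kern (fst p)) (snd p) u i\<bar> \<le> (LF i + (\<Sum>j\<in>UNIV. LE i j * W j)) * dist p q" for i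
    proof -
      have "laplacian lam (kern (fst p)) (snd p) u i
         = (laplacian lam (kern (fst p)) (snd p) (w p) i - laplacian lam (kern (fst q)) (snd q) (w q) i)
           - (\<Sum>j\<in>UNIV. (E p i j - E q i j) * w q $ j)"
        unfolding u_def laplacian_diff lap by (simp add: left_diff_distrib sum_subtractf)
      then have "\<bar>laplacian lam (kern (fst p)) (snd p) u i\<bar>
         \<le> \<bar>force (fst p) (snd p) i - force (fst q) (snd q) i\<bar> + \<bar>\<Sum>j\<in>UNIV. (E p i j - E q i j) * w q $ j\<bar>"
        unfolding wlap[OF p] wlap[OF q] by linarith
      also have "\<bar>\<Sum>j\<in>UNIV. (E p i j - E q i j) * w q $ j\<bar> \<le> (\<Sum>j\<in>UNIV. (LE i j * dist p q) * W j)"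
        by (rule order_trans[OF sum_abs], intro sum_mono, unfold abs_mult, intro mult_mono)
           (use LE(2)[OF p q] W[OF q] LE(1) in auto)
      also have "\<dots> = (\<Sum>j\<in>UNIV. LE i j * W j) * dist p q"
        unfolding sum_distrib_right by (simp add: mult_ac)
      finally show ?thesis using F(4)[OF p q, of i] by (simp add: distrib_right)
    qed
    have "(\<Sum>s\<in>UNIV. lam $ s * \<bar>laplacian lam (kern (fst p)) (snd p) u s\<bar>)
       \<le> (\<Sum>s\<in>UNIV. lam $ s * ((LF s + (\<Sum>j\<in>UNIV. LE s j * W j)) * dist p q))"
      using lu lam_pos by (intro sum_mono mult_left_mono) (auto simp: less_imp_le)
    also have "\<dots> = (\<Sum>s\<in>UNIV. lam $ s * (LF s + (\<Sum>j\<in>UNIV. LE s j * W j))) * dist p q"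
      by (simp add: sum_distrib_right mult.assoc)
    finally have "C * (\<Sum>s\<in>UNIV. lam $ s * \<bar>laplacian lam (kern (fst p)) (snd p) u s\<bar>)
       \<le> C * ((\<Sum>s\<in>UNIV. lam $ s * (LF s + (\<Sum>j\<in>UNIV. LE s j * W j))) * dist p q)"
      using C(1) by (rule mult_left_mono)
    then have "(\<Sum>s\<in>UNIV. lam $ s * \<bar>u $ s\<bar>) / lam $ s
       \<le> (C * ((\<Sum>s\<in>UNIV. lam $ s * (LF s + (\<Sum>j\<in>UNIV. LE s j * W j))) * dist p q)) / lam $ s"
      using C(2)[OF p u] lam_pos[of s] by (intro divide_right_mono) auto
    then show ?thesis
      using component_le_weighted_norm[of u s] by (simp add: u_def L_def mult.assoc)
  qed
  moreover have "0 \<le> L"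
    unfolding L_def using C(1) F(1) LE(1) W0 lam_pos
    by (intro divide_nonneg_pos mult_nonneg_nonneg sum_nonneg add_nonneg_nonneg) (auto simp: less_imp_le)
  ultimately show ?thesis
    using bounded_lipschitzI[of "W s" L ?S "\<lambda>p. w p $ s"] W W0 by (simp add: w_def)
qed

lemma accel_lipschitz:
  obtains L where "0 \<le> L" "\<And>p q. p \<in> phase_box R \<theta> \<Longrightarrow> q \<in> phase_box R \<theta> \<Longrightarrow>
    norm (accel (fst p) (snd p) - accel (fst q) (snd q)) \<le> L * dist p q"
proof -
  let ?S = "phase_box R \<theta>"
  have "\<exists>L\<ge>0. \<forall>p\<in>?S. \<forall>q\<in>?S. \<bar>accel (fst p) (snd p) $ i - accel (fst q) (snd q) $ i\<bar> \<le> L * dist p q" for i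
    using bounded_lipschitz_accel[of i] unfolding bounded_lipschitz_def by blast
  then obtain L where L: "\<And>i. 0 \<le> L i" "\<And>i p q. p \<in> ?S \<Longrightarrow> q \<in> ?S \<Longrightarrow>
     \<bar>accel (fst p) (snd p) $ i - accel (fst q) (snd q) $ i\<bar> \<le> L i * dist p q"
    by metis
  show ?thesis
  proof (rule that[of "\<Sum>i\<in>UNIV. L i"])
    show "0 \<le> (\<Sum>i\<in>UNIV. L i)" using L(1) by (intro sum_nonneg) auto
    fix p q assume pq: "p \<in> ?S" "q \<in> ?S"
    have "norm (accel (fst p) (snd p) - accel (fst q) (snd q))
       \<le> (\<Sum>i\<in>UNIV. \<bar>accel (fst p) (snd p) $ i - accel (fst q) (snd q) $ i\<bar>)"
      using norm_le_l1_cart[of "accel (fst p) (snd p) - accel (fst q) (snd q)"] by simp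
    also have "\<dots> \<le> (\<Sum>i\<in>UNIV. L i) * dist p q"
      unfolding sum_distrib_right using L(2)[OF pq] by (intro sum_mono) auto
    finally show "norm (accel (fst p) (snd p) - accel (fst q) (snd q)) \<le> (\<Sum>i\<in>UNIV. L i) * dist p q" .
  qed
qed

text \<open>
  Every term of the equation except \<open>G\<^sub>i w\<^sub>i\<close> contains the factor \<open>v\<^sub>i\<close>.
\<close>

lemma accel_le_velocity:
  obtains C where "0 \<le> C" "\<And>p. p \<in> phase_box R \<theta> \<Longrightarrow> \<bar>accel (fst p) (snd p) $ i\<bar> \<le> C * snd p $ i"
proof -
  let ?S = "phase_box R \<theta>"
  define h where "h p = (\<Sum>j\<in>UNIV. lam $ j * kern (fst p) i j * accel (fst p) (snd p) $ j)
     + quad (fst p) (snd p) i" for p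
  have "bounded_lipschitz ?S h"
    unfolding h_def by (intro bounded_lipschitz_add bounded_lipschitz_sum bounded_lipschitz_mult
        bounded_lipschitz_const bounded_lipschitz_kern bounded_lipschitz_accel bounded_lipschitz_quad)
  then obtain B1 where B1: "0 \<le> B1" "\<And>p. p \<in> ?S \<Longrightarrow> \<bar>h p\<bar> \<le> B1"
    by (rule bounded_lipschitzE) blast
  have "bounded_lipschitz ?S (\<lambda>p. psi (fst p) (snd p) * deg (fst p) (snd p) i)"
    by (intro bounded_lipschitz_mult bounded_lipschitz_psi bounded_lipschitz_deg)
  then obtain B2 where B2: "0 \<le> B2" "\<And>p. p \<in> ?S \<Longrightarrow> \<bar>psi (fst p) (snd p) * deg (fst p) (snd p) i\<bar> \<le> B2"
    by (rule bounded_lipschitzE) blast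
  have "bounded_lipschitz ?S (\<lambda>p. snd p $ i * deg (fst p) (snd p) i)"
    by (intro bounded_lipschitz_mult bounded_lipschitz_velocity bounded_lipschitz_deg)
  then obtain B3 where B3: "0 \<le> B3" "\<And>p. p \<in> ?S \<Longrightarrow> \<bar>snd p $ i * deg (fst p) (snd p) i\<bar> \<le> B3"
    by (rule bounded_lipschitzE) blast
  show ?thesis
  proof (rule that[of "(B1 + B2 * sqrt B3) / m"])
    show "0 \<le> (B1 + B2 * sqrt B3) / m" using B1 B2 B3 m_pos by simp
    fix p assume p: "p \<in> ?S"
    note D = phase_boxD[OF conv \<theta> p]
    define v where "v = snd p $ i"
    define d where "d = deg (fst p) (snd p) i"
    have v: "0 \<le> v" unfolding v_def by (rule simplexD(1)[OF D(3)])
    have d: "m \<le> d" unfolding d_def by (rule deg_ge[OF conv D])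
    have vd: "0 \<le> v * d" using v d m_pos by simp
    have f: "force (fst p) (snd p) i
        = v * quad (fst p) (snd p) i + psi (fst p) (snd p) * ((v * d) * sqrt (v * d))"
      unfolding force_def v_def[symmetric] d_def[symmetric] powr_three_halves[OF vd] by simp
    have "d * accel (fst p) (snd p) $ i = v * (h p + (psi (fst p) (snd p) * d) * sqrt (v * d))"
      using accel(2)[OF conv D, of i] unfolding f laplacian_def deg_def[symmetric] d_def[symmetric] v_def[symmetric] h_def
      by (simp add: algebra_simps)
    then have "\<bar>d * accel (fst p) (snd p) $ i\<bar> = \<bar>v * (h p + (psi (fst p) (snd p) * d) * sqrt (v * d))\<bar>"
      by (rule arg_cong)
    then have eq: "d * \<bar>accel (fst p) (snd p) $ i\<bar> = v * \<bar>h p + (psi (fst p) (snd p) * d) * sqrt (v * d)\<bar>"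
      using v d m_pos by (simp only: abs_mult[of d] abs_mult[of v] abs_of_nonneg)
    have "\<bar>(psi (fst p) (snd p) * d) * sqrt (v * d)\<bar> \<le> B2 * sqrt B3"
      unfolding abs_mult[of _ "sqrt (v * d)"] using B2(1) B2(2)[OF p] B3(2)[OF p] vd
      by (intro mult_mono) (auto simp: v_def d_def)
    then have "\<bar>h p + (psi (fst p) (snd p) * d) * sqrt (v * d)\<bar> \<le> B1 + B2 * sqrt B3"
      using B1(2)[OF p] by linarith
    then have "d * \<bar>accel (fst p) (snd p) $ i\<bar> \<le> v * (B1 + B2 * sqrt B3)"
      unfolding eq using v by (rule mult_left_mono)
    moreover have "m * \<bar>accel (fst p) (snd p) $ i\<bar> \<le> d * \<bar>accel (fst p) (snd p) $ i\<bar>"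
      using d by (intro mult_right_mono) auto
    ultimately have "m * \<bar>accel (fst p) (snd p) $ i\<bar> \<le> v * (B1 + B2 * sqrt B3)" by linarith
    then show "\<bar>accel (fst p) (snd p) $ i\<bar> \<le> (B1 + B2 * sqrt B3) / m * snd p $ i"
      using m_pos by (simp add: v_def field_simps)
  qed
qed

end

end

section \<open>The coefficients of the covariance function\<close>

text \<open>
  The coefficients of \<open>\<xi>\<close> as a power series. Entries on lists of length less than 2 are set to \<open>0\<close>, so that
  the series starts in degree 2.
\<close>

definition xi_coeffs :: "real^'s::finite \<Rightarrow> ('s list \<Rightarrow> real) \<Rightarrow> 's list \<Rightarrow> real"
  where "xi_coeffs lam gam ss = (if 2 \<le> length ss then (gam ss)\<^sup>2 * (\<Prod>s\<leftarrow>ss. lam $ s) else 0)"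

lemma prod_list_map_mult:
  "(\<Prod>s\<leftarrow>ss. f s * g s) = (\<Prod>s\<leftarrow>ss. f s) * (\<Prod>s\<leftarrow>ss. g s)" for f g :: "'a \<Rightarrow> real"
  by (induction ss) (simp_all add: mult_ac)

lemma prod_list_map_pos: "(\<And>s. 0 < f s) \<Longrightarrow> 0 < (\<Prod>s\<leftarrow>ss. f s)" for f :: "'a \<Rightarrow> real"
  by (induction ss) simp_all

lemma hom_part_xi_coeffs:
  "hom_part (xi_coeffs lam gam) (k + 2) y = (\<Sum>ss\<in>multi_indices (k + 2). xi_term lam gam y ss)"
  unfolding hom_part_def
  by (rule sum.cong) (auto simp: multi_indices_def xi_coeffs_def xi_term_def prod_list_map_mult)

lemma hom_part_xi_coeffs_low:
  assumes "k < 2"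
  shows "hom_part (xi_coeffs lam gam) k y = 0"
  unfolding hom_part_def using assms by (intro sum.neutral) (auto simp: multi_indices_def xi_coeffs_def)

lemma sum_prod_list: "(\<Sum>ss\<in>multi_indices k. \<Prod>s\<leftarrow>ss. f $ s) = (\<Sum>s\<in>UNIV. f $ s) ^ k"
  for f :: "real^'s::finite"
proof (induction k)
  case 0
  then show ?case by (simp add: multi_indices_def)
next
  case (Suc k)
  show ?case unfolding sum_multi_indices_Suc
    by (simp add: sum_distrib_left[symmetric] sum_distrib_right[symmetric] Suc)
qed

section \<open>Monotonicity and derivatives on closed intervals\<close>

lemma nondecreasing_within:
  fixes f f' :: "real \<Rightarrow> real"
  assumes d: "\<And>q. q \<in> {a..b} \<Longrightarrow> (f has_real_derivative f' q) (at q within {a..b})"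
    and nn: "\<And>q. q \<in> {a..b} \<Longrightarrow> 0 \<le> f' q" and xy: "a \<le> x" "x \<le> y" "y \<le> b"
  shows "f x \<le> f y"
proof (rule DERIV_nonneg_imp_increasing_open[OF xy(2)])
  have "continuous_on {a..b} f"
    unfolding continuous_on_eq_continuous_within using d has_field_derivative_imp_has_derivative
    by (meson has_derivative_continuous)
  then show "continuous_on {x..y} f" using xy by (rule_tac continuous_on_subset) auto
  fix q assume q: "x < q" "q < y"
  then have "q \<in> {a..b}" "at q within {a..b} = at q" using xy by (auto intro!: at_within_Icc_at)
  then show "\<exists>D. DERIV f q :> D \<and> 0 \<le> D" using d[of q] nn[of q] by auto
qed

lemma constant_within:
  fixes f :: "real \<Rightarrow> real"
  assumes d: "\<And>q. q \<in> {a..b} \<Longrightarrow> (f has_real_derivative 0) (at q within {a..b})"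
    and x: "a \<le> x" "x \<le> b"
  shows "f x = f a"
proof (rule antisym)
  show "f a \<le> f x" using nondecreasing_within[OF d, of a x] x by auto
  have "((\<lambda>q. - f q) has_real_derivative 0) (at q within {a..b})" if "q \<in> {a..b}" for q
    using DERIV_minus[OF d[OF that]] by simp
  from nondecreasing_within[OF this, of a x] x show "f x \<le> f a" by auto
qed

lemma real_derivative_unique_within:
  assumes "a < b" "q \<in> {a..b}" "(f has_real_derivative x) (at q within {a..b})"
    "(f has_real_derivative y) (at q within {a..b})"
  shows "x = y"
  using vector_derivative_unique_within_closed_interval[of a b q f x y] assms
  by (simp add: has_real_derivative_iff_has_vector_derivative)

lemma has_vector_derivative_component:
  assumes "(f has_vector_derivative f') F"
  shows "((\<lambda>q. f q $ s) has_real_derivative f' $ s) F"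
  unfolding has_real_derivative_iff_has_vector_derivative
  by (rule bounded_linear.has_vector_derivative[OF bounded_linear_vec_nth assms])

lemma power_series_along_curve:
  assumes b: "converges_below b R" and lt: "\<And>s. \<bar>\<Phi> q $ s\<bar> < R $ s"
    and \<Phi>: "(\<Phi> has_vector_derivative v) (at q within I)"
  shows "((\<lambda>p. power_series b (\<Phi> p)) has_real_derivative
     (\<Sum>j\<in>UNIV. power_series (diff_coeffs j b) (\<Phi> q) * v $ j)) (at q within I)"
proof -
  have "((\<lambda>p. power_series b (\<Phi> p)) has_derivative
     (\<lambda>h. \<Sum>s\<in>UNIV. (h *\<^sub>R v) $ s * power_series (diff_coeffs s b) (\<Phi> q))) (at q within I)"
    by (rule has_derivative_compose[OF \<Phi>[unfolded has_vector_derivative_def] power_series_has_derivative[OF b lt]])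
  moreover have "(\<lambda>h. \<Sum>s\<in>UNIV. (h *\<^sub>R v) $ s * power_series (diff_coeffs s b) (\<Phi> q))
      = (*) (\<Sum>j\<in>UNIV. power_series (diff_coeffs j b) (\<Phi> q) * v $ j)"
    unfolding fun_eq_iff sum_distrib_right by (auto intro!: sum.cong)
  ultimately show ?thesis by (simp add: has_field_derivative_def)
qed

section \<open>The power series of the model and its domain\<close>

locale tree_model =
  fixes lam :: "real^'s::finite" and gam :: "'s list \<Rightarrow> real"
  assumes lam_pos: "\<And>s. 0 < lam $ s"
    and lam_sum: "(\<Sum>s\<in>UNIV. lam $ s) = 1"
    and gam_sym: "symmetric_tensors gam"
    and gam_summable: "summable (\<lambda>k. 2 ^ (k + 2) * tensor_sup_norm gam (k + 2))"
    and nondeg: "non_degenerate gam"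
begin

text \<open>
  A lower bound for \<open>N\<close> at the origin: there \<open>\<partial>\<^sub>i\<partial>\<^sub>j\<xi> = 2 \<gamma>\<^sub>i\<^sub>j\<^sup>2 \<lambda>\<^sub>i \<lambda>\<^sub>j\<close>.
\<close>

definition curvature_min :: real
  where "curvature_min = Min (range (\<lambda>(i, j). 2 * (gam [i, j])\<^sup>2))"

sublocale species_series lam "xi_coeffs lam gam" curvature_min
proof
  show "0 < lam $ s" for s by (rule lam_pos)
  show "(\<Sum>s\<in>UNIV. lam $ s) = 1" by (rule lam_sum)
  have "gam [i, j] > 0" for i j using nondeg by (auto simp: non_degenerate_def multi_indices_def)
  then show "0 < curvature_min" unfolding curvature_min_def
    by (subst Min_gr_iff) (auto simp: zero_less_power2 less_imp_neq[symmetric] split: prod.splits)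
  show "curvature_min * (lam $ i * lam $ j) \<le> diff_coeffs j (diff_coeffs i (xi_coeffs lam gam)) []" for i j
  proof -
    have "curvature_min \<le> 2 * (gam [i, j])\<^sup>2" unfolding curvature_min_def by (rule Min_le) auto
    then have "curvature_min * (lam $ i * lam $ j) \<le> 2 * (gam [i, j])\<^sup>2 * (lam $ i * lam $ j)"
      using lam_pos[of i] lam_pos[of j] by (intro mult_right_mono) auto
    then show ?thesis by (simp add: diff_coeffs_def xi_coeffs_def mult_ac)
  qed
qed

abbreviation coeffs where "coeffs \<equiv> xi_coeffs lam gam"

lemma coeffs_nonneg: "0 \<le> coeffs ss"
  unfolding xi_coeffs_def using prod_list_map_pos[of "($) lam" ss] lam_pos by (auto simp: less_imp_le)

lemma coeffs_symmetric: "symmetric_coeffs coeffs"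
  unfolding symmetric_coeffs_def
proof (intro allI impI)
  fix ss ss' :: "'s list" assume eq: "mset ss = mset ss'"
  have "(\<Prod>s\<leftarrow>ss. lam $ s) = prod_mset (image_mset (($) lam) (mset ss))" for ss
    by (induction ss) simp_all
  then have "(\<Prod>s\<leftarrow>ss. lam $ s) = (\<Prod>s\<leftarrow>ss'. lam $ s)" using eq by metis
  moreover have "gam ss = gam ss'" if "2 \<le> length ss"
    using gam_sym eq that unfolding symmetric_tensors_def by blast
  ultimately show "coeffs ss = coeffs ss'"
    using mset_eq_length[OF eq] by (simp add: xi_coeffs_def)
qed

text \<open>
  On the unit box \<open>\<Sum>\<^sub>s \<lambda>\<^sub>s y\<^sub>s \<le> 1\<close>, so the part of degree \<open>k\<close> is at most the square of the sup norm of the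
  \<open>k\<close>-th tensor, and these sup norms are bounded and summable.
\<close>

lemma converges_below_unit: "converges_below coeffs 1"
  unfolding converges_below_def
proof (intro conjI allI impI)
  show "0 \<le> coeffs ss" for ss by (rule coeffs_nonneg)
  show "symmetric_coeffs coeffs" by (rule coeffs_symmetric)
  show "0 < (1 :: real^'s) $ s" for s by simp
  fix \<theta> :: real assume \<theta>: "0 < \<theta>" "\<theta> < 1"
  define T where "T k = tensor_sup_norm gam k" for k
  have T: "\<bar>gam ss\<bar> \<le> T k" if "ss \<in> multi_indices k" for ss k
    unfolding T_def tensor_sup_norm_def using that by (intro Max_ge) auto
  have T0: "0 \<le> T k" for k
    using T[of "replicate k undefined" k] by (simp add: multi_indices_def)
  have nn1: "0 \<le> hom_part coeffs k 1" for k by (intro hom_part_nonneg coeffs_nonneg) simp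
  have le: "hom_part coeffs (k + 2) 1 \<le> (T (k + 2))\<^sup>2" for k
  proof -
    have "hom_part coeffs (k + 2) 1 \<le> (\<Sum>ss\<in>multi_indices (k + 2). (T (k + 2))\<^sup>2 * (\<Prod>s\<leftarrow>ss. lam $ s))"
      unfolding hom_part_xi_coeffs
    proof (rule sum_mono)
      fix ss :: "'s list" assume ss: "ss \<in> multi_indices (k + 2)"
      have "(gam ss)\<^sup>2 \<le> (T (k + 2))\<^sup>2" using power_mono[OF T[OF ss], of 2] by simp
      then show "xi_term lam gam 1 ss \<le> (T (k + 2))\<^sup>2 * (\<Prod>s\<leftarrow>ss. lam $ s)"
        unfolding xi_term_def using prod_list_map_pos[of "($) lam" ss] lam_pos
        by (simp add: mult_right_mono less_imp_le)
    qed
    also have "\<dots> = (T (k + 2))\<^sup>2" by (simp add: sum_distrib_left[symmetric] sum_prod_list lam_sum)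
    finally show ?thesis .
  qed
  obtain M where M: "\<And>k. 2 ^ (k + 2) * T (k + 2) \<le> M"
    using summable_imp_bounded[OF gam_summable] unfolding bounded_iff T_def
    by (auto dest: abs_le_D1)
  have "norm (hom_part coeffs (k + 2) 1 * \<theta> ^ (k + 2)) \<le> M * (2 ^ (k + 2) * T (k + 2))" for k
  proof -
    have p: "1 \<le> (2::real) ^ (k + 2)" by (rule one_le_power) simp
    have T1: "T (k + 2) \<le> 2 ^ (k + 2) * T (k + 2)" using mult_right_mono[OF p T0[of "k + 2"]] by simp
    have "hom_part coeffs (k + 2) 1 * \<theta> ^ (k + 2) \<le> (T (k + 2))\<^sup>2 * 1"
      using \<theta> by (intro mult_mono le power_le_one) auto
    also have "(T (k + 2))\<^sup>2 * 1 \<le> M * (2 ^ (k + 2) * T (k + 2))"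
      unfolding power2_eq_square mult_1_right
      using order_trans[OF T1 M[of k]] T1 T0[of "k + 2"] order_trans[OF T0[of "k + 2"] order_trans[OF T1 M[of k]]]
      by (intro mult_mono)
    finally show ?thesis using nn1 \<theta> by (simp add: abs_mult)
  qed
  then have "summable (\<lambda>k. hom_part coeffs (k + 2) 1 * \<theta> ^ (k + 2))"
    unfolding T_def by (intro summable_comparison_test'[OF summable_mult[OF gam_summable, of M], of 0])
  then show "summable (\<lambda>k. hom_part coeffs k 1 * \<theta> ^ k)"
    by (rule summable_iff_shift[THEN iffD1])
qed

lemma summable_abs_xi_term:
  assumes "converges_below coeffs R" "\<And>s. \<bar>y $ s\<bar> < R $ s"
  shows "summable (\<lambda>k. \<Sum>ss\<in>multi_indices (k + 2). \<bar>xi_term lam gam y ss\<bar>)"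
proof -
  define z :: "real^'s" where "z = (\<chi> s. \<bar>y $ s\<bar>)"
  obtain \<theta> where \<theta>: "0 < \<theta>" "\<theta> < 1" and z: "\<And>s. \<bar>z $ s\<bar> < \<theta> * R $ s"
    by (rule box_scale[of z R]) (use assms(2) in \<open>auto simp: z_def\<close>)
  have "\<bar>\<Prod>s\<leftarrow>ss. lam $ s * y $ s\<bar> = (\<Prod>s\<leftarrow>ss. lam $ s * z $ s)" for ss
    using lam_pos by (induction ss) (simp_all add: abs_mult z_def abs_of_pos)
  then have "\<bar>xi_term lam gam y ss\<bar> = xi_term lam gam z ss" for ss
    by (simp add: xi_term_def abs_mult)
  then have "(\<lambda>k. \<Sum>ss\<in>multi_indices (k + 2). \<bar>xi_term lam gam y ss\<bar>) = (\<lambda>k. hom_part coeffs (k + 2) z)"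
    by (simp only: hom_part_xi_coeffs)
  moreover have "summable (\<lambda>k. hom_part coeffs k z)"
    using z less_imp_le by (intro summable_hom_part(1)[OF assms(1) \<theta>]) blast
  ultimately show ?thesis using summable_ignore_initial_segment[of "\<lambda>k. hom_part coeffs k z" 2] by simp
qed

lemma xi_domainI:
  assumes "converges_below coeffs R" "\<And>s. \<bar>y $ s\<bar> < R $ s"
  shows "y \<in> xi_domain lam gam"
proof -
  have S: "x \<in> box (- R) R \<longleftrightarrow> (\<forall>s. \<bar>x $ s\<bar> < R $ s)" for x
    unfolding mem_box_cart by (simp add: abs_less_iff) (metis minus_less_iff)
  show ?thesis unfolding xi_domain_def
    by (rule interiorI[of "box (- R) R"])
       (use S assms summable_abs_xi_term[OF assms(1)] in \<open>auto simp: open_box\<close>)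
qed

text \<open>
  Absolute convergence in a neighbourhood of \<open>y\<close> includes a point whose coordinates exceed those of \<open>y\<close> in
  absolute value.
\<close>

lemma xi_domainE:
  assumes "y \<in> xi_domain lam gam"
  obtains R where "converges_below coeffs R" "\<And>s. \<bar>y $ s\<bar> < R $ s"
proof -
  obtain e where e: "0 < e"
    "ball y e \<subseteq> {x. summable (\<lambda>k. \<Sum>ss\<in>multi_indices (k + 2). \<bar>xi_term lam gam x ss\<bar>)}"
    using assms unfolding xi_domain_def mem_interior by blast
  define d where "d = e / (2 * real CARD('s))"
  have d: "0 < d" using e by (simp add: d_def)
  define \<sigma> where "\<sigma> s = (if 0 \<le> y $ s then 1 else - 1 :: real)" for s
  define x where "x = (\<chi> s. y $ s + \<sigma> s * d)"
  define R where "R = (\<chi> s. \<bar>y $ s\<bar> + d)"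
  have xR: "\<bar>x $ s\<bar> = R $ s" for s using d by (auto simp: x_def R_def \<sigma>_def)
  have "norm (x - y) \<le> (\<Sum>s\<in>UNIV. \<bar>(x - y) $ s\<bar>)" by (rule norm_le_l1_cart)
  also have "\<dots> \<le> (\<Sum>s\<in>(UNIV::'s set). d)" by (intro sum_mono) (use d in \<open>auto simp: x_def \<sigma>_def\<close>)
  also have "\<dots> < e" using e by (simp add: d_def)
  finally have "x \<in> ball y e" by (simp add: dist_norm norm_minus_commute)
  then have "summable (\<lambda>k. \<Sum>ss\<in>multi_indices (k + 2). \<bar>xi_term lam gam x ss\<bar>)" using e by blast
  moreover have "\<bar>xi_term lam gam x ss\<bar> = xi_term lam gam R ss" for ss
  proof -
    have "\<bar>\<Prod>s\<leftarrow>ss. lam $ s * x $ s\<bar> = (\<Prod>s\<leftarrow>ss. lam $ s * R $ s)" for ss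
      using lam_pos by (induction ss) (simp_all add: abs_mult xR abs_of_pos)
    then show ?thesis by (simp add: xi_term_def abs_mult)
  qed
  ultimately have sm: "summable (\<lambda>k. hom_part coeffs (k + 2) R)" by (simp only: hom_part_xi_coeffs)
  then have sm: "summable (\<lambda>k. hom_part coeffs k R)" by (subst (asm) summable_iff_shift)
  have R: "0 < R $ s" for s using d by (simp add: R_def add_nonneg_pos)
  have nn: "0 \<le> hom_part coeffs k R" for k using R by (intro hom_part_nonneg coeffs_nonneg) (auto simp: less_imp_le)
  have "converges_below coeffs R"
    unfolding converges_below_def
  proof (intro conjI allI impI coeffs_nonneg coeffs_symmetric R)
    fix \<theta> :: real assume \<theta>: "0 < \<theta>" "\<theta> < 1"
    show "summable (\<lambda>k. hom_part coeffs k R * \<theta> ^ k)"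
    proof (rule summable_comparison_test'[OF sm, of 0])
      fix k
      have "hom_part coeffs k R * \<theta> ^ k \<le> hom_part coeffs k R * 1"
        using \<theta> nn by (intro mult_left_mono power_le_one) auto
      then show "norm (hom_part coeffs k R * \<theta> ^ k) \<le> hom_part coeffs k R"
        using nn \<theta> by (simp add: abs_mult)
    qed
  qed
  moreover have "\<bar>y $ s\<bar> < R $ s" for s using d by (simp add: R_def)
  ultimately show ?thesis using that by blast
qed

lemma xi_eq_power_series:
  assumes "converges_below coeffs R" "\<And>s. \<bar>y $ s\<bar> < R $ s"
  shows "xi lam gam y = power_series coeffs y"
proof -
  obtain \<theta> where \<theta>: "0 < \<theta>" "\<theta> < 1" and z: "\<And>s. \<bar>y $ s\<bar> < \<theta> * R $ s"
    using box_scale[OF assms(2)] by metis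
  have "summable (\<lambda>k. hom_part coeffs k y)"
    using z less_imp_le by (intro summable_hom_part(1)[OF assms(1) \<theta>]) blast
  from suminf_split_initial_segment[OF this, of 2]
  have "power_series coeffs y = (\<Sum>k. hom_part coeffs (k + 2) y) + (\<Sum>k<2. hom_part coeffs k y)"
    by (simp add: power_series_def)
  also have "(\<Sum>k<2. hom_part coeffs k y) = 0" by (intro sum.neutral) (simp add: hom_part_xi_coeffs_low)
  finally show ?thesis by (simp only: xi_def hom_part_xi_coeffs add_0_right)
qed

lemma open_abs_box: "open {x::real^'s. \<forall>s. \<bar>x $ s\<bar> < R $ s}"
proof -
  have "{x::real^'s. \<forall>s. \<bar>x $ s\<bar> < R $ s} = box (- R) R"
    unfolding set_eq_iff mem_box_cart by (simp add: abs_less_iff) (metis minus_less_iff)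
  then show ?thesis by (simp add: open_box)
qed

lemma xi_species_eq:
  assumes c: "converges_below coeffs R" and y: "\<And>s. \<bar>y $ s\<bar> < R $ s"
  shows "xi_species lam gam s y = power_series (diff_coeffs s coeffs) y / lam $ s"
proof -
  let ?c = "\<lambda>u. y + u *\<^sub>R axis s 1"
  have "(power_series coeffs has_derivative
      (\<lambda>h. \<Sum>s\<in>UNIV. h $ s * power_series (diff_coeffs s coeffs) y)) (at y)"
    by (rule power_series_has_derivative[OF c y])
  then have "(xi lam gam has_derivative
      (\<lambda>h. \<Sum>s\<in>UNIV. h $ s * power_series (diff_coeffs s coeffs) y)) (at y)"
    by (rule has_derivative_transform_within_open[OF _ open_abs_box[of R]])
       (use y xi_eq_power_series[OF c] in auto)
  then have "(xi lam gam has_derivative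
      (\<lambda>h. \<Sum>s\<in>UNIV. h $ s * power_series (diff_coeffs s coeffs) y)) (at (?c 0))" by simp
  moreover have "(?c has_derivative (\<lambda>h. h *\<^sub>R axis s 1)) (at 0)"
    by (auto intro!: derivative_eq_intros)
  ultimately have "((\<lambda>u. xi lam gam (?c u)) has_derivative
      (\<lambda>h. \<Sum>i\<in>UNIV. (h *\<^sub>R axis s 1) $ i * power_series (diff_coeffs i coeffs) y)) (at 0)"
    by (rule has_derivative_compose[rotated])
  moreover have "(\<Sum>i\<in>UNIV. (h *\<^sub>R axis s 1) $ i * power_series (diff_coeffs i coeffs) y)
      = power_series (diff_coeffs s coeffs) y * h" for h :: real
    by (simp add: axis_def if_distrib[of "\<lambda>c. _ * c"] if_distrib[of "\<lambda>c. c * _"] cong: if_cong)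
  ultimately have "((\<lambda>u. xi lam gam (?c u)) has_field_derivative power_series (diff_coeffs s coeffs) y) (at 0)"
    by (simp add: has_field_derivative_def)
  then have "deriv (\<lambda>u. xi lam gam (?c u)) 0 = power_series (diff_coeffs s coeffs) y"
    by (rule DERIV_imp_deriv)
  then show ?thesis by (simp add: xi_species_def divide_inverse mult.commute)
qed

lemma xi_species_along_curve:
  assumes dom: "\<Phi> q \<in> xi_domain lam gam" and q: "q \<in> I"
    and d: "(\<Phi> has_vector_derivative v) (at q within I)"
  shows "((\<lambda>p. xi_species lam gam s (\<Phi> p)) has_real_derivative deg (\<Phi> q) v s) (at q within I)"
proof -
  obtain R where c: "converges_below coeffs R" and lt: "\<And>s. \<bar>\<Phi> q $ s\<bar> < R $ s"
    using xi_domainE[OF dom] by blast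
  have "continuous (at q within I) \<Phi>"
    using d has_vector_derivative_continuous by blast
  then have "\<forall>\<^sub>F p in at q within I. \<Phi> p \<in> {x::real^'s. \<forall>s. \<bar>x $ s\<bar> < R $ s}"
    unfolding continuous_within by (rule topological_tendstoD[OF _ open_abs_box]) (use lt in simp)
  then obtain e where e: "0 < e" "\<And>p. p \<in> I \<Longrightarrow> p \<noteq> q \<Longrightarrow> dist p q < e \<Longrightarrow> (\<forall>s. \<bar>\<Phi> p $ s\<bar> < R $ s)"
    unfolding eventually_at by auto
  have near: "\<bar>\<Phi> p $ s\<bar> < R $ s" if "p \<in> I" "dist p q < e" for p s
    using e(2)[OF that(1) _ that(2)] lt by (cases "p = q") auto
  have "((\<lambda>p. power_series (diff_coeffs s coeffs) (\<Phi> p)) has_real_derivative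
     (\<Sum>j\<in>UNIV. power_series (diff_coeffs j (diff_coeffs s coeffs)) (\<Phi> q) * v $ j)) (at q within I)"
    by (rule power_series_along_curve[OF converges_below_diff_coeffs[OF c] lt d])
  then have "((\<lambda>p. power_series (diff_coeffs s coeffs) (\<Phi> p) / lam $ s) has_real_derivative
     (\<Sum>j\<in>UNIV. power_series (diff_coeffs j (diff_coeffs s coeffs)) (\<Phi> q) * v $ j) / lam $ s) (at q within I)"
    by (rule DERIV_cdivide)
  moreover have "(\<Sum>j\<in>UNIV. power_series (diff_coeffs j (diff_coeffs s coeffs)) (\<Phi> q) * v $ j) / lam $ s
     = deg (\<Phi> q) v s"
  proof -
    have "lam $ j \<noteq> 0" for j using lam_pos[of j] by simp
    then show ?thesis
      unfolding deg_def degree_vec_def kern_def sum_divide_distrib by (intro sum.cong refl) simp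
  qed
  ultimately have "((\<lambda>p. power_series (diff_coeffs s coeffs) (\<Phi> p) / lam $ s) has_real_derivative
     deg (\<Phi> q) v s) (at q within I)" by simp
  then show ?thesis
    by (rule has_field_derivative_transform_within[OF _ e(1) q])
       (use near xi_species_eq[OF c] in auto)
qed

lemma deg_along_curve:
  assumes dom: "\<Phi> q \<in> xi_domain lam gam"
    and d: "(\<Phi> has_vector_derivative \<Phi>' q) (at q within I)"
    and d': "(\<Phi>' has_vector_derivative w) (at q within I)"
  shows "((\<lambda>p. deg (\<Phi> p) (\<Phi>' p) s) has_real_derivative
     quad (\<Phi> q) (\<Phi>' q) s + (\<Sum>j\<in>UNIV. lam $ j * kern (\<Phi> q) s j * w $ j)) (at q within I)"
proof -
  obtain R where c: "converges_below coeffs R" and lt: "\<And>s. \<bar>\<Phi> q $ s\<bar> < R $ s"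
    using xi_domainE[OF dom] by blast
  have ne: "lam $ j \<noteq> 0" for j using lam_pos[of j] by simp
  define P where "P j p = power_series (diff_coeffs j (diff_coeffs s coeffs)) (\<Phi> p)" for j p
  define P' where "P' j = (\<Sum>k\<in>UNIV. power_series (diff_coeffs k (diff_coeffs j (diff_coeffs s coeffs))) (\<Phi> q) * \<Phi>' q $ k)" for j
  have dP: "(P j has_real_derivative P' j) (at q within I)" for j
    unfolding P_def P'_def
    by (rule power_series_along_curve[OF converges_below_diff_coeffs[OF converges_below_diff_coeffs[OF c]] lt d])
  have eq: "(\<lambda>p. deg (\<Phi> p) (\<Phi>' p) s) = (\<lambda>p. \<Sum>j\<in>UNIV. P j p * \<Phi>' p $ j / lam $ s)"
    unfolding deg_def degree_vec_def kern_def P_def by (rule ext, intro sum.cong refl) (simp add: ne)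
  have "((\<lambda>p. \<Sum>j\<in>UNIV. P j p * \<Phi>' p $ j / lam $ s) has_real_derivative
     (\<Sum>j\<in>UNIV. (P' j * \<Phi>' q $ j + w $ j * P j q) / lam $ s)) (at q within I)"
    by (intro DERIV_sum DERIV_cdivide DERIV_mult dP has_vector_derivative_component d')
  moreover have "(\<Sum>j\<in>UNIV. (P' j * \<Phi>' q $ j + w $ j * P j q) / lam $ s)
     = quad (\<Phi> q) (\<Phi>' q) s + (\<Sum>j\<in>UNIV. lam $ j * kern (\<Phi> q) s j * w $ j)"
  proof -
    have "P' j * \<Phi>' q $ j / lam $ s = (\<Sum>k\<in>UNIV.
       power_series (diff_coeffs k (diff_coeffs j (diff_coeffs s coeffs))) (\<Phi> q) / lam $ s
         * \<Phi>' q $ j * \<Phi>' q $ k)" for j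
      unfolding P'_def sum_distrib_right sum_divide_distrib
      by (intro sum.cong refl) (simp add: mult_ac)
    moreover have "w $ j * P j q / lam $ s = lam $ j * kern (\<Phi> q) s j * w $ j" for j
      by (simp add: kern_def P_def ne)
    ultimately show ?thesis
      unfolding quad_def sum.distrib[symmetric] add_divide_distrib by (intro sum.cong refl) simp
  qed
  ultimately show ?thesis unfolding eq by simp
qed

end

section \<open>Continuity and Gronwall estimates\<close>

text \<open>
Induction along a real interval.
\<close>

lemma interval_induct:
  fixes a b :: real
  assumes base: "P a"
    and left: "\<And>q. a < q \<Longrightarrow> q \<le> b \<Longrightarrow> (\<And>p. a \<le> p \<Longrightarrow> p < q \<Longrightarrow> P p) \<Longrightarrow> P q"
    and right: "\<And>q. a \<le> q \<Longrightarrow> q < b \<Longrightarrow> (\<And>p. a \<le> p \<Longrightarrow> p \<le> q \<Longrightarrow> P p) \<Longrightarrow>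
        \<exists>e>0. \<forall>p\<in>{a..b}. \<bar>p - q\<bar> < e \<longrightarrow> P p"
    and x: "x \<in> {a..b}"
  shows "P x"
proof (rule ccontr)
  assume nP: "\<not> P x"
  define B where "B = {q\<in>{a..b}. \<not> P q}"
  have xB: "x \<in> B" using nP x by (simp add: B_def)
  have bdd: "bdd_below B" by (rule bdd_belowI[of _ a]) (auto simp: B_def)
  define r where "r = Inf B"
  have ar: "a \<le> r" unfolding r_def using xB by (intro cInf_greatest) (auto simp: B_def)
  have rx: "r \<le> x" unfolding r_def by (rule cInf_lower[OF xB bdd])
  have below: "P p" if "a \<le> p" "p < r" for p
  proof (rule ccontr)
    assume "\<not> P p"
    then have "p \<in> B" using that rx x by (auto simp: B_def)
    then show False using cInf_lower[OF _ bdd, of p] that by (simp add: r_def)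
  qed
  have "P r"
  proof (cases "r = a")
    case False
    then show ?thesis using left[of r] below ar rx x by auto
  qed (use base in simp)
  then have upto: "P p" if "a \<le> p" "p \<le> r" for p using below that by (cases "p = r") auto
  have "r \<noteq> b"
    using upto nP rx x by auto
  then have "r < b" using rx x by auto
  from right[OF ar this upto] obtain e where e: "0 < e" "\<And>p. p \<in> {a..b} \<Longrightarrow> \<bar>p - r\<bar> < e \<Longrightarrow> P p"
    by blast
  obtain p where p: "p \<in> B" "p < r + e"
    using cInf_lessD[of B "r + e"] xB e(1) unfolding r_def by auto
  have "r \<le> p" unfolding r_def by (rule cInf_lower[OF p(1) bdd])
  then show False using e(2)[of p] p by (auto simp: B_def)
qed

lemma continuous_le_from_left:
  fixes f :: "real \<Rightarrow> real"
  assumes "continuous (at q within {a..b}) f" "a < q" "q \<le> b" "\<And>p. a \<le> p \<Longrightarrow> p < q \<Longrightarrow> f p \<le> c"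
  shows "f q \<le> c"
proof (rule ccontr)
  assume "\<not> f q \<le> c"
  then have "\<forall>\<^sub>F p in at q within {a..b}. c < f p"
    using assms(1) unfolding continuous_within by (intro order_tendstoD) auto
  then obtain e where e: "0 < e" "\<And>p. p \<in> {a..b} \<Longrightarrow> p \<noteq> q \<Longrightarrow> dist p q < e \<Longrightarrow> c < f p"
    unfolding eventually_at by blast
  define p where "p = max a (q - e / 2)"
  have "a \<le> p" "p < q" "dist p q < e" using e assms by (auto simp: p_def dist_real_def)
  then show False using e(2)[of p] assms(3) assms(4)[of p] by auto
qed

lemma continuous_less_nearby:
  fixes f :: "'i::finite \<Rightarrow> real \<Rightarrow> real"
  assumes "\<And>i. continuous (at q within S) (f i)" "\<And>i. f i q < c i"
  shows "\<exists>e>0. \<forall>p\<in>S. \<bar>p - q\<bar> < e \<longrightarrow> (\<forall>i. f i p < c i)"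
proof -
  have "\<forall>\<^sub>F p in at q within S. f i p < c i" for i
    using assms unfolding continuous_within by (intro order_tendstoD) auto
  then have "\<forall>\<^sub>F p in at q within S. \<forall>i. f i p < c i" by (intro eventually_all_finite) auto
  then obtain e where e: "0 < e" "\<And>p. p \<in> S \<Longrightarrow> p \<noteq> q \<Longrightarrow> dist p q < e \<Longrightarrow> \<forall>i. f i p < c i"
    unfolding eventually_at by blast
  have "\<forall>i. f i p < c i" if "p \<in> S" "\<bar>p - q\<bar> < e" for p
    using e(2)[of p] that assms(2) by (cases "p = q") (auto simp: dist_real_def)
  then show ?thesis using e(1) by blast
qed

lemma gronwall_norm:
  fixes z z' :: "real \<Rightarrow> 'a::real_inner"
  assumes d: "\<And>q. q \<in> {0..r} \<Longrightarrow> (z has_vector_derivative z' q) (at q within {0..r})"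
    and le: "\<And>q. q \<in> {0..r} \<Longrightarrow> norm (z' q) \<le> K * norm (z q)"
    and q: "q \<in> {0..r}"
  shows "norm (z q) \<le> norm (z 0) * exp (K * q)"
proof -
  define f where "f q = - (exp (- (2 * K * q)) * (z q \<bullet> z q))" for q
  define f' where "f' q = exp (- (2 * K * q)) * (2 * K * (z q \<bullet> z q) - 2 * (z q \<bullet> z' q))" for q
  have df: "(f has_real_derivative f' q) (at q within {0..r})" if "q \<in> {0..r}" for q
  proof -
    have "((\<lambda>q. z q \<bullet> z q) has_real_derivative (z q \<bullet> z' q + z' q \<bullet> z q)) (at q within {0..r})"
      unfolding has_real_derivative_iff_has_vector_derivative
      by (rule bounded_bilinear.has_vector_derivative[OF bounded_bilinear_inner d[OF that] d[OF that]])
    then show ?thesis unfolding f_def f'_def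
      by (auto intro!: derivative_eq_intros simp: inner_commute algebra_simps)
  qed
  have "0 \<le> f' q" if "q \<in> {0..r}" for q
  proof -
    have "z q \<bullet> z' q \<le> norm (z q) * norm (z' q)" by (rule norm_cauchy_schwarz)
    also have "\<dots> \<le> norm (z q) * (K * norm (z q))" by (intro mult_left_mono le that) auto
    also have "\<dots> = K * (z q \<bullet> z q)" by (simp add: dot_square_norm power2_eq_square)
    finally show ?thesis by (simp add: f'_def)
  qed
  from nondecreasing_within[OF df this, of 0 q] have "f 0 \<le> f q" using q by auto
  then have "(norm (z q))\<^sup>2 \<le> (norm (z 0))\<^sup>2 * exp (2 * K * q)"
    by (simp add: f_def dot_square_norm exp_minus field_simps)
  also have "\<dots> = (norm (z 0) * exp (K * q))\<^sup>2"
    by (simp add: power_mult_distrib exp_double[symmetric] mult.assoc)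
  finally show ?thesis by (rule power2_le_imp_le) simp
qed

text \<open>
  This identity links the square-root form of the equation to its division-free form.
\<close>

lemma sqrt_ratio_has_derivative:
  assumes f: "(f has_real_derivative x) (at q within I)" and g: "(g has_real_derivative h) (at q within I)"
    and pos: "0 < f q" "0 < g q"
  shows "((\<lambda>p. sqrt (f p / g p)) has_real_derivative
     f q * (x * g q - f q * h) / (2 * (f q * g q) powr (3/2))) (at q within I)"
proof -
  have p0: "0 < f q / g q" using pos by simp
  have "((\<lambda>p. sqrt (f p / g p)) has_real_derivative
     inverse (sqrt (f q / g q)) / 2 * ((x * g q - f q * h) / (g q * g q))) (at q within I)"
    by (rule DERIV_chain2[OF DERIV_real_sqrt[OF p0] DERIV_divide[OF f g]]) (use pos in simp)
  moreover have "inverse (sqrt (f q / g q)) / 2 * ((x * g q - f q * h) / (g q * g q))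
     = f q * (x * g q - f q * h) / (2 * (f q * g q) powr (3/2))"
  proof -
    define A B where "A = sqrt (f q)" and "B = sqrt (g q)"
    have AB: "0 < A" "0 < B" "f q = A * A" "g q = B * B" using pos by (auto simp: A_def B_def)
    have 1: "sqrt (f q / g q) = A / B" by (simp add: real_sqrt_divide A_def B_def)
    have 2: "(f q * g q) powr (3/2) = (f q * g q) * (A * B)"
      using pos by (subst powr_three_halves) (auto simp: A_def B_def real_sqrt_mult)
    show ?thesis unfolding 1 2 unfolding AB(3,4) using AB(1,2) by (simp add: field_simps)
  qed
  ultimately show ?thesis by simp
qed

section \<open>Reduction of the tree-descending equation\<close>

context tree_model
begin

text \<open>
  Solutions of \<open>\<Phi>'' = accel \<Phi> \<Phi>'\<close> on \<open>[0,t]\<close> that start at the origin with velocity \<open>v\<close> and stay in the domain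
  of \<open>\<xi>\<close> with velocities in the simplex.
\<close>

definition flow :: "real \<Rightarrow> real^'s \<Rightarrow> (real \<Rightarrow> real^'s) \<Rightarrow> (real \<Rightarrow> real^'s) \<Rightarrow> bool"
  where "flow t v \<Phi> \<Phi>' \<longleftrightarrow> \<Phi> 0 = 0 \<and> \<Phi>' 0 = v \<and>
    (\<forall>q\<in>{0..t}. \<Phi> q \<in> xi_domain lam gam \<and> \<Phi>' q \<in> weighted_simplex lam \<and>
       (\<Phi> has_vector_derivative \<Phi>' q) (at q within {0..t}) \<and>
       (\<Phi>' has_vector_derivative accel (\<Phi> q) (\<Phi>' q)) (at q within {0..t}))"

lemma flowD:
  assumes "flow t v \<Phi> \<Phi>'"
  shows "\<Phi> 0 = 0" "\<Phi>' 0 = v"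
    "\<And>q. q \<in> {0..t} \<Longrightarrow> \<Phi> q \<in> xi_domain lam gam"
    "\<And>q. q \<in> {0..t} \<Longrightarrow> \<Phi>' q \<in> weighted_simplex lam"
    "\<And>q. q \<in> {0..t} \<Longrightarrow> (\<Phi> has_vector_derivative \<Phi>' q) (at q within {0..t})"
    "\<And>q. q \<in> {0..t} \<Longrightarrow> (\<Phi>' has_vector_derivative accel (\<Phi> q) (\<Phi>' q)) (at q within {0..t})"
  using assms unfolding flow_def by auto

lemma flow_mono:
  assumes "flow t v \<Phi> \<Phi>'" "0 \<le> p" "p \<le> q" "q \<le> t"
  shows "\<Phi> p $ s \<le> \<Phi> q $ s"
proof (rule nondecreasing_within[OF _ _ assms(2-4)])
  show "((\<lambda>q. \<Phi> q $ s) has_real_derivative \<Phi>' q $ s) (at q within {0..t})" if "q \<in> {0..t}" for q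
    by (rule has_vector_derivative_component[OF flowD(5)[OF assms(1) that]])
  show "0 \<le> \<Phi>' q $ s" if "q \<in> {0..t}" for q by (rule simplexD(1)[OF flowD(4)[OF assms(1) that]])
qed

lemma flow_nonneg:
  assumes "flow t v \<Phi> \<Phi>'" "q \<in> {0..t}"
  shows "0 \<le> \<Phi> q $ s"
  using flow_mono[OF assms(1), of 0 q s] assms(2) flowD(1)[OF assms(1)] by simp

lemma flow_weighted_sum:
  assumes "flow t v \<Phi> \<Phi>'" "q \<in> {0..t}"
  shows "(\<Sum>s\<in>UNIV. lam $ s * \<Phi> q $ s) = q"
proof -
  have "((\<lambda>q. (\<Sum>s\<in>UNIV. lam $ s * \<Phi> q $ s) - q) has_real_derivative 0) (at q within {0..t})"
    if q: "q \<in> {0..t}" for q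
  proof -
    have "((\<lambda>q. (\<Sum>s\<in>UNIV. lam $ s * \<Phi> q $ s) - q) has_real_derivative
        (\<Sum>s\<in>UNIV. lam $ s * \<Phi>' q $ s) - 1) (at q within {0..t})"
      by (intro DERIV_diff DERIV_sum DERIV_cmult has_vector_derivative_component flowD(5)[OF assms(1) q] DERIV_ident)
    then show ?thesis using simplexD(2)[OF flowD(4)[OF assms(1) q]] by simp
  qed
  from constant_within[OF this, of q] assms(2) flowD(1)[OF assms(1)] show ?thesis by simp
qed

lemma flow_le:
  assumes "flow t v \<Phi> \<Phi>'" "q \<in> {0..t}"
  shows "\<Phi> q $ s \<le> q / lam $ s"
proof -
  have "lam $ s * \<Phi> q $ s \<le> (\<Sum>s\<in>UNIV. lam $ s * \<Phi> q $ s)"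
    using flow_nonneg[OF assms] lam_pos by (intro member_le_sum) (auto simp: less_imp_le)
  then show ?thesis unfolding flow_weighted_sum[OF assms] using lam_pos[of s] by (simp add: field_simps)
qed

lemma accel_equation:
  assumes dom: "x \<in> xi_domain lam gam" "\<And>s. 0 \<le> x $ s" and v: "v \<in> weighted_simplex lam"
  shows "accel x v $ s * deg x v s - v $ s * (quad x v s + (\<Sum>j\<in>UNIV. lam $ j * kern x s j * accel x v $ j))
     = psi x v * (v $ s * deg x v s) powr (3/2)"
proof -
  obtain R where c: "converges_below coeffs R" and lt: "\<And>s. \<bar>x $ s\<bar> < R $ s"
    using xi_domainE[OF dom(1)] by blast
  have lt': "x $ s < R $ s" for s using lt[of s] by simp
  show ?thesis using accel(2)[OF c dom(2) lt' v, of s]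
    by (simp add: laplacian_def force_def deg_def algebra_simps)
qed

lemma deg_pos:
  assumes dom: "x \<in> xi_domain lam gam" "\<And>s. 0 \<le> x $ s" and v: "v \<in> weighted_simplex lam"
  shows "0 < deg x v s"
proof -
  obtain R where c: "converges_below coeffs R" and lt: "\<And>s. \<bar>x $ s\<bar> < R $ s"
    using xi_domainE[OF dom(1)] by blast
  have lt': "x $ s < R $ s" for s using lt[of s] by simp
  show ?thesis using deg_ge[OF c dom(2) lt' v, of s] m_pos by simp
qed

lemma flow_imp_solution:
  assumes f: "flow t v \<Phi> \<Phi>'" and t: "0 < t"
  shows "tree_descending_solution lam gam v t \<Phi>"
proof -
  note D = flowD[OF f]
  note nn = flow_nonneg[OF f]
  define G where "G s q = deg (\<Phi> q) (\<Phi>' q) s" for s q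
  define \<Phi>'' where "\<Phi>'' q = accel (\<Phi> q) (\<Phi>' q)" for q
  define G' where "G' s q = quad (\<Phi> q) (\<Phi>' q) s + (\<Sum>j\<in>UNIV. lam $ j * kern (\<Phi> q) s j * \<Phi>'' q $ j)" for s q
  have dG: "(G s has_real_derivative G' s q) (at q within {0..t})" if q: "q \<in> {0..t}" for s q
    unfolding G_def G'_def \<Phi>''_def by (rule deg_along_curve[OF D(3,5,6)[OF q]])
  have eqn: "\<Phi>'' q $ s * G s q - \<Phi>' q $ s * G' s q
      = 2 * (psi (\<Phi> q) (\<Phi>' q) / 2) * (\<Phi>' q $ s * G s q) powr (3/2)" if q: "q \<in> {0..t}" for s q
    using accel_equation[OF D(3)[OF q] nn[OF q] D(4)[OF q], of s] by (simp add: G_def G'_def \<Phi>''_def)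
  have Gpos: "0 < G s q" if "q \<in> {0..t}" for s q
    unfolding G_def by (rule deg_pos[OF D(3)[OF that] nn[OF that] D(4)[OF that]])
  have "tree_descending_at {0..t} \<Phi>' \<Phi>'' G G' q" if q: "q \<in> {0..t}" for q
  proof (cases "\<forall>s. \<Phi>' q $ s \<noteq> 0")
    case True
    then have pos: "0 < \<Phi>' q $ s" for s using simplexD(1)[OF D(4)[OF q], of s] by (simp add: less_le)
    let ?D = "\<lambda>s. \<Phi>' q $ s * (psi (\<Phi> q) (\<Phi>' q) / 2)"
    have "((\<lambda>p. sqrt (\<Phi>' p $ s / G s p)) has_real_derivative ?D s) (at q within {0..t})" for s
    proof -
      have "((\<lambda>p. \<Phi>' p $ s) has_real_derivative \<Phi>'' q $ s) (at q within {0..t})"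
        unfolding \<Phi>''_def by (rule has_vector_derivative_component[OF D(6)[OF q]])
      from sqrt_ratio_has_derivative[OF this dG[OF q, of s] pos Gpos[OF q]]
      show ?thesis unfolding eqn[OF q] using pos[of s] Gpos[OF q, of s] by simp
    qed
    moreover have "1 / \<Phi>' q $ s * ?D s = 1 / \<Phi>' q $ s' * ?D s'" for s s'
      using True by simp
    ultimately show ?thesis unfolding tree_descending_at_def using True by (auto intro!: exI[of _ ?D])
  next
    case False
    show ?thesis unfolding tree_descending_at_def if_not_P[OF False] using eqn[OF q] by blast
  qed
  moreover have "((\<lambda>p. xi_species lam gam s (\<Phi> p)) has_real_derivative G s q) (at q within {0..t})"
    if q: "q \<in> {0..t}" for s q
    unfolding G_def by (rule xi_species_along_curve[OF D(3)[OF q] q D(5)[OF q]])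
  moreover have "0 \<le> \<Phi>' q $ s * G s q" if q: "q \<in> {0..t}" for s q
    using simplexD(1)[OF D(4)[OF q], of s] Gpos[OF q, of s] by simp
  moreover have "(\<Phi>' has_vector_derivative \<Phi>'' q) (at q within {0..t})" if "q \<in> {0..t}" for q
    unfolding \<Phi>''_def by (rule D(6)[OF that])
  moreover have "lam \<bullet> \<Phi> q = q" if "q \<in> {0..t}" for q
    using flow_weighted_sum[OF f that] by (simp add: inner_vec_def)
  ultimately show ?thesis
    unfolding tree_descending_solution_def using D dG
    by (intro conjI ballI exI[of _ \<Phi>'] exI[of _ \<Phi>''] exI[of _ G] exI[of _ G'] allI) auto
qed

lemma solution_imp_flow:
  assumes sol: "tree_descending_solution lam gam v t \<Phi>" and t: "0 < t" and v: "v \<in> weighted_simplex lam"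
  shows "\<exists>\<Phi>'. flow t v \<Phi> \<Phi>'"
proof -
  from sol obtain \<Phi>' \<Phi>'' G G' where
    \<Phi>0: "\<Phi> 0 = 0" and dom: "\<And>q. q \<in> {0..t} \<Longrightarrow> \<Phi> q \<in> xi_domain lam gam"
    and lam\<Phi>: "\<And>q. q \<in> {0..t} \<Longrightarrow> lam \<bullet> \<Phi> q = q"
    and v0: "\<Phi>' 0 = v"
    and d1: "\<And>q. q \<in> {0..t} \<Longrightarrow> (\<Phi> has_vector_derivative \<Phi>' q) (at q within {0..t})"
    and d2: "\<And>q. q \<in> {0..t} \<Longrightarrow> (\<Phi>' has_vector_derivative \<Phi>'' q) (at q within {0..t})"
    and dxi: "\<And>q s. q \<in> {0..t} \<Longrightarrow> ((\<lambda>p. xi_species lam gam s (\<Phi> p)) has_real_derivative G s q) (at q within {0..t})"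
    and dG: "\<And>q s. q \<in> {0..t} \<Longrightarrow> (G s has_real_derivative G' s q) (at q within {0..t})"
    and sgn: "\<And>q s. q \<in> {0..t} \<Longrightarrow> 0 \<le> \<Phi>' q $ s * G s q"
    and ode: "\<And>q. q \<in> {0..t} \<Longrightarrow> tree_descending_at {0..t} \<Phi>' \<Phi>'' G G' q"
    unfolding tree_descending_solution_def by blast
  have G: "G s q = deg (\<Phi> q) (\<Phi>' q) s" if q: "q \<in> {0..t}" for s q
    by (rule real_derivative_unique_within[OF t q dxi[OF q] xi_species_along_curve[OF dom[OF q] q d1[OF q]]])
  have dc: "((\<lambda>q. \<Phi> q $ s) has_real_derivative \<Phi>' q $ s) (at q within {0..t})" if "q \<in> {0..t}" for q s
    by (rule has_vector_derivative_component[OF d1[OF that]])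
  have dc': "((\<lambda>q. \<Phi>' q $ s) has_real_derivative \<Phi>'' q $ s) (at q within {0..t})" if "q \<in> {0..t}" for q s
    by (rule has_vector_derivative_component[OF d2[OF that]])
  have sum1: "(\<Sum>s\<in>UNIV. lam $ s * \<Phi>' q $ s) = 1" if q: "q \<in> {0..t}" for q
  proof (rule real_derivative_unique_within[OF t q])
    show "((\<lambda>q. \<Sum>s\<in>UNIV. lam $ s * \<Phi> q $ s) has_real_derivative (\<Sum>s\<in>UNIV. lam $ s * \<Phi>' q $ s)) (at q within {0..t})"
      by (intro DERIV_sum DERIV_cmult dc q)
    show "((\<lambda>q. \<Sum>s\<in>UNIV. lam $ s * \<Phi> q $ s) has_real_derivative 1) (at q within {0..t})"
      by (rule has_field_derivative_transform_within[OF DERIV_ident zero_less_one q])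
         (use lam\<Phi> in \<open>simp add: inner_vec_def\<close>)
  qed
  have sum2: "(\<Sum>s\<in>UNIV. lam $ s * \<Phi>'' q $ s) = 0" if q: "q \<in> {0..t}" for q
  proof (rule real_derivative_unique_within[OF t q])
    show "((\<lambda>q. \<Sum>s\<in>UNIV. lam $ s * \<Phi>' q $ s) has_real_derivative (\<Sum>s\<in>UNIV. lam $ s * \<Phi>'' q $ s)) (at q within {0..t})"
      by (intro DERIV_sum DERIV_cmult dc' q)
    show "((\<lambda>q. \<Sum>s\<in>UNIV. lam $ s * \<Phi>' q $ s) has_real_derivative 0) (at q within {0..t})"
      by (rule has_field_derivative_transform_within[OF DERIV_const zero_less_one q])
         (use sum1 in simp)
  qed
  have mono: "0 \<le> \<Phi> q $ s" if "q \<in> {0..t}" "\<And>p. 0 \<le> p \<Longrightarrow> p \<le> q \<Longrightarrow> 0 \<le> \<Phi>' p $ s" for q s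
  proof -
    have "\<Phi> 0 $ s \<le> \<Phi> q $ s"
    proof (rule nondecreasing_within[where f = "\<lambda>q. \<Phi> q $ s" and f' = "\<lambda>q. \<Phi>' q $ s" and a = 0 and b = q])
      fix p assume p: "p \<in> {0..q}"
      have "((\<lambda>q. \<Phi> q $ s) has_real_derivative \<Phi>' p $ s) (at p within {0..t})" using dc p that(1) by auto
      then show "((\<lambda>q. \<Phi> q $ s) has_real_derivative \<Phi>' p $ s) (at p within {0..q})"
        by (rule DERIV_subset) (use that(1) in auto)
      show "0 \<le> \<Phi>' p $ s" using p that(2) by auto
    qed (use that(1) in auto)
    then show ?thesis using \<Phi>0 by simp
  qed
  \<comment> \<open>As long as the velocities are nonnegative all \<open>G s\<close> are positive, and then the sign
     condition \<open>0 \<le> \<Phi>' * G\<close> carries nonnegativity a little further.\<close>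
  have pos: "\<forall>s. 0 \<le> \<Phi>' q $ s" if "q \<in> {0..t}" for q
  proof (rule interval_induct[where P = "\<lambda>q. \<forall>s. 0 \<le> \<Phi>' q $ s" and a = 0 and b = t])
    show "\<forall>s. 0 \<le> \<Phi>' 0 $ s" using v simplexD(1) v0 by simp
    show "q \<in> {0..t}" by fact
  next
    fix q assume q: "0 < q" "q \<le> t" and IH: "\<And>p. 0 \<le> p \<Longrightarrow> p < q \<Longrightarrow> \<forall>s. 0 \<le> \<Phi>' p $ s"
    show "\<forall>s. 0 \<le> \<Phi>' q $ s"
    proof
      fix s
      have "continuous (at q within {0..t}) (\<lambda>p. - \<Phi>' p $ s)"
        using dc'[of q s] q by (intro continuous_minus DERIV_continuous) auto
      from continuous_le_from_left[OF this q, of 0] show "0 \<le> \<Phi>' q $ s" using IH by auto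
    qed
  next
    fix q assume q: "0 \<le> q" "q < t" and IH: "\<And>p. 0 \<le> p \<Longrightarrow> p \<le> q \<Longrightarrow> \<forall>s. 0 \<le> \<Phi>' p $ s"
    have qt: "q \<in> {0..t}" using q by auto
    have "0 < G s q" for s
      unfolding G[OF qt]
    proof (rule deg_pos[OF dom[OF qt]])
      show "0 \<le> \<Phi> q $ s" for s using mono[OF qt] IH by blast
      show "\<Phi>' q \<in> weighted_simplex lam" using IH[of q] q sum1[OF qt] by (auto simp: weighted_simplex_iff)
    qed
    moreover have "continuous (at q within {0..t}) (\<lambda>p. - G s p)" for s
      using dG[OF qt, of s] by (intro continuous_minus DERIV_continuous)
    ultimately obtain e where e: "0 < e" "\<And>p. p \<in> {0..t} \<Longrightarrow> \<bar>p - q\<bar> < e \<Longrightarrow> (\<forall>s. - G s p < 0)"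
      using continuous_less_nearby[of q "{0..t}" "\<lambda>s p. - G s p" "\<lambda>_. 0"] by auto
    have "\<forall>s. 0 \<le> \<Phi>' p $ s" if "p \<in> {0..t}" "\<bar>p - q\<bar> < e" for p
    proof
      fix s
      have "0 < G s p" using e(2)[OF that] by simp
      then show "0 \<le> \<Phi>' p $ s" using sgn[OF that(1), of s] by (simp add: zero_le_mult_iff)
    qed
    then show "\<exists>e>0. \<forall>p\<in>{0..t}. \<bar>p - q\<bar> < e \<longrightarrow> (\<forall>s. 0 \<le> \<Phi>' p $ s)" using e(1) by blast
  qed
  have vsimplex: "\<Phi>' q \<in> weighted_simplex lam" if "q \<in> {0..t}" for q
    using pos[OF that] sum1[OF that] by (simp add: weighted_simplex_iff)
  have nn: "0 \<le> \<Phi> q $ s" if "q \<in> {0..t}" for q s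
    by (rule mono[OF that]) (use pos that in auto)
  have Gpos: "0 < G s q" if q: "q \<in> {0..t}" for s q
    unfolding G[OF q] by (rule deg_pos[OF dom[OF q] nn[OF q] vsimplex[OF q]])
  have G': "G' s q = quad (\<Phi> q) (\<Phi>' q) s + (\<Sum>j\<in>UNIV. lam $ j * kern (\<Phi> q) s j * \<Phi>'' q $ j)"
    if q: "q \<in> {0..t}" for s q
  proof (rule real_derivative_unique_within[OF t q dG[OF q]])
    show "(G s has_real_derivative quad (\<Phi> q) (\<Phi>' q) s + (\<Sum>j\<in>UNIV. lam $ j * kern (\<Phi> q) s j * \<Phi>'' q $ j))
      (at q within {0..t})"
      by (rule has_field_derivative_transform_within[OF deg_along_curve[OF dom[OF q] d1[OF q] d2[OF q]] zero_less_one q])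
         (use G in simp)
  qed
  have "\<Phi>'' q = accel (\<Phi> q) (\<Phi>' q)" if q: "q \<in> {0..t}" for q
  proof -
    obtain R where c: "converges_below coeffs R" and lt: "\<And>s. \<bar>\<Phi> q $ s\<bar> < R $ s"
      using xi_domainE[OF dom[OF q]] by blast
    have lt': "\<Phi> q $ s < R $ s" for s using lt[of s] by simp
    obtain \<Psi> where \<Psi>: "\<And>s. \<Phi>'' q $ s * G s q - \<Phi>' q $ s * G' s q = 2 * \<Psi> * (\<Phi>' q $ s * G s q) powr (3/2)"
    proof (cases "\<forall>s. \<Phi>' q $ s \<noteq> 0")
      case True
      then have vpos: "0 < \<Phi>' q $ s" for s using pos[OF q] by (simp add: less_le)
      obtain D where D: "\<And>s. ((\<lambda>p. sqrt (\<Phi>' p $ s / G s p)) has_real_derivative D s) (at q within {0..t})"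
        "\<And>s s'. 1 / \<Phi>' q $ s * D s = 1 / \<Phi>' q $ s' * D s'"
        using ode[OF q] True unfolding tree_descending_at_def by auto
      have "D s = \<Phi>' q $ s * (\<Phi>'' q $ s * G s q - \<Phi>' q $ s * G' s q) / (2 * (\<Phi>' q $ s * G s q) powr (3/2))" for s
        by (rule real_derivative_unique_within[OF t q D(1)
              sqrt_ratio_has_derivative[OF dc'[OF q] dG[OF q] vpos Gpos[OF q]]])
      then have "1 / \<Phi>' q $ s * D s
         = (\<Phi>'' q $ s * G s q - \<Phi>' q $ s * G' s q) / (2 * (\<Phi>' q $ s * G s q) powr (3/2))" for s
        using vpos[of s] by simp
      then have "\<Phi>'' q $ s * G s q - \<Phi>' q $ s * G' s q
         = 2 * (1 / \<Phi>' q $ s * D s) * (\<Phi>' q $ s * G s q) powr (3/2)" for s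
        using vpos[of s] Gpos[OF q, of s] by simp
      then have "\<Phi>'' q $ s * G s q - \<Phi>' q $ s * G' s q
         = 2 * (1 / \<Phi>' q $ undefined * D undefined) * (\<Phi>' q $ s * G s q) powr (3/2)" for s
        using D(2)[of s undefined] by metis
      then show ?thesis using that by blast
    next
      case False
      show ?thesis using ode[OF q] that unfolding tree_descending_at_def if_not_P[OF False] by blast
    qed
    have lap: "laplacian lam (kern (\<Phi> q)) (\<Phi>' q) (\<Phi>'' q) s
        = \<Phi>' q $ s * quad (\<Phi> q) (\<Phi>' q) s + 2 * \<Psi> * (\<Phi>' q $ s * deg (\<Phi> q) (\<Phi>' q) s) powr (3/2)" for s
      using \<Psi>[of s] unfolding G[OF q] G'[OF q] laplacian_def deg_def[symmetric]
      by (simp add: algebra_simps)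
    define N where "N = (\<Sum>s\<in>UNIV. lam $ s * (\<Phi>' q $ s * quad (\<Phi> q) (\<Phi>' q) s))"
    define E where "E = (\<Sum>s\<in>UNIV. lam $ s * (\<Phi>' q $ s * deg (\<Phi> q) (\<Phi>' q) s) powr (3/2))"
    have "0 < Min (range (($) lam)) * curvature_min powr (3/2)" using Min_lam_pos m_pos by simp
    then have E: "0 < E" unfolding E_def by (rule less_le_trans[OF _ cubic_sum_ge[OF c nn[OF q] lt' vsimplex[OF q]]])
    \<comment> \<open>Summing the equations against \<open>lam\<close> identifies the common value \<open>\<Psi>\<close>.\<close>
    have "0 = (\<Sum>s\<in>UNIV. lam $ s * laplacian lam (kern (\<Phi> q)) (\<Phi>' q) (\<Phi>'' q) s)"
      by (rule sum_laplacian[symmetric]) (rule kern_sym[OF coeffs_symmetric])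
    also have "\<dots> = N + 2 * \<Psi> * E"
      unfolding lap N_def E_def sum_distrib_left sum.distrib[symmetric]
      by (intro sum.cong refl) (simp add: algebra_simps)
    finally have "2 * \<Psi> = psi (\<Phi> q) (\<Phi>' q)"
      unfolding psi_def N_def[symmetric] E_def[symmetric] using E by (simp add: field_simps)
    then have "laplacian lam (kern (\<Phi> q)) (\<Phi>' q) (\<Phi>'' q) s = force (\<Phi> q) (\<Phi>' q) s" for s
      unfolding lap force_def by simp
    then show ?thesis by (rule accel(3)[OF c nn[OF q] lt' vsimplex[OF q] sum2[OF q]])
  qed
  then show ?thesis
    using \<Phi>0 v0 dom vsimplex d1 d2 unfolding flow_def by (intro exI[of _ \<Phi>']) auto
qed

end

section \<open>Fixed points and mean values\<close>

lemma picard_lipschitz: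
  fixes f :: "'a::euclidean_space \<Rightarrow> 'a"
  assumes lip: "\<And>x y. norm (f x - f y) \<le> L * norm (x - y)" and \<tau>: "0 < \<tau>" "L * \<tau> < 1"
  obtains z where "z 0 = z0" "\<And>q. q \<in> {0..\<tau>} \<Longrightarrow> (z has_vector_derivative f (z q)) (at q within {0..\<tau>})"
proof -
  define L' where "L' = max L 0"
  have L': "0 \<le> L'" "norm (f x - f y) \<le> L' * norm (x - y)" for x y
  proof -
    show "0 \<le> L'" by (simp add: L'_def)
    have "L * norm (x - y) \<le> L' * norm (x - y)" by (intro mult_right_mono) (auto simp: L'_def)
    then show "norm (f x - f y) \<le> L' * norm (x - y)" using lip[of x y] by linarith
  qed
  have L'\<tau>: "0 \<le> L' * \<tau>" "L' * \<tau> < 1" using \<tau> by (auto simp: L'_def max_def)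
  have "continuous_on UNIV f"
    by (rule lipschitz_on_continuous_on[of L']) (use L' in \<open>auto intro!: lipschitz_onI simp: dist_norm\<close>)
  then have cf: "continuous_on S (\<lambda>p. f (apply_bcontfun g p))" for S and g :: "real \<Rightarrow>\<^sub>C 'a"
    by (rule continuous_on_compose2) auto
  define clip where "clip q = max 0 (min \<tau> q)" for q
  have clip: "clip q \<in> {0..\<tau>}" for q using \<tau> by (auto simp: clip_def)
  have clip_id: "clip q = q" if "q \<in> {0..\<tau>}" for q using that by (auto simp: clip_def)
  have cclip: "continuous_on UNIV clip" unfolding clip_def by (intro continuous_intros)
  \<comment> \<open>The integral operator acts on bounded continuous functions on the whole line; beyond \<open>[0,\<tau>]\<close> they
     are continued as constants.\<close>
  define H where "H g q = z0 + integral {0..clip q} (\<lambda>p. f (apply_bcontfun g p))" for g q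
  have H: "H g \<in> bcontfun" for g
  proof -
    have c: "continuous_on {0..\<tau>} (\<lambda>q. z0 + integral {0..q} (\<lambda>p. f (apply_bcontfun g p)))"
      by (intro continuous_intros indefinite_integral_continuous_1 integrable_continuous_real cf)
    have "continuous_on UNIV (H g)" unfolding H_def
      by (rule continuous_on_compose2[OF c cclip]) (use clip in auto)
    moreover have "bounded (range (H g))"
    proof (rule bounded_subset)
      show "bounded ((\<lambda>q. z0 + integral {0..q} (\<lambda>p. f (apply_bcontfun g p))) ` {0..\<tau>})"
        by (rule compact_imp_bounded[OF compact_continuous_image[OF c]]) simp
      show "range (H g) \<subseteq> (\<lambda>q. z0 + integral {0..q} (\<lambda>p. f (apply_bcontfun g p))) ` {0..\<tau>}"
        using clip by (auto simp: H_def)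
    qed
    ultimately show ?thesis by (simp add: bcontfun_def)
  qed
  define T where "T g = Bcontfun (H g)" for g
  have T: "apply_bcontfun (T g) = H g" for g by (simp add: T_def Bcontfun_inverse[OF H])
  have contr: "dist (T g) (T h) \<le> (L' * \<tau>) * dist g h" for g h
  proof (rule dist_bound)
    fix q
    have "dist (apply_bcontfun (T g) q) (apply_bcontfun (T h) q)
       = norm (integral {0..clip q} (\<lambda>p. f (apply_bcontfun g p)) - integral {0..clip q} (\<lambda>p. f (apply_bcontfun h p)))"
      by (simp add: T H_def dist_norm)
    also have "\<dots> = norm (integral {0..clip q} (\<lambda>p. f (apply_bcontfun g p) - f (apply_bcontfun h p)))"
      by (subst integral_diff) (auto intro!: integrable_continuous_real cf)
    also have "\<dots> \<le> (L' * dist g h) * (clip q - 0)"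
    proof (rule integral_bound)
      show "0 \<le> clip q" using clip[of q] by simp
      show "continuous_on {0..clip q} (\<lambda>p. f (apply_bcontfun g p) - f (apply_bcontfun h p))"
        by (intro continuous_on_diff cf)
      fix p
      have "L' * norm (apply_bcontfun g p - apply_bcontfun h p) \<le> L' * dist g h"
        using dist_bounded[of g p h] L'(1) by (intro mult_left_mono) (auto simp: dist_norm)
      then show "norm (f (apply_bcontfun g p) - f (apply_bcontfun h p)) \<le> L' * dist g h"
        using L'(2) order_trans by blast
    qed
    also have "\<dots> \<le> (L' * dist g h) * \<tau>"
      using clip[of q] L'(1) by (intro mult_left_mono) auto
    finally show "dist (apply_bcontfun (T g) q) (apply_bcontfun (T h) q) \<le> (L' * \<tau>) * dist g h"
      by (simp add: mult_ac)
  qed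
  have "\<exists>!g. T g = g" by (rule banach_fix_type[OF L'\<tau>]) (use contr in blast)
  then obtain g where g: "T g = g" by blast
  have zq: "apply_bcontfun g q = z0 + integral {0..q} (\<lambda>p. f (apply_bcontfun g p))" if "q \<in> {0..\<tau>}" for q
  proof -
    have "apply_bcontfun g = H g" using T[of g] unfolding g .
    from fun_cong[OF this, of q] show ?thesis unfolding H_def clip_id[OF that] .
  qed
  show ?thesis
  proof (rule that[of "apply_bcontfun g"])
    show "apply_bcontfun g 0 = z0" using zq[of 0] \<tau> by simp
    fix q assume q: "q \<in> {0..\<tau>}"
    have "((\<lambda>q. z0 + integral {0..q} (\<lambda>p. f (apply_bcontfun g p))) has_vector_derivative
       0 + f (apply_bcontfun g q)) (at q within {0..\<tau>})"
      by (intro has_vector_derivative_add has_vector_derivative_const integral_has_vector_derivative cf q)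
    then have "((\<lambda>q. z0 + integral {0..q} (\<lambda>p. f (apply_bcontfun g p))) has_vector_derivative
       f (apply_bcontfun g q)) (at q within {0..\<tau>})" by simp
    then show "(apply_bcontfun g has_vector_derivative f (apply_bcontfun g q)) (at q within {0..\<tau>})"
      by (rule has_vector_derivative_transform_within[OF _ zero_less_one q]) (rule zq[symmetric])
  qed
qed

lemma vector_mean_value:
  fixes f :: "real \<Rightarrow> 'a::real_normed_vector"
  assumes d: "\<And>q. q \<in> {0..t} \<Longrightarrow> (f has_vector_derivative f' q) (at q within {0..t})"
    and le: "\<And>q. q \<in> {0..t} \<Longrightarrow> norm (f' q) \<le> M" and q: "q \<in> {0..t}"
  shows "norm (f q - f 0) \<le> M * q"
proof -
  have "norm (f q - f 0) \<le> M * norm (q - 0)"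
  proof (rule differentiable_bound[where S = "{0..t}"])
    show "(f has_derivative (\<lambda>h. h *\<^sub>R f' x)) (at x within {0..t})" if "x \<in> {0..t}" for x
      using d[OF that] by (simp add: has_vector_derivative_def)
    show "onorm (\<lambda>h. h *\<^sub>R f' x) \<le> M" if "x \<in> {0..t}" for x
      by (rule onorm_le) (use mult_left_mono[OF le[OF that] abs_ge_zero] in \<open>simp add: mult.commute\<close>)
  qed (use q in auto)
  then show ?thesis using q by simp
qed

text \<open>
A function that does not move while it is negative cannot become negative.
\<close>

lemma nonneg_if_stationary_below:
  fixes y y' :: "real \<Rightarrow> real"
  assumes d: "\<And>q. q \<in> {0..t} \<Longrightarrow> (y has_real_derivative y' q) (at q within {0..t})"
    and y0: "0 \<le> y 0" and stat: "\<And>q. q \<in> {0..t} \<Longrightarrow> y q < 0 \<Longrightarrow> y' q = 0"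
    and q: "q \<in> {0..t}"
  shows "0 \<le> y q"
proof (rule ccontr)
  assume neg: "\<not> 0 \<le> y q"
  have cont: "continuous_on {0..t} y"
    unfolding continuous_on_eq_continuous_within using d DERIV_continuous by blast
  have cq: "continuous_on {0..q} y" by (rule continuous_on_subset[OF cont]) (use q in auto)
  define A where "A = {0..q} \<inter> y -` {0..}"
  have "closed A" unfolding A_def by (intro continuous_closed_preimage cq) auto
  moreover have "bounded A" by (rule bounded_subset[of "{0..q}"]) (auto simp: A_def)
  ultimately have "compact A" by (simp add: compact_eq_bounded_closed)
  moreover have "A \<noteq> {}" using y0 q by (auto simp: A_def)
  ultimately obtain r where r: "r \<in> A" "\<And>p. p \<in> A \<Longrightarrow> p \<le> r"
    using compact_attains_sup[of A] by blast
  have rq: "0 \<le> r" "r < q" "0 \<le> y r" using r(1) neg by (auto simp: A_def less_le)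
  have "y q = y r"
  proof (rule DERIV_isconst_end[OF rq(2)])
    show "continuous_on {r..q} y" by (rule continuous_on_subset[OF cq]) (use rq in auto)
    fix p assume p: "r < p" "p < q"
    have "y p < 0"
    proof (rule ccontr)
      assume "\<not> y p < 0"
      then have "p \<in> A" using p rq by (auto simp: A_def)
      then show False using r(2)[of p] p by simp
    qed
    moreover have "p \<in> {0..t}" "at p within {0..t} = at p" using p rq q by (auto intro!: at_within_Icc_at)
    ultimately show "DERIV y p :> 0" using d[of p] stat[of p] by simp
  qed
  then show False using rq neg by simp
qed

section \<open>The weighted simplex\<close>

context
  fixes lam :: "real^'s::finite"
  assumes lam_pos: "\<And>s. 0 < lam $ s"
begin

lemma convex_weighted_simplex: "convex (weighted_simplex lam)"
  unfolding weighted_simplex_def convex_def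
  by (auto simp: inner_add_right)

lemma compact_weighted_simplex: "compact (weighted_simplex lam)"
proof -
  have "weighted_simplex lam = (\<Inter>s. {v. 0 \<le> v $ s}) \<inter> {v. lam \<bullet> v = 1}"
    by (auto simp: weighted_simplex_def)
  moreover have "closed ((\<Inter>s. {v::real^'s. 0 \<le> v $ s}) \<inter> {v. lam \<bullet> v = 1})"
    by (intro closed_Int closed_INT ballI closed_Collect_le closed_Collect_eq continuous_intros)
  ultimately have "closed (weighted_simplex lam)" by simp
  moreover have "weighted_simplex lam \<subseteq> cbox 0 (\<chi> s. 1 / lam $ s)"
  proof
    fix v assume v: "v \<in> weighted_simplex lam"
    have "lam $ s * v $ s \<le> (\<Sum>s\<in>UNIV. lam $ s * v $ s)" for s
      using v lam_pos by (intro member_le_sum) (auto simp: weighted_simplex_iff less_imp_le)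
    then show "v \<in> cbox 0 (\<chi> s. 1 / lam $ s)"
      using v lam_pos by (auto simp: mem_box_cart weighted_simplex_iff pos_le_divide_eq mult.commute)
  qed
  ultimately show ?thesis
    using bounded_cbox bounded_subset compact_eq_bounded_closed by metis
qed

lemma weighted_simplex_eqI:
  assumes "x \<in> weighted_simplex lam" "y \<in> weighted_simplex lam" "\<And>s. x $ s \<le> y $ s"
  shows "x = y"
proof -
  have nn: "0 \<le> lam $ s * (y $ s - x $ s)" for s using lam_pos[of s] assms(3)[of s] by simp
  have "(\<Sum>s\<in>UNIV. lam $ s * (y $ s - x $ s)) = 0"
    using assms(1,2) by (simp add: weighted_simplex_iff right_diff_distrib sum_subtractf)
  then have "lam $ s * (y $ s - x $ s) = 0" for s 
    using sum_nonneg_eq_0_iff[of UNIV "\<lambda>s. lam $ s * (y $ s - x $ s)"] nn by auto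
  then have "x $ s = y $ s" for s using lam_pos[of s] by (metis eq_iff_diff_eq_0 less_irrefl mult_eq_0_iff)
  then show ?thesis by (simp add: vec_eq_iff)
qed

text \<open>
  Projecting from the hyperplane of the simplex sends a negative coordinate to \<open>0\<close>.
\<close>

lemma closest_point_simplex_zero:
  assumes v: "(\<Sum>s\<in>UNIV. lam $ s * v $ s) = 1" and neg: "v $ s < 0"
    and ne: "weighted_simplex lam \<noteq> {}"
  shows "closest_point (weighted_simplex lam) v $ s = 0"
proof (rule ccontr)
  let ?S = "weighted_simplex lam"
  define y where "y = closest_point ?S v"
  have cl: "closed ?S" by (rule compact_imp_closed[OF compact_weighted_simplex])
  have y: "y \<in> ?S" unfolding y_def by (rule closest_point_in_set[OF cl ne])
  assume "closest_point ?S v $ s \<noteq> 0"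
  then have ys: "0 < y $ s" using y by (auto simp: y_def[symmetric] weighted_simplex_iff less_le)
  have "\<exists>i. y $ i < v $ i"
  proof (rule ccontr)
    assume "\<not> (\<exists>i. y $ i < v $ i)"
    then have "(\<Sum>i\<in>UNIV. lam $ i * v $ i) < (\<Sum>i\<in>UNIV. lam $ i * y $ i)"
      using lam_pos ys neg by (intro sum_strict_mono_ex1) (auto simp: not_less less_imp_le intro!: exI[of _ s])
    then show False using v y by (simp add: weighted_simplex_iff)
  qed
  then obtain i where i: "y $ i < v $ i" by blast
  then have i_ne_s: "i \<noteq> s" using ys neg by auto
  \<comment> \<open>Moving the mass of species \<open>s\<close> to species \<open>i\<close> brings \<open>y\<close> closer to \<open>v\<close>.\<close>
  define \<eta> where "\<eta> = lam $ s * y $ s"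
  have \<eta>: "0 < \<eta>" using ys lam_pos by (simp add: \<eta>_def)
  define z where "z = y + (axis i (\<eta> / lam $ i) - axis s (\<eta> / lam $ s))"
  have ne': "lam $ j \<noteq> 0" for j using lam_pos[of j] by simp
  have "z \<in> ?S"
    unfolding weighted_simplex_def
  proof (intro CollectI conjI allI)
    show "lam \<bullet> z = 1" using y ne' by (simp add: z_def weighted_simplex_def inner_add_right inner_diff_right inner_axis)
    show "0 \<le> z $ j" for j
      using y ne' i_ne_s \<eta> lam_pos[of i] by (cases "j = i"; cases "j = s")
        (auto simp: z_def axis_def weighted_simplex_iff \<eta>_def)
  qed
  then have "(v - y) \<bullet> (z - y) \<le> 0"
    unfolding y_def by (rule closest_point_dot[OF convex_weighted_simplex cl])
  moreover have "(v - y) \<bullet> (z - y) = (v $ i - y $ i) * (\<eta> / lam $ i) - (v $ s - y $ s) * (\<eta> / lam $ s)"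
    by (simp add: z_def inner_diff_right inner_axis)
  moreover have "0 < (v $ i - y $ i) * (\<eta> / lam $ i)" using i \<eta> lam_pos by simp
  moreover have "0 < - ((v $ s - y $ s) * (\<eta> / lam $ s))"
    using ys neg \<eta> lam_pos[of s] by (simp add: mult_neg_pos divide_neg_pos)
  ultimately show False by linarith
qed

text \<open>
  For a target \<open>y\<close>, a Brouwer fixed point \<open>v\<close> of the normalised map \<open>v \<mapsto> v + (y - F v)\<^sup>+\<close> satisfies
  \<open>c v = (y - F v)\<^sup>+\<close> with \<open>c \<ge> 0\<close>. If \<open>c = 0\<close> then \<open>y \<le> F v\<close>. If \<open>c > 0\<close> then \<open>F v \<le> y\<close>, on the support of
  \<open>v\<close> by the equation and off it since \<open>F\<close> preserves the faces. As both points lie in the simplex they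
  coincide in either case.
\<close>

lemma face_preserving_surjective:
  fixes F :: "real^'s \<Rightarrow> real^'s"
  assumes cont: "continuous_on (weighted_simplex lam) F"
    and F: "F \<in> weighted_simplex lam \<rightarrow> weighted_simplex lam"
    and face: "\<And>v s. v \<in> weighted_simplex lam \<Longrightarrow> v $ s = 0 \<Longrightarrow> F v $ s = 0"
  shows "F ` weighted_simplex lam = weighted_simplex lam"
proof
  show "F ` weighted_simplex lam \<subseteq> weighted_simplex lam" using F by blast
  show "weighted_simplex lam \<subseteq> F ` weighted_simplex lam"
  proof
    fix y assume y: "y \<in> weighted_simplex lam"
    define P where "P v = (\<chi> s. max 0 (y $ s - F v $ s))" for v
    define T where "T v = (1 / (1 + lam \<bullet> P v)) *\<^sub>R (v + P v)" for v
    have Pnn: "0 \<le> P v $ s" for v s by (simp add: P_def)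
    have S: "0 \<le> lam \<bullet> P v" for v
      unfolding inner_vec_def using Pnn lam_pos by (intro sum_nonneg) (auto simp: less_imp_le)
    have S': "1 + lam \<bullet> P v \<noteq> 0" for v using S[of v] by linarith
    have cP: "continuous_on (weighted_simplex lam) P"
      unfolding P_def by (intro continuous_intros cont)
    have "continuous_on (weighted_simplex lam) T"
      unfolding T_def by (intro continuous_intros cP) (use S' in auto)
    moreover have "T \<in> weighted_simplex lam \<rightarrow> weighted_simplex lam"
    proof
      fix v assume v: "v \<in> weighted_simplex lam"
      have "lam \<bullet> T v = 1" using v S'[of v] by (simp add: T_def inner_add_right weighted_simplex_def)
      moreover have "0 \<le> T v $ s" for s
        using v Pnn[of v s] S[of v] by (simp add: T_def weighted_simplex_def)
      ultimately show "T v \<in> weighted_simplex lam" by (simp add: weighted_simplex_def)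
    qed
    moreover have "weighted_simplex lam \<noteq> {}" using y by blast
    ultimately obtain v where v: "v \<in> weighted_simplex lam" "T v = v"
      using brouwer[OF compact_weighted_simplex convex_weighted_simplex] by metis
    have "(1 + lam \<bullet> P v) *\<^sub>R v = v + P v"
      using arg_cong[OF v(2), of "\<lambda>x. (1 + lam \<bullet> P v) *\<^sub>R x"] S'[of v] by (simp add: T_def)
    then have fixpt: "(lam \<bullet> P v) * v $ s = P v $ s" for s
      by (simp add: vec_eq_iff distrib_right)
    have Fv: "F v \<in> weighted_simplex lam" using F v by blast
    have "F v = y"
    proof (cases "lam \<bullet> P v = 0")
      case True
      then have "y $ s \<le> F v $ s" for s using fixpt[of s] by (simp add: P_def max_def split: if_splits)
      then show ?thesis using weighted_simplex_eqI[OF y Fv] by simp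
    next
      case False
      have "F v $ s \<le> y $ s" for s
      proof (cases "v $ s = 0")
        case True
        then show ?thesis using face[OF v(1) True] y by (simp add: weighted_simplex_def)
      next
        case vs: False
        then have "0 \<noteq> P v $ s" using fixpt[of s] False by (metis mult_eq_0_iff)
        then show ?thesis by (simp add: P_def max_def split: if_splits)
      qed
      then show ?thesis by (rule weighted_simplex_eqI[OF Fv y])
    qed
    then show "y \<in> F ` weighted_simplex lam" using v(1) by blast
  qed
qed

end

section \<open>Dependence on the initial velocity\<close>

context tree_model
begin

lemma flow_difference_le:
  assumes conv: "converges_below coeffs R" and \<theta>: "0 < \<theta>" "\<theta> < 1"
    and L: "\<And>p q. p \<in> phase_box R \<theta> \<Longrightarrow> q \<in> phase_box R \<theta> \<Longrightarrow>
        norm (accel (fst p) (snd p) - accel (fst q) (snd q)) \<le> L * dist p q"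
    and f: "flow t v \<Phi> \<Phi>'" and g: "flow t w \<Psi> \<Psi>'" and r: "r \<le> t"
    and box: "\<And>q s. q \<in> {0..r} \<Longrightarrow> \<Phi> q $ s \<le> \<theta> * R $ s" "\<And>q s. q \<in> {0..r} \<Longrightarrow> \<Psi> q $ s \<le> \<theta> * R $ s"
    and q: "q \<in> {0..r}"
  shows "norm (\<Phi> q - \<Psi> q, \<Phi>' q - \<Psi>' q) \<le> norm (v - w) * exp ((1 + L) * q)"
proof -
  have sub: "{0..r} \<subseteq> {0..t}" using r by auto
  have "norm (\<Phi> q - \<Psi> q, \<Phi>' q - \<Psi>' q) \<le> norm (\<Phi> 0 - \<Psi> 0, \<Phi>' 0 - \<Psi>' 0) * exp ((1 + L) * q)"
  proof (rule gronwall_norm[OF _ _ q])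
    fix p assume p: "p \<in> {0..r}"
    then have pt: "p \<in> {0..t}" using sub by blast
    show "((\<lambda>q. (\<Phi> q - \<Psi> q, \<Phi>' q - \<Psi>' q)) has_vector_derivative
        (\<Phi>' p - \<Psi>' p, accel (\<Phi> p) (\<Phi>' p) - accel (\<Psi> p) (\<Psi>' p))) (at p within {0..r})"
      by (intro has_vector_derivative_Pair has_vector_derivative_diff
            has_vector_derivative_within_subset[OF _ sub] flowD(5,6)[OF f pt] flowD(5,6)[OF g pt])
    have "(\<Phi> p, \<Phi>' p) \<in> phase_box R \<theta>" "(\<Psi> p, \<Psi>' p) \<in> phase_box R \<theta>"
      using box[OF p] flow_nonneg[OF f pt] flow_nonneg[OF g pt] flowD(4)[OF f pt] flowD(4)[OF g pt]
      by (auto simp: phase_box_def)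
    from L[OF this] have "norm (accel (\<Phi> p) (\<Phi>' p) - accel (\<Psi> p) (\<Psi>' p))
        \<le> L * norm (\<Phi> p - \<Psi> p, \<Phi>' p - \<Psi>' p)"
      by (simp add: dist_norm)
    moreover have "norm (\<Phi>' p - \<Psi>' p) \<le> norm (\<Phi> p - \<Psi> p, \<Phi>' p - \<Psi>' p)" by (rule norm_snd_le)
    ultimately show "norm (\<Phi>' p - \<Psi>' p, accel (\<Phi> p) (\<Phi>' p) - accel (\<Psi> p) (\<Psi>' p))
        \<le> (1 + L) * norm (\<Phi> p - \<Psi> p, \<Phi>' p - \<Psi>' p)"
      using norm_Pair_le[of "\<Phi>' p - \<Psi>' p" "accel (\<Phi> p) (\<Phi>' p) - accel (\<Psi> p) (\<Psi>' p)"]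
      by (simp add: distrib_right)
  qed
  then show ?thesis using flowD(1,2)[OF f] flowD(1,2)[OF g] by (simp add: norm_Pair)
qed

text \<open>
  The neighbouring solution is not known in advance to remain in the box on which \<open>accel\<close> is Lipschitz.
  As long as it does, Gronwall's inequality keeps it at distance less than \<open>d\<close> from \<open>\<Phi>\<close>, hence strictly
  inside the box; so it never leaves.
\<close>

lemma flow_dependence:
  assumes f: "flow t v \<Phi> \<Phi>'" and t: "0 < t"
  obtains C \<delta> where "0 \<le> C" "0 < \<delta>" "\<And>w \<Psi> \<Psi>'. flow t w \<Psi> \<Psi>' \<Longrightarrow> norm (v - w) < \<delta> \<Longrightarrow>
    norm (\<Phi> t - \<Psi> t) \<le> C * norm (v - w)"
proof -
  have tt: "t \<in> {0..t}" using t by simp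
  obtain R where conv: "converges_below coeffs R" and lt: "\<And>s. \<bar>\<Phi> t $ s\<bar> < R $ s"
    using xi_domainE[OF flowD(3)[OF f tt]] by blast
  obtain \<theta>0 where \<theta>0: "0 < \<theta>0" "\<theta>0 < 1" "\<And>s. \<bar>\<Phi> t $ s\<bar> < \<theta>0 * R $ s"
    using box_scale[OF lt] by metis
  define \<theta> where "\<theta> = (1 + \<theta>0) / 2"
  have \<theta>: "0 < \<theta>" "\<theta> < 1" "\<theta>0 < \<theta>" using \<theta>0 by (auto simp: \<theta>_def)
  note Rpos = converges_belowD(3)[OF conv]
  define d where "d = Min (range (\<lambda>s. (\<theta> - \<theta>0) * R $ s))"
  have d: "0 < d" unfolding d_def using \<theta> Rpos by (subst Min_gr_iff) auto
  have d_le: "d \<le> (\<theta> - \<theta>0) * R $ s" for s unfolding d_def by (rule Min_le) auto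
  obtain L where L: "0 \<le> L" "\<And>p q. p \<in> phase_box R \<theta> \<Longrightarrow> q \<in> phase_box R \<theta> \<Longrightarrow>
        norm (accel (fst p) (snd p) - accel (fst q) (snd q)) \<le> L * dist p q"
    using accel_lipschitz[OF conv \<theta>(1,2)] by blast
  define C where "C = exp ((1 + L) * t)"
  have C: "0 < C" by (simp add: C_def)
  have \<Phi>box: "\<Phi> q $ s < \<theta>0 * R $ s" if "q \<in> {0..t}" for q s
    using flow_mono[OF f, of q t s] \<theta>0(3)[of s] that by auto
  have \<theta>R: "\<theta>0 * R $ s \<le> \<theta> * R $ s" for s using \<theta>(3) Rpos[of s] by (intro mult_right_mono) auto
  have \<Phi>le: "\<Phi> q $ s \<le> \<theta> * R $ s" if "q \<in> {0..t}" for q s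
    using \<Phi>box[OF that, of s] \<theta>R[of s] by linarith
  show ?thesis
  proof (rule that[of C "d / C"])
    fix w \<Psi> \<Psi>' assume g: "flow t w \<Psi> \<Psi>'" and near: "norm (v - w) < d / C"
    have C\<delta>: "C * norm (v - w) < d" using near C by (simp add: field_simps)
    have close: "norm (\<Phi> r - \<Psi> r) \<le> C * norm (v - w)"
      if r: "r \<in> {0..t}" and bx: "\<And>q s. q \<in> {0..r} \<Longrightarrow> \<Psi> q $ s \<le> \<theta> * R $ s" for r
    proof -
      have "norm (\<Phi> r - \<Psi> r, \<Phi>' r - \<Psi>' r) \<le> norm (v - w) * exp ((1 + L) * r)"
        by (rule flow_difference_le[OF conv \<theta>(1,2) L(2) f g])
           (use r bx \<Phi>le in auto)
      also have "\<dots> \<le> norm (v - w) * C" unfolding C_def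
        using r L(1) by (intro mult_left_mono) (auto intro: mult_left_mono)
      finally show ?thesis using norm_fst_le[of "\<Phi> r - \<Psi> r" "\<Phi>' r - \<Psi>' r"] by (simp add: mult.commute)
    qed
    have cont: "continuous (at q within {0..t}) (\<lambda>p. \<Psi> p $ s)" if "q \<in> {0..t}" for q s
      by (rule DERIV_continuous[OF has_vector_derivative_component[OF flowD(5)[OF g that]]])
    have inbox: "\<forall>s. \<Psi> q $ s \<le> \<theta> * R $ s" if "q \<in> {0..t}" for q
    proof (rule interval_induct[where P = "\<lambda>q. \<forall>s. \<Psi> q $ s \<le> \<theta> * R $ s" and a = 0 and b = t])
      show "\<forall>s. \<Psi> 0 $ s \<le> \<theta> * R $ s" using flowD(1)[OF g] \<theta> Rpos by (simp add: less_imp_le)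
      show "q \<in> {0..t}" by fact
    next
      fix q assume q: "0 < q" "q \<le> t" and IH: "\<And>p. 0 \<le> p \<Longrightarrow> p < q \<Longrightarrow> \<forall>s. \<Psi> p $ s \<le> \<theta> * R $ s"
      have qt: "q \<in> {0..t}" using q by auto
      show "\<forall>s. \<Psi> q $ s \<le> \<theta> * R $ s"
      proof
        fix s show "\<Psi> q $ s \<le> \<theta> * R $ s"
          by (rule continuous_le_from_left[OF cont[OF qt] q]) (use IH in blast)
      qed
    next
      fix q assume q: "0 \<le> q" "q < t" and IH: "\<And>p. 0 \<le> p \<Longrightarrow> p \<le> q \<Longrightarrow> \<forall>s. \<Psi> p $ s \<le> \<theta> * R $ s"
      have qt: "q \<in> {0..t}" using q by auto
      have "norm (\<Phi> q - \<Psi> q) < d" using close[OF qt] IH C\<delta> by force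
      then have "\<Psi> q $ s < \<theta> * R $ s" for s
        using component_le_norm_cart[of "\<Phi> q - \<Psi> q" s] \<Phi>box[OF qt, of s] d_le[of s]
        by (simp add: left_diff_distrib)
      then obtain e where "0 < e" "\<forall>p\<in>{0..t}. \<bar>p - q\<bar> < e \<longrightarrow> (\<forall>s. \<Psi> p $ s < \<theta> * R $ s)"
        using continuous_less_nearby[of q "{0..t}" "\<lambda>s p. \<Psi> p $ s" "\<lambda>s. \<theta> * R $ s"] cont[OF qt] by blast
      then show "\<exists>e>0. \<forall>p\<in>{0..t}. \<bar>p - q\<bar> < e \<longrightarrow> (\<forall>s. \<Psi> p $ s \<le> \<theta> * R $ s)"
        by (intro exI[of _ e]) (auto intro: less_imp_le)
    qed
    show "norm (\<Phi> t - \<Psi> t) \<le> C * norm (v - w)" by (rule close[OF tt]) (use inbox in blast)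
  qed (use C d in auto)
qed

lemma flow_unique:
  assumes "flow t v \<Phi> \<Phi>'" "flow t v \<Psi> \<Psi>'" "0 < t"
  shows "\<Psi> t = \<Phi> t"
proof -
  obtain C \<delta> where "0 \<le> C" "0 < \<delta>" and C: "\<And>w \<Psi> \<Psi>'. flow t w \<Psi> \<Psi>' \<Longrightarrow> norm (v - w) < \<delta> \<Longrightarrow>
    norm (\<Phi> t - \<Psi> t) \<le> C * norm (v - w)"
    using flow_dependence[OF assms(1,3)] by blast
  then have "norm (\<Phi> t - \<Psi> t) \<le> 0" using C[OF assms(2)] by simp
  then show ?thesis by simp
qed

lemma tree_map_eq:
  assumes f: "flow t v \<Phi> \<Phi>'" and t: "0 < t"
  shows "tree_map lam gam t v = (1 / t) *\<^sub>R \<Phi> t"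
  unfolding tree_map_def
proof (rule the_equality)
  show "\<exists>\<Psi>. tree_descending_solution lam gam v t \<Psi> \<and> (1 / t) *\<^sub>R \<Phi> t = (1 / t) *\<^sub>R \<Psi> t"
    using flow_imp_solution[OF f t] by blast
  fix y assume "\<exists>\<Psi>. tree_descending_solution lam gam v t \<Psi> \<and> y = (1 / t) *\<^sub>R \<Psi> t"
  then obtain \<Psi> where \<Psi>: "tree_descending_solution lam gam v t \<Psi>" "y = (1 / t) *\<^sub>R \<Psi> t" by blast
  have "v \<in> weighted_simplex lam" using flowD(2,4)[OF f] t by (metis atLeastAtMost_iff less_imp_le order_refl)
  then obtain \<Psi>' where "flow t v \<Psi> \<Psi>'" using solution_imp_flow[OF \<Psi>(1) t] by blast
  then show "y = (1 / t) *\<^sub>R \<Phi> t" using flow_unique[OF f _ t] \<Psi>(2) by simp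
qed

lemma flow_scaled_in_simplex:
  assumes f: "flow t v \<Phi> \<Phi>'" and t: "0 < t"
  shows "(1 / t) *\<^sub>R \<Phi> t \<in> weighted_simplex lam"
proof -
  have tt: "t \<in> {0..t}" using t by simp
  have "(\<Sum>s\<in>UNIV. lam $ s * ((1 / t) *\<^sub>R \<Phi> t) $ s) = (1 / t) * (\<Sum>s\<in>UNIV. lam $ s * \<Phi> t $ s)"
    by (simp add: sum_distrib_left mult_ac)
  then show ?thesis
    using flow_nonneg[OF f tt] t unfolding weighted_simplex_iff flow_weighted_sum[OF f tt] by simp
qed

lemma flow_preserves_faces:
  assumes f: "flow t v \<Phi> \<Phi>'" and t: "0 < t" and v: "v $ s = 0"
  shows "\<Phi> t $ s = 0"
proof -
  have tt: "t \<in> {0..t}" using t by simp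
  obtain R where conv: "converges_below coeffs R" and lt: "\<And>s. \<bar>\<Phi> t $ s\<bar> < R $ s"
    using xi_domainE[OF flowD(3)[OF f tt]] by blast
  obtain \<theta> where \<theta>: "0 < \<theta>" "\<theta> < 1" "\<And>s. \<bar>\<Phi> t $ s\<bar> < \<theta> * R $ s"
    using box_scale[OF lt] by metis
  have box: "(\<Phi> q, \<Phi>' q) \<in> phase_box R \<theta>" if q: "q \<in> {0..t}" for q
  proof -
    have "\<Phi> q $ s \<le> \<theta> * R $ s" for s
      using flow_mono[OF f, of q t s] \<theta>(3)[of s] q by auto
    then show ?thesis using flow_nonneg[OF f q] flowD(4)[OF f q] by (auto simp: phase_box_def)
  qed
  obtain C where C: "0 \<le> C" "\<And>p. p \<in> phase_box R \<theta> \<Longrightarrow> \<bar>accel (fst p) (snd p) $ s\<bar> \<le> C * snd p $ s"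
    using accel_le_velocity[OF conv \<theta>(1,2)] by blast
  have zero: "\<Phi>' q $ s = 0" if q: "q \<in> {0..t}" for q
  proof -
    have "norm (\<Phi>' q $ s) \<le> norm (\<Phi>' 0 $ s) * exp (C * q)"
    proof (rule gronwall_norm[OF _ _ q])
      fix p assume p: "p \<in> {0..t}"
      show "((\<lambda>q. \<Phi>' q $ s) has_vector_derivative accel (\<Phi> p) (\<Phi>' p) $ s) (at p within {0..t})"
        by (rule bounded_linear.has_vector_derivative[OF bounded_linear_vec_nth flowD(6)[OF f p]])
      show "norm (accel (\<Phi> p) (\<Phi>' p) $ s) \<le> C * norm (\<Phi>' p $ s)"
        using C(2)[OF box[OF p]] simplexD(1)[OF flowD(4)[OF f p], of s] by simp
    qed
    then show ?thesis using v flowD(2)[OF f] by simp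
  qed
  have "((\<lambda>q. \<Phi> q $ s) has_real_derivative 0) (at q within {0..t})" if q: "q \<in> {0..t}" for q
    using has_vector_derivative_component[OF flowD(5)[OF f q], of s] zero[OF q] by simp
  from constant_within[OF this, of t] show ?thesis using t flowD(1)[OF f] by simp
qed

lemma tree_map_surjective:
  assumes t: "0 < t" and tmd: "tree_map_defined lam gam t"
  shows "tree_map lam gam t ` weighted_simplex lam = weighted_simplex lam"
proof (rule face_preserving_surjective[OF lam_pos])
  have ex: "\<exists>\<Phi> \<Phi>'. flow t v \<Phi> \<Phi>'" if v: "v \<in> weighted_simplex lam" for v
    using tmd solution_imp_flow[OF _ t v] v unfolding tree_map_defined_def by blast
  show "tree_map lam gam t \<in> weighted_simplex lam \<rightarrow> weighted_simplex lam"
    using ex tree_map_eq[OF _ t] flow_scaled_in_simplex[OF _ t] by fastforce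
  show "tree_map lam gam t v $ s = 0" if v: "v \<in> weighted_simplex lam" "v $ s = 0" for v s
  proof -
    obtain \<Phi> \<Phi>' where f: "flow t v \<Phi> \<Phi>'" using ex[OF v(1)] by blast
    show ?thesis unfolding tree_map_eq[OF f t] using flow_preserves_faces[OF f t v(2)] by simp
  qed
  show "continuous_on (weighted_simplex lam) (tree_map lam gam t)"
    unfolding continuous_on_iff
  proof (intro ballI allI impI)
    fix v and e :: real assume v: "v \<in> weighted_simplex lam" and e: "0 < e"
    obtain \<Phi> \<Phi>' where f: "flow t v \<Phi> \<Phi>'" using ex[OF v] by blast
    obtain C \<delta> where C: "0 \<le> C" "0 < \<delta>" "\<And>w \<Psi> \<Psi>'. flow t w \<Psi> \<Psi>' \<Longrightarrow> norm (v - w) < \<delta> \<Longrightarrow>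
      norm (\<Phi> t - \<Psi> t) \<le> C * norm (v - w)"
      using flow_dependence[OF f t] by blast
    show "\<exists>d>0. \<forall>w\<in>weighted_simplex lam. dist w v < d \<longrightarrow> dist (tree_map lam gam t w) (tree_map lam gam t v) < e"
    proof (intro exI[of _ "min \<delta> (e * t / (C + 1))"] conjI ballI impI)
      show "0 < min \<delta> (e * t / (C + 1))" using C e t by simp
      fix w assume w: "w \<in> weighted_simplex lam" and near: "dist w v < min \<delta> (e * t / (C + 1))"
      obtain \<Psi> \<Psi>' where g: "flow t w \<Psi> \<Psi>'" using ex[OF w] by blast
      have nw: "norm (v - w) < \<delta>" "norm (v - w) < e * t / (C + 1)"
        using near by (auto simp: dist_norm norm_minus_commute)
      have "norm (\<Phi> t - \<Psi> t) \<le> C * norm (v - w)" by (rule C(3)[OF g nw(1)])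
      also have "\<dots> \<le> (C + 1) * norm (v - w)" by (intro mult_right_mono) auto
      also have "\<dots> < e * t" using nw(2) C(1) by (simp add: field_simps)
      finally have "norm (\<Phi> t - \<Psi> t) / t < e" using t by (simp add: field_simps)
      moreover have "dist (tree_map lam gam t w) (tree_map lam gam t v) = norm (\<Phi> t - \<Psi> t) / t"
        unfolding tree_map_eq[OF f t] tree_map_eq[OF g t] dist_norm scaleR_diff_right[symmetric]
        using t by (simp add: norm_minus_commute)
      ultimately show "dist (tree_map lam gam t w) (tree_map lam gam t v) < e" by simp
    qed
  qed
qed

section \<open>Small times\<close>

text \<open>
  The acceleration is extended to all positions and velocities by composing it with the closest-point
  projections, and the extended equation is solved by contraction. Its solution stays in the
  original phase space: the weighted sum of the velocities is conserved, and a negative velocity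
  would be stationary by \<open>closest_point_simplex_zero\<close> and \<open>accel_le_velocity\<close>.
\<close>

lemma flow_exists:
  assumes L: "0 \<le> L" "\<And>p q. p \<in> phase_box 1 (1/2) \<Longrightarrow> q \<in> phase_box 1 (1/2) \<Longrightarrow>
        norm (accel (fst p) (snd p) - accel (fst q) (snd q)) \<le> L * dist p q"
    and t: "0 < t" "(1 + L) * t < 1" "\<And>s. t / lam $ s \<le> 1 / 2" and v: "v \<in> weighted_simplex lam"
  shows "\<exists>\<Phi> \<Phi>'. flow t v \<Phi> \<Phi>'"
proof -
  let ?S = "weighted_simplex lam"
  let ?X = "{x::real^'s. \<forall>s. 0 \<le> x $ s \<and> x $ s \<le> 1 / 2}"
  have half: "0 < (1/2::real)" "(1/2::real) < 1" by auto
  note unit = converges_below_unit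
  have X: "?X = cbox 0 (\<chi> s. 1 / 2)" by (auto simp: mem_box_cart)
  have "convex ?X" "closed ?X" unfolding X by (rule convex_box closed_cbox)+
  moreover have "0 \<in> ?X" by simp
  ultimately have Xp: "convex ?X" "closed ?X" "?X \<noteq> {}" by blast+
  have Sp: "convex ?S" "closed ?S" "?S \<noteq> {}"
    using convex_weighted_simplex[OF lam_pos] compact_imp_closed[OF compact_weighted_simplex[OF lam_pos]] v by auto
  define P where "P z = (closest_point ?X (fst z), closest_point ?S (snd z))" for z
  have P: "P z \<in> phase_box 1 (1/2)" for z
    using closest_point_in_set[OF Xp(2,3), of "fst z"] closest_point_in_set[OF Sp(2,3), of "snd z"]
    unfolding P_def phase_box_def by simp
  have Plip: "dist (P y) (P z) \<le> dist y z" for y z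
    unfolding P_def dist_prod_def fst_conv snd_conv
    by (intro real_sqrt_le_mono add_mono power_mono closest_point_lipschitz Xp Sp) auto
  define f where "f z = (snd z, accel (fst (P z)) (snd (P z)))" for z
  have lip: "norm (f y - f z) \<le> (1 + L) * norm (y - z)" for y z
  proof -
    have "norm (f y - f z) \<le> norm (snd y - snd z)
        + norm (accel (fst (P y)) (snd (P y)) - accel (fst (P z)) (snd (P z)))"
      unfolding f_def by (simp add: norm_Pair_le)
    also have "\<dots> \<le> dist y z + L * dist (P y) (P z)"
      using dist_snd_le[of y z] L(2)[OF P[of y] P[of z]] by (intro add_mono) (simp_all add: dist_norm)
    also have "\<dots> \<le> dist y z + L * dist y z" using Plip[of y z] L(1) by (intro add_left_mono mult_left_mono)
    finally show ?thesis by (simp add: dist_norm distrib_right)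
  qed
  obtain z where z0: "z 0 = (0, v)" and
    dz: "\<And>q. q \<in> {0..t} \<Longrightarrow> (z has_vector_derivative f (z q)) (at q within {0..t})"
    using picard_lipschitz[OF lip t(1,2)] by metis
  define \<Phi> where "\<Phi> q = fst (z q)" for q
  define \<Phi>' where "\<Phi>' q = snd (z q)" for q
  define a where "a q = accel (fst (P (z q))) (snd (P (z q)))" for q
  have d1: "(\<Phi> has_vector_derivative \<Phi>' q) (at q within {0..t})" if "q \<in> {0..t}" for q
    using bounded_linear.has_vector_derivative[OF bounded_linear_fst dz[OF that]]
    by (simp add: \<Phi>_def[abs_def] \<Phi>'_def f_def)
  have d2: "(\<Phi>' has_vector_derivative a q) (at q within {0..t})" if "q \<in> {0..t}" for q
    using bounded_linear.has_vector_derivative[OF bounded_linear_snd dz[OF that]]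
    by (simp add: \<Phi>'_def[abs_def] a_def f_def)
  have \<Phi>0: "\<Phi> 0 = 0" "\<Phi>' 0 = v" using z0 by (auto simp: \<Phi>_def \<Phi>'_def)
  have asum: "(\<Sum>s\<in>UNIV. lam $ s * a q $ s) = 0" for q
    unfolding a_def by (rule accel(1)[OF unit phase_boxD[OF unit half P]])
  have sum1: "(\<Sum>s\<in>UNIV. lam $ s * \<Phi>' q $ s) = 1" if q: "q \<in> {0..t}" for q
  proof -
    have "((\<lambda>q. \<Sum>s\<in>UNIV. lam $ s * \<Phi>' q $ s) has_real_derivative (\<Sum>s\<in>UNIV. lam $ s * a p $ s)) (at p within {0..t})"
      if "p \<in> {0..t}" for p
      by (intro DERIV_sum DERIV_cmult has_vector_derivative_component d2 that)
    from constant_within[OF this[unfolded asum], of q] q show ?thesis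
      using \<Phi>0(2) simplexD(2)[OF v] by simp
  qed
  have pos: "0 \<le> \<Phi>' q $ s" if q: "q \<in> {0..t}" for q s
  proof (rule nonneg_if_stationary_below[where y' = "\<lambda>q. a q $ s", OF _ _ _ q])
    show "((\<lambda>q. \<Phi>' q $ s) has_real_derivative a p $ s) (at p within {0..t})" if "p \<in> {0..t}" for p
      by (rule has_vector_derivative_component[OF d2[OF that]])
    show "0 \<le> \<Phi>' 0 $ s" using \<Phi>0(2) simplexD(1)[OF v] by simp
    fix p assume p: "p \<in> {0..t}" "\<Phi>' p $ s < 0"
    obtain C where C: "0 \<le> C" "\<And>p. p \<in> phase_box 1 (1/2) \<Longrightarrow> \<bar>accel (fst p) (snd p) $ s\<bar> \<le> C * snd p $ s"
      using accel_le_velocity[OF unit half] by blast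
    have "snd (P (z p)) $ s = 0"
      unfolding P_def snd_conv using closest_point_simplex_zero[OF lam_pos sum1[OF p(1)] p(2) Sp(3)]
      by (simp add: \<Phi>'_def)
    then show "a p $ s = 0" using C(2)[OF P[of "z p"]] by (simp add: a_def)
  qed
  have vsimplex: "\<Phi>' q \<in> ?S" if "q \<in> {0..t}" for q
    using pos[OF that] sum1[OF that] by (simp add: weighted_simplex_iff)
  have nn: "0 \<le> \<Phi> q $ s" if q: "q \<in> {0..t}" for q s
  proof -
    have "\<Phi> 0 $ s \<le> \<Phi> q $ s"
      by (rule nondecreasing_within[where f = "\<lambda>q. \<Phi> q $ s" and f' = "\<lambda>q. \<Phi>' q $ s" and a = 0 and b = t])
         (use q pos d1 in \<open>auto intro: has_vector_derivative_component\<close>)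
    then show ?thesis using \<Phi>0 by simp
  qed
  have sum\<Phi>: "(\<Sum>s\<in>UNIV. lam $ s * \<Phi> q $ s) - q = 0" if q: "q \<in> {0..t}" for q
  proof -
    have "((\<lambda>q. (\<Sum>s\<in>UNIV. lam $ s * \<Phi> q $ s) - q) has_real_derivative 0) (at p within {0..t})"
      if p: "p \<in> {0..t}" for p
    proof -
      have "((\<lambda>q. (\<Sum>s\<in>UNIV. lam $ s * \<Phi> q $ s) - q) has_real_derivative
          (\<Sum>s\<in>UNIV. lam $ s * \<Phi>' p $ s) - 1) (at p within {0..t})"
        by (intro DERIV_diff DERIV_sum DERIV_cmult has_vector_derivative_component d1 p DERIV_ident)
      then show ?thesis using sum1[OF p] by simp
    qed
    from constant_within[OF this, of q] q \<Phi>0 show ?thesis by simp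
  qed
  have le: "\<Phi> q $ s \<le> 1 / 2" if q: "q \<in> {0..t}" for q s
  proof -
    have "lam $ s * \<Phi> q $ s \<le> (\<Sum>s\<in>UNIV. lam $ s * \<Phi> q $ s)"
      using nn[OF q] lam_pos by (intro member_le_sum) (auto simp: less_imp_le)
    then have "\<Phi> q $ s \<le> t / lam $ s"
      using sum\<Phi>[OF q] q lam_pos[of s] by (simp add: field_simps)
    then show ?thesis using t(3)[of s] by linarith
  qed
  have Pz: "P (z q) = (\<Phi> q, \<Phi>' q)" if q: "q \<in> {0..t}" for q
    unfolding P_def using nn[OF q] le[OF q] vsimplex[OF q]
    by (simp add: closest_point_self \<Phi>_def \<Phi>'_def)
  have "\<Phi> q \<in> xi_domain lam gam" if q: "q \<in> {0..t}" for q
  proof (rule xi_domainI[OF unit])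
    show "\<bar>\<Phi> q $ s\<bar> < 1 $ s" for s using nn[OF q, of s] le[OF q, of s] by simp
  qed
  moreover have "(\<Phi>' has_vector_derivative accel (\<Phi> q) (\<Phi>' q)) (at q within {0..t})" if "q \<in> {0..t}" for q
    using d2[OF that] by (simp add: a_def Pz[OF that])
  ultimately show ?thesis using \<Phi>0 vsimplex d1 unfolding flow_def by blast
qed

text \<open>
  For small \<open>t\<close> the displacement difference of two solutions is \<open>t (v - w)\<close> up to an error of at most
  \<open>3 L t\<^sup>2 \<bar>v - w\<bar>\<close>, so distinct initial velocities have distinct images.
\<close>

lemma small_time:
  "\<exists>\<epsilon>>0. \<forall>t\<in>{0<..\<epsilon>}. tree_map_defined lam gam t \<and>
      tree_map lam gam t \<in> weighted_simplex lam \<rightarrow> weighted_simplex lam \<and>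
      inj_on (tree_map lam gam t) (weighted_simplex lam)"
proof -
  have half: "0 < (1/2::real)" "(1/2::real) < 1" by auto
  obtain L where L: "0 \<le> L" "\<And>p q. p \<in> phase_box 1 (1/2) \<Longrightarrow> q \<in> phase_box 1 (1/2) \<Longrightarrow>
        norm (accel (fst p) (snd p) - accel (fst q) (snd q)) \<le> L * dist p q"
    using accel_lipschitz[OF converges_below_unit half] by blast
  \<comment> \<open>The first bound on the time makes both the Picard operator contracting and \<open>3 L t < 1\<close>; the second
     keeps the solutions in the box \<open>[0,1/2]\<close>.\<close>
  define \<epsilon> where "\<epsilon> = min (1 / (4 * (1 + L))) (Min (range (($) lam)) / 2)"
  have \<epsilon>: "0 < \<epsilon>" unfolding \<epsilon>_def using L(1) Min_lam_pos by simp
  have main: "tree_map_defined lam gam t \<and>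
      tree_map lam gam t \<in> weighted_simplex lam \<rightarrow> weighted_simplex lam \<and>
      inj_on (tree_map lam gam t) (weighted_simplex lam)" if t: "t \<in> {0<..\<epsilon>}" for t
  proof -
    have t0: "0 < t" using t by simp
    have "t \<le> 1 / (4 * (1 + L))" using t by (simp add: \<epsilon>_def)
    then have tL: "(1 + L) * t \<le> 1 / 4" using L(1) by (simp add: field_simps)
    have tlam: "t / lam $ s \<le> 1 / 2" for s
    proof -
      have "Min (range (($) lam)) \<le> lam $ s" by (rule Min_le) auto
      then have "t \<le> lam $ s / 2" using t by (simp add: \<epsilon>_def)
      then show ?thesis using lam_pos[of s] by (simp add: field_simps)
    qed
    have ex: "\<exists>\<Phi> \<Phi>'. flow t v \<Phi> \<Phi>'" if "v \<in> weighted_simplex lam" for v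
      by (rule flow_exists[OF L t0 _ tlam that]) (use tL in auto)
    have tmd: "tree_map_defined lam gam t"
      unfolding tree_map_defined_def using ex flow_imp_solution[OF _ t0] by blast
    have "inj_on (tree_map lam gam t) (weighted_simplex lam)"
    proof (rule inj_onI)
      fix v w assume v: "v \<in> weighted_simplex lam" and w: "w \<in> weighted_simplex lam"
        and eq: "tree_map lam gam t v = tree_map lam gam t w"
      obtain \<Phi> \<Phi>' where f: "flow t v \<Phi> \<Phi>'" using ex[OF v] by blast
      obtain \<Psi> \<Psi>' where g: "flow t w \<Psi> \<Psi>'" using ex[OF w] by blast
      have same: "\<Phi> t = \<Psi> t"
        using eq t0 unfolding tree_map_eq[OF f t0] tree_map_eq[OF g t0] by simp
      have box: "\<Theta> q $ s \<le> 1 / 2 * 1 $ s" if "flow t u \<Theta> \<Theta>'" "q \<in> {0..t}" for u \<Theta> \<Theta>' q s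
      proof -
        have "\<Theta> q $ s \<le> q / lam $ s" by (rule flow_le[OF that])
        also have "\<dots> \<le> t / lam $ s" using that lam_pos[of s] by (intro divide_right_mono) auto
        also have "\<dots> \<le> 1 / 2" by (rule tlam)
        finally show ?thesis by simp
      qed
      define N where "N = norm (v - w)"
      have diff: "norm (\<Phi> q - \<Psi> q, \<Phi>' q - \<Psi>' q) \<le> 3 * N" if q: "q \<in> {0..t}" for q
      proof -
        have "norm (\<Phi> q - \<Psi> q, \<Phi>' q - \<Psi>' q) \<le> N * exp ((1 + L) * q)"
          unfolding N_def
          by (rule flow_difference_le[OF converges_below_unit half L(2) f g order_refl box[OF f] box[OF g] q])
        also have "\<dots> \<le> N * exp 1"
        proof -
          have "(1 + L) * q \<le> (1 + L) * t" using q L(1) by (intro mult_left_mono) auto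
          then show ?thesis using tL by (intro mult_left_mono) (auto simp: N_def)
        qed
        also have "\<dots> \<le> N * 3" using exp_le by (intro mult_left_mono) (auto simp: N_def)
        finally show ?thesis by simp
      qed
      have dv: "norm ((\<Phi>' q - \<Psi>' q) - (v - w)) \<le> 3 * L * N * t" if q: "q \<in> {0..t}" for q
      proof -
        have "norm ((\<Phi>' q - \<Psi>' q) - (\<Phi>' 0 - \<Psi>' 0)) \<le> (L * (3 * N)) * q"
        proof (rule vector_mean_value[OF _ _ q])
          fix p assume p: "p \<in> {0..t}"
          show "((\<lambda>q. \<Phi>' q - \<Psi>' q) has_vector_derivative accel (\<Phi> p) (\<Phi>' p) - accel (\<Psi> p) (\<Psi>' p)) (at p within {0..t})"
            by (intro has_vector_derivative_diff flowD(6)[OF f p] flowD(6)[OF g p])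
          have "(\<Phi> p, \<Phi>' p) \<in> phase_box 1 (1/2)" "(\<Psi> p, \<Psi>' p) \<in> phase_box 1 (1/2)"
            using box[OF f p] box[OF g p] flow_nonneg[OF f p] flow_nonneg[OF g p] flowD(4)[OF f p] flowD(4)[OF g p]
            by (auto simp: phase_box_def)
          from L(2)[OF this] have "norm (accel (\<Phi> p) (\<Phi>' p) - accel (\<Psi> p) (\<Psi>' p))
              \<le> L * norm (\<Phi> p - \<Psi> p, \<Phi>' p - \<Psi>' p)" by (simp add: dist_norm)
          also have "\<dots> \<le> L * (3 * N)" using diff[OF p] L(1) by (rule mult_left_mono)
          finally show "norm (accel (\<Phi> p) (\<Phi>' p) - accel (\<Psi> p) (\<Psi>' p)) \<le> L * (3 * N)" .
        qed
        also have "\<dots> \<le> (L * (3 * N)) * t" using q L(1) by (intro mult_left_mono) (auto simp: N_def)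
        finally show ?thesis using flowD(2)[OF f] flowD(2)[OF g] by simp
      qed
      have "norm (((\<Phi> t - \<Psi> t) - t *\<^sub>R (v - w)) - ((\<Phi> 0 - \<Psi> 0) - 0 *\<^sub>R (v - w))) \<le> (3 * L * N * t) * t"
      proof (rule vector_mean_value[where f = "\<lambda>q. (\<Phi> q - \<Psi> q) - q *\<^sub>R (v - w)"])
        fix p assume p: "p \<in> {0..t}"
        have "((\<lambda>q. (\<Phi> q - \<Psi> q) - q *\<^sub>R (v - w)) has_vector_derivative (\<Phi>' p - \<Psi>' p) - 1 *\<^sub>R (v - w)) (at p within {0..t})"
          by (intro has_vector_derivative_diff flowD(5)[OF f p] flowD(5)[OF g p])
             (auto intro!: derivative_eq_intros)
        then show "((\<lambda>q. (\<Phi> q - \<Psi> q) - q *\<^sub>R (v - w)) has_vector_derivative (\<Phi>' p - \<Psi>' p) - (v - w)) (at p within {0..t})"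
          by simp
        show "norm ((\<Phi>' p - \<Psi>' p) - (v - w)) \<le> 3 * L * N * t" by (rule dv[OF p])
      qed (use t0 in auto)
      then have "t * N \<le> (3 * L * N * t) * t"
        using same flowD(1)[OF f] flowD(1)[OF g] t0 by (simp add: N_def norm_minus_commute)
      then have "t * (N * (1 - 3 * (L * t))) \<le> 0" by (simp add: algebra_simps)
      moreover have "0 < 1 - 3 * (L * t)" using tL t0 by (simp add: distrib_right)
      ultimately have "N \<le> 0" using t0 by (simp add: mult_le_0_iff)
      then show "v = w" by (simp add: N_def)
    qed
    moreover have "tree_map lam gam t \<in> weighted_simplex lam \<rightarrow> weighted_simplex lam"
      using tree_map_surjective[OF t0 tmd] by blast
    ultimately show ?thesis using tmd by blast
  qed
  then show ?thesis using \<epsilon> by blast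
qed

end

section \<open>Injectivity and surjectivity\<close>

theorem proposition1p12:
  fixes lam :: "real^'s::finite"
    and gam :: "'s list \<Rightarrow> real"
  assumes lam_pos: "\<forall>s. lam $ s > 0"
    and lam_sum: "(\<Sum>s\<in>UNIV. lam $ s) = 1"
    and gam_nonneg: "\<forall>ss. length ss \<ge> 2 \<longrightarrow> gam ss \<ge> 0"
    and gam_sym: "symmetric_tensors gam"
    and gam_summable: "summable (\<lambda>k. 2 ^ (k + 2) * tensor_sup_norm gam (k + 2))"
    and nondeg: "non_degenerate gam"
  shows "(\<exists>\<epsilon>>0. \<forall>t\<in>{0<..\<epsilon>}.
            tree_map_defined lam gam t \<and>
            tree_map lam gam t \<in> weighted_simplex lam \<rightarrow> weighted_simplex lam \<and>
            inj_on (tree_map lam gam t) (weighted_simplex lam)) \<and>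
         (\<forall>t>0. tree_map_defined lam gam t \<longrightarrow>
            tree_map lam gam t ` weighted_simplex lam = weighted_simplex lam)"
proof -
  interpret tree_model lam gam
    using assms by unfold_locales auto
  show ?thesis using small_time tree_map_surjective by blast
qed

end
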